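(* Let $\Bbbk$ be an algebraically closed field of characteristic $0$ and $H$ a finite-dimensional Hopf algebra over $\Bbbk$. Let $K$ be a finite-dimensional $H$-simple left $H$-comodule algebra and let $U$, $W$ be two finite-dimensional left $K$-modules. Then $$\dim K\,\dim \mathrm{Stab}_K(U,W)=\dim U\,\dim W\,\dim H.$$
   Context: A left $H$-comodule algebra is an algebra $K$ with a left $H$-coaction $k\mapsto k_{(-1)}\otimes k_{(0)}\in H\otimes K$ that is an algebra map. $K$ is $H$-simple if it has no non-trivial two-sided ideal that is an $H$-subcomodule. Let $\mathcal{S}$ be the antipode of $H$ and let $H$ act on $H^*$ by $\langle h\rightharpoondown\beta,a\rangle=\langle\beta,\mathcal{S}^{-1}(h)a\rangle$. For a left $K$-module $U$, $H^*\otimes U$ is a left $K$-module by $k\cdot(\beta\otimes u)=(k_{(-1)}\rightharpoondown\beta)\otimes k_{(0)}\cdot u$. Let $\mathcal{L}:H^*\otimes\mathrm{Hom}(U,W)\to\mathrm{Hom}(H^*\otimes U,H^*\otimes W)$ be $\mathcal{L}(\alpha\otimes f)(\beta\otimes u)=\alpha\beta\otimes f(u)$. The Yan–Zhu stabilizer of $U$ and $W$ is $$\mathrm{Stab}_K(U,W)=\mathrm{Hom}_K(H^*\otimes U,H^*\otimes W)\cap\mathcal{L}(H^*\otimes\mathrm{Hom}(U,W)).$$ *)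

theory Defs
  imports "HOL-Computational_Algebra.Computational_Algebra" "HOL-Library.Function_Algebras"
begin

section \<open>Vector spaces, linear maps and tensor products\<close>

text \<open>
  A vector space is a linear subspace \<open>car\<close> of a type carrying a scalar multiplication
  \<open>scl\<close>; this is needed because Hom spaces, duals and tensor products depend on the scalar
  multiplications and are therefore not types of their own.
\<close>

record ('k, 'v) vspace =
  scl :: "'k \<Rightarrow> 'v \<Rightarrow> 'v"
  car :: "'v set"

definition is_vspace :: "('k::field, 'v::ab_group_add) vspace \<Rightarrow> bool" where
  "is_vspace V \<longleftrightarrow> vector_space (scl V) \<and> module.subspace (scl V) (car V)"

definition full :: "('k \<Rightarrow> 'v \<Rightarrow> 'v) \<Rightarrow> ('k, 'v) vspace" where
  "full s = \<lparr>scl = s, car = UNIV\<rparr>"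

definition ground :: "('k::field, 'k) vspace" where
  "ground = full (*)"

definition finite_dim :: "('k::field \<Rightarrow> 'v::ab_group_add \<Rightarrow> 'v) \<Rightarrow> bool" where
  "finite_dim s \<longleftrightarrow> (\<exists>B. finite_dimensional_vector_space s B)"

definition lin ::
  "('k, 'v::ab_group_add) vspace \<Rightarrow> ('k, 'w::ab_group_add) vspace \<Rightarrow> ('v \<Rightarrow> 'w) \<Rightarrow> bool" where
  "lin V W f \<longleftrightarrow>
     (\<forall>x\<in>car V. f x \<in> car W) \<and>
     (\<forall>x\<in>car V. \<forall>y\<in>car V. f (x + y) = f x + f y) \<and>
     (\<forall>c. \<forall>x\<in>car V. f (scl V c x) = scl W c (f x))"

text \<open>
  A linear map is represented by the function that vanishes outside the carrier, so that equal maps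
  are equal as functions.
\<close>

definition Hom ::
  "('k, 'v::ab_group_add) vspace \<Rightarrow> ('k, 'w::ab_group_add) vspace \<Rightarrow> ('k, 'v \<Rightarrow> 'w) vspace" where
  "Hom V W = \<lparr>scl = (\<lambda>c f x. scl W c (f x)),
              car = {f. lin V W f \<and> (\<forall>x. x \<notin> car V \<longrightarrow> f x = 0)}\<rparr>"

definition dual :: "('k::field, 'v::ab_group_add) vspace \<Rightarrow> ('k, 'v \<Rightarrow> 'k) vspace" where
  "dual V = Hom V ground"

definition bilin ::
  "('k, 'v::ab_group_add) vspace \<Rightarrow> ('k, 'w::ab_group_add) vspace \<Rightarrow> ('k, 'x::ab_group_add) vspace
     \<Rightarrow> ('v \<Rightarrow> 'w \<Rightarrow> 'x) \<Rightarrow> bool" where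
  "bilin V W X \<phi> \<longleftrightarrow>
     (\<forall>v\<in>car V. lin W X (\<phi> v)) \<and> (\<forall>w\<in>car W. lin V X (\<lambda>v. \<phi> v w))"

text \<open>
  The tensor product is the quotient of the free vector space on pairs by the bilinearity relations.
  Its dual is the space of bilinear forms, so the quotient embeds into the space of functions
  on bilinear forms, a pure tensor being sent to evaluation at the given pair. This makes
  the tensor product a subspace of a type; its universal property is shown in
  \<open>tensor_universal\<close> below.
\<close>

definition pure ::
  "('k::field, 'v::ab_group_add) vspace \<Rightarrow> ('k, 'w::ab_group_add) vspace \<Rightarrow> 'v \<Rightarrow> 'w
     \<Rightarrow> ('v \<Rightarrow> 'w \<Rightarrow> 'k) \<Rightarrow> 'k" where
  "pure V W v w = (\<lambda>\<beta>. if bilin V W ground \<beta> then \<beta> v w else 0)"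

definition tensor ::
  "('k::field, 'v::ab_group_add) vspace \<Rightarrow> ('k, 'w::ab_group_add) vspace
     \<Rightarrow> ('k, ('v \<Rightarrow> 'w \<Rightarrow> 'k) \<Rightarrow> 'k) vspace" (infixr "\<otimes>\<^sub>v" 75) where
  "V \<otimes>\<^sub>v W = \<lparr>scl = (\<lambda>c t \<beta>. c * t \<beta>),
            car = module.span (\<lambda>c t \<beta>. c * t \<beta>) {pure V W v w |v w. v \<in> car V \<and> w \<in> car W}\<rparr>"

text \<open>The linear map on a tensor product determined by its values on pure tensors.\<close>

definition tlift ::
  "('k::field, 'v::ab_group_add) vspace \<Rightarrow> ('k, 'w::ab_group_add) vspace
     \<Rightarrow> ('k, 'x::ab_group_add) vspace \<Rightarrow> ('v \<Rightarrow> 'w \<Rightarrow> 'x) \<Rightarrow> (('v \<Rightarrow> 'w \<Rightarrow> 'k) \<Rightarrow> 'k) \<Rightarrow> 'x" where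
  "tlift V W X \<phi> =
     (THE f. f \<in> car (Hom (V \<otimes>\<^sub>v W) X) \<and> (\<forall>v\<in>car V. \<forall>w\<in>car W. f (pure V W v w) = \<phi> v w))"

definition tensor_map ::
  "('k::field, 'v::ab_group_add) vspace \<Rightarrow> ('k, 'w::ab_group_add) vspace
     \<Rightarrow> ('k, 'x::ab_group_add) vspace \<Rightarrow> ('k, 'y::ab_group_add) vspace
     \<Rightarrow> ('v \<Rightarrow> 'x) \<Rightarrow> ('w \<Rightarrow> 'y) \<Rightarrow> (('v \<Rightarrow> 'w \<Rightarrow> 'k) \<Rightarrow> 'k) \<Rightarrow> (('x \<Rightarrow> 'y \<Rightarrow> 'k) \<Rightarrow> 'k)" where
  "tensor_map V W X Y f g = tlift V W (X \<otimes>\<^sub>v Y) (\<lambda>v w. pure X Y (f v) (g w))"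

definition tensor_assoc ::
  "('k::field, 'u::ab_group_add) vspace \<Rightarrow> ('k, 'v::ab_group_add) vspace
     \<Rightarrow> ('k, 'w::ab_group_add) vspace
     \<Rightarrow> (((('u \<Rightarrow> 'v \<Rightarrow> 'k) \<Rightarrow> 'k) \<Rightarrow> 'w \<Rightarrow> 'k) \<Rightarrow> 'k)
     \<Rightarrow> (('u \<Rightarrow> (('v \<Rightarrow> 'w \<Rightarrow> 'k) \<Rightarrow> 'k) \<Rightarrow> 'k) \<Rightarrow> 'k)" where
  "tensor_assoc U V W = tlift (U \<otimes>\<^sub>v V) W (U \<otimes>\<^sub>v V \<otimes>\<^sub>v W)
     (\<lambda>t w. tlift U V (U \<otimes>\<^sub>v V \<otimes>\<^sub>v W) (\<lambda>u v. pure U (V \<otimes>\<^sub>v W) u (pure V W v w)) t)"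

definition tensor_mult ::
  "('k::field, 'a::ring) vspace \<Rightarrow> ('k, 'b::ring) vspace
     \<Rightarrow> (('a \<Rightarrow> 'b \<Rightarrow> 'k) \<Rightarrow> 'k) \<Rightarrow> (('a \<Rightarrow> 'b \<Rightarrow> 'k) \<Rightarrow> 'k) \<Rightarrow> (('a \<Rightarrow> 'b \<Rightarrow> 'k) \<Rightarrow> 'k)" where
  "tensor_mult A B s t =
     tlift A B (A \<otimes>\<^sub>v B) (\<lambda>a b. tlift A B (A \<otimes>\<^sub>v B) (\<lambda>c d. pure A B (a * c) (b * d)) t) s"


subsection \<open>The universal property\<close>

lemma vector_space_function:
  assumes "vector_space (s :: 'k::field \<Rightarrow> 'w::ab_group_add \<Rightarrow> 'w)"
  shows "vector_space (\<lambda>c (f :: 'v \<Rightarrow> 'w) x. s c (f x))"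
proof -
  interpret vector_space s by fact
  show ?thesis
    by unfold_locales (auto simp: fun_eq_iff scale_right_distrib scale_left_distrib)
qed

lemma vector_space_ground: "vector_space ((*) :: 'k::field \<Rightarrow> 'k \<Rightarrow> 'k)"
  by unfold_locales (auto simp: algebra_simps)

lemma vector_space_tensor: "vector_space (\<lambda>c (t :: 'b \<Rightarrow> 'k::field) \<beta>. c * t \<beta>)"
  by (rule vector_space_function[OF vector_space_ground])

lemma is_vspace_full: "vector_space s \<Longrightarrow> is_vspace (full s)"
  by (simp add: is_vspace_def full_def module.subspace_UNIV module_iff_vector_space)

lemma is_vspace_ground: "is_vspace ground"
  unfolding ground_def by (rule is_vspace_full[OF vector_space_ground])

lemma is_vspace_tensor: "is_vspace (V \<otimes>\<^sub>v W)"
proof -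
  interpret t: vector_space "\<lambda>c (t :: ('b \<Rightarrow> 'c \<Rightarrow> 'a) \<Rightarrow> 'a) \<beta>. c * t \<beta>"
    by (rule vector_space_tensor)
  show ?thesis
    unfolding is_vspace_def tensor_def using t.vector_space_axioms by simp
qed

lemma is_vspace_Hom:
  assumes "is_vspace V" "is_vspace W"
  shows "is_vspace (Hom V W)"
proof -
  interpret V: vector_space "scl V" using assms(1) by (simp add: is_vspace_def)
  interpret W: vector_space "scl W" using assms(2) by (simp add: is_vspace_def)
  interpret F: vector_space "\<lambda>c f x. scl W c (f x)"
    by (rule vector_space_function) (rule W.vector_space_axioms)
  have "V.subspace (car V)" "W.subspace (car W)" using assms by (simp_all add: is_vspace_def)
  then have "F.subspace (car (Hom V W))"
    unfolding F.subspace_def Hom_def lin_def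
    by (auto simp: W.scale_right_distrib W.subspace_0 W.subspace_add W.subspace_scale
          mult.commute algebra_simps)
  then show ?thesis
    using F.vector_space_axioms by (simp add: is_vspace_def Hom_def)
qed

lemma bilin_pure:
  assumes "is_vspace V" "is_vspace W"
  shows "bilin V W (V \<otimes>\<^sub>v W) (pure V W)"
proof -
  interpret t: vector_space "\<lambda>c (t :: ('b \<Rightarrow> 'c \<Rightarrow> 'a) \<Rightarrow> 'a) \<beta>. c * t \<beta>"
    by (rule vector_space_tensor)
  have "pure V W v w \<in> car (V \<otimes>\<^sub>v W)" if "v \<in> car V" "w \<in> car W" for v w
    unfolding tensor_def using that by (auto intro!: t.span_base)
  then show ?thesis
    unfolding bilin_def lin_def
    by (auto simp: pure_def fun_eq_iff tensor_def bilin_def lin_def ground_def full_def)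
qed

theorem tensor_universal:
  fixes V :: "('k::field, 'v::ab_group_add) vspace"
    and W :: "('k, 'w::ab_group_add) vspace"
    and X :: "('k, 'x::ab_group_add) vspace"
  assumes "is_vspace V" "is_vspace W" and X: "is_vspace X" and bil: "bilin V W X \<phi>"
  shows "\<exists>!f. f \<in> car (Hom (V \<otimes>\<^sub>v W) X) \<and> (\<forall>v\<in>car V. \<forall>w\<in>car W. f (pure V W v w) = \<phi> v w)"
proof -
  let ?s = "\<lambda>c (t :: ('v \<Rightarrow> 'w \<Rightarrow> 'k) \<Rightarrow> 'k) \<beta>. c * t \<beta>"
  let ?P = "{pure V W v w |v w. v \<in> car V \<and> w \<in> car W}"
  interpret t: vector_space ?s by (rule vector_space_tensor)
  interpret k: vector_space "(*) :: 'k \<Rightarrow> 'k \<Rightarrow> 'k" by (rule vector_space_ground)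
  interpret x: vector_space "scl X" using X by (simp add: is_vspace_def)
  interpret tx: vector_space_pair ?s "scl X" by unfold_locales
  interpret xk: vector_space_pair "scl X" "(*) :: 'k \<Rightarrow> 'k \<Rightarrow> 'k" by unfold_locales
  have subX: "x.subspace (car X)" using X by (simp add: is_vspace_def)
  have carT: "car (V \<otimes>\<^sub>v W) = t.span ?P" and sclT: "scl (V \<otimes>\<^sub>v W) = ?s"
    by (simp_all add: tensor_def)
  have separate: "x = y" if eq: "\<And>\<xi>. Vector_Spaces.linear (scl X) (*) \<xi> \<Longrightarrow> \<xi> x = \<xi> y" for x y
  proof (rule ccontr)
    assume "x \<noteq> y"
    then have ind: "x.independent {x - y}" by simp
    define \<xi> where "\<xi> = xk.construct {x - y} (\<lambda>_. 1)"
    have l: "Vector_Spaces.linear (scl X) (*) \<xi>"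
      unfolding \<xi>_def by (rule xk.linear_construct[OF ind])
    have "\<xi> (x - y) = 1"
      unfolding \<xi>_def by (rule xk.construct_basis[OF ind]) simp
    moreover have "\<xi> (x - y) = \<xi> x - \<xi> y"
      using l by (rule xk.linear_diff)
    ultimately show False using eq[OF l] by simp
  qed
  obtain B where B: "B \<subseteq> ?P" "t.independent B" "?P \<subseteq> t.span B"
    by (rule t.basis_exists[of ?P])
  have spanB: "t.span ?P = t.span B"
    using B(1,3) by (intro subset_antisym t.span_mono t.span_minimal t.subspace_span)
  have "\<exists>p. b = pure V W (fst p) (snd p) \<and> fst p \<in> car V \<and> snd p \<in> car W" if "b \<in> B" for b
  proof -
    from that B(1) obtain v w where "b = pure V W v w" "v \<in> car V" "w \<in> car W" by blast
    then show ?thesis by (intro exI[of _ "(v, w)"]) simp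
  qed
  then have "\<forall>b\<in>B. \<exists>p. b = pure V W (fst p) (snd p) \<and> fst p \<in> car V \<and> snd p \<in> car W"
    by (rule ballI)
  then obtain p where "\<forall>b\<in>B.
      b = pure V W (fst (p b)) (snd (p b)) \<and> fst (p b) \<in> car V \<and> snd (p b) \<in> car W"
    by (rule bchoice[THEN exE])
  then have p: "\<And>b. b \<in> B \<Longrightarrow>
      b = pure V W (fst (p b)) (snd (p b)) \<and> fst (p b) \<in> car V \<and> snd (p b) \<in> car W"
    by (rule bspec)
  define g where "g = tx.construct B (\<lambda>b. \<phi> (fst (p b)) (snd (p b)))"
  have lg: "Vector_Spaces.linear ?s (scl X) g"
    unfolding g_def by (rule tx.linear_construct[OF B(2)])
  have gadd: "g (\<lambda>\<beta>. c * s \<beta> + t \<beta>) = scl X c (g s) + g t" for c s t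
    using tx.linear_add[OF lg, of "?s c s" t] tx.linear_scale[OF lg, of c s]
    by (simp add: plus_fun_def)
  have gB: "g b = \<phi> (fst (p b)) (snd (p b))" if "b \<in> B" for b
    unfolding g_def using that by (rule tx.construct_basis[OF B(2)])
  have form: "bilin V W ground (\<lambda>v w. \<xi> (\<phi> v w))"
    if "Vector_Spaces.linear (scl X) (*) \<xi>" for \<xi>
    using bil xk.linear_add[OF that] xk.linear_scale[OF that]
    by (auto simp: bilin_def lin_def ground_def full_def)
  have key: "\<xi> (g t) = t (\<lambda>v w. \<xi> (\<phi> v w))"
    if \<xi>: "Vector_Spaces.linear (scl X) (*) \<xi>" and t: "t \<in> t.span B" for \<xi> t
    using t
  proof (induction rule: t.span_induct_alt)
    case base
    show ?case
      using xk.linear_0[OF \<xi>] tx.linear_0[OF lg] by (simp flip: func_zero)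
  next
    case (step c b t)
    have "b (\<lambda>v w. \<xi> (\<phi> v w)) = \<xi> (g b)"
      by (subst p[OF step(1), THEN conjunct1]) (simp add: pure_def gB[OF step(1)] form[OF \<xi>])
    then show ?case
      using step(2) by (simp add: gadd
          xk.linear_add[OF \<xi>] xk.linear_scale[OF \<xi>])
  qed
  have gpure: "g (pure V W v w) = \<phi> v w" if "v \<in> car V" "w \<in> car W" for v w
  proof (rule separate)
    fix \<xi> assume \<xi>: "Vector_Spaces.linear (scl X) (*) \<xi>"
    have "pure V W v w \<in> t.span B" using B(3) that by blast
    from key[OF \<xi> this] show "\<xi> (g (pure V W v w)) = \<xi> (\<phi> v w)"
      using form[OF \<xi>] by (simp add: pure_def)
  qed
  have gX: "g t \<in> car X" if "t \<in> t.span B" for t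
    using that
  proof (induction rule: t.span_induct_alt)
    case base
    show ?case using tx.linear_0[OF lg] x.subspace_0[OF subX] by (simp flip: func_zero)
  next
    case (step c b t)
    have "g b \<in> car X" using gB[OF step(1)] p[OF step(1)] bil by (simp add: bilin_def lin_def)
    then show ?case
      using step(2) subX
      by (simp add: gadd x.subspace_add x.subspace_scale)
  qed
  define f where "f = (\<lambda>t. if t \<in> t.span ?P then g t else 0)"
  show ?thesis
  proof (rule ex1I[of _ f], intro conjI ballI)
    show "f \<in> car (Hom (V \<otimes>\<^sub>v W) X)"
      by (auto simp: Hom_def lin_def carT sclT f_def spanB gX t.span_add t.span_scale
          tx.linear_add[OF lg] tx.linear_scale[OF lg])
    show "f (pure V W v w) = \<phi> v w" if "v \<in> car V" "w \<in> car W" for v w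
    proof -
      have "pure V W v w \<in> t.span ?P" using that by (auto intro!: t.span_base)
      then show ?thesis using gpure[OF that] by (simp add: f_def)
    qed
  next
    fix h
    assume h: "h \<in> car (Hom (V \<otimes>\<^sub>v W) X) \<and> (\<forall>v\<in>car V. \<forall>w\<in>car W. h (pure V W v w) = \<phi> v w)"
    then have hadd: "\<And>s t. s \<in> t.span ?P \<Longrightarrow> t \<in> t.span ?P \<Longrightarrow> h (s + t) = h s + h t"
      and hscl: "\<And>c t. t \<in> t.span ?P \<Longrightarrow> h (?s c t) = scl X c (h t)"
      and h0: "\<And>t. t \<notin> t.span ?P \<Longrightarrow> h t = 0"
      unfolding Hom_def lin_def carT sclT by auto
    have "t \<in> t.span ?P \<and> h t = g t" if "t \<in> t.span ?P" for t
      using that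
    proof (induction rule: t.span_induct_alt)
      case base
      have "h (0 + 0) = h 0 + h 0" by (rule hadd) (auto intro: t.span_zero)
      then have "h 0 = g 0" using tx.linear_0[OF lg] by simp
      then show ?case using t.span_zero[of ?P] by (simp flip: func_zero)
    next
      case (step c b t)
      have b: "b \<in> t.span ?P" using step(1) by (rule t.span_base)
      have "h b = g b" using step(1) h gpure by auto
      then have "h (?s c b + t) = g (?s c b + t)"
        using step(2) hadd[OF t.span_scale[OF b], of t] hscl[OF b]
        by (simp add: gadd plus_fun_def)
      moreover have "?s c b + t \<in> t.span ?P"
        using step(2) t.span_add[OF t.span_scale[OF b]] by blast
      ultimately show ?case by blast
    qed
    then show "h = f" using h0 by (auto simp: f_def fun_eq_iff)
  qed
qed

lemma
  assumes "is_vspace V" "is_vspace W" "is_vspace X" "bilin V W X \<phi>"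
  shows tlift_in_Hom: "tlift V W X \<phi> \<in> car (Hom (V \<otimes>\<^sub>v W) X)"
    and tlift_pure: "v \<in> car V \<Longrightarrow> w \<in> car W \<Longrightarrow> tlift V W X \<phi> (pure V W v w) = \<phi> v w"
  using theI'[OF tensor_universal[OF assms]] unfolding tlift_def by blast+


section \<open>Hopf algebras and comodule algebras\<close>

text \<open>
  The sort of \<open>'a\<close> is that of unital rings in which 0 = 1 is allowed.
\<close>

locale algebra_over = vector_space s
  for s :: "'k::field \<Rightarrow> 'a::{ring, monoid_mult} \<Rightarrow> 'a" +
  assumes scale_mult_left: "s c x * y = s c (x * y)"
    and scale_mult_right: "x * s c y = s c (x * y)"

locale hopf_algebra = algebra_over sH
  for sH :: "'k::field \<Rightarrow> 'h::ring_1 \<Rightarrow> 'h" +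
  fixes \<Delta> :: "'h \<Rightarrow> ('h \<Rightarrow> 'h \<Rightarrow> 'k) \<Rightarrow> 'k"
    and \<epsilon> :: "'h \<Rightarrow> 'k"
    and S :: "'h \<Rightarrow> 'h"
  assumes comult_linear: "\<Delta> \<in> car (Hom (full sH) (full sH \<otimes>\<^sub>v full sH))"
    and counit_linear: "\<epsilon> \<in> car (dual (full sH))"
    and antipode_linear: "S \<in> car (Hom (full sH) (full sH))"
    and coassoc:
      "tensor_assoc (full sH) (full sH) (full sH)
         (tensor_map (full sH) (full sH) (full sH \<otimes>\<^sub>v full sH) (full sH) \<Delta> id (\<Delta> h)) =
       tensor_map (full sH) (full sH) (full sH) (full sH \<otimes>\<^sub>v full sH) id \<Delta> (\<Delta> h)"
    and counit_left: "tlift (full sH) (full sH) (full sH) (\<lambda>a b. sH (\<epsilon> a) b) (\<Delta> h) = h"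
    and counit_right: "tlift (full sH) (full sH) (full sH) (\<lambda>a b. sH (\<epsilon> b) a) (\<Delta> h) = h"
    and comult_mult: "\<Delta> (g * h) = tensor_mult (full sH) (full sH) (\<Delta> g) (\<Delta> h)"
    and comult_one: "\<Delta> 1 = pure (full sH) (full sH) 1 1"
    and counit_mult: "\<epsilon> (g * h) = \<epsilon> g * \<epsilon> h"
    and counit_one: "\<epsilon> 1 = 1"
    and antipode_left: "tlift (full sH) (full sH) (full sH) (\<lambda>a b. S a * b) (\<Delta> h) = sH (\<epsilon> h) 1"
    and antipode_right: "tlift (full sH) (full sH) (full sH) (\<lambda>a b. a * S b) (\<Delta> h) = sH (\<epsilon> h) 1"

locale left_comodule_algebra = H: hopf_algebra sH \<Delta> \<epsilon> S + K: algebra_over sK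
  for sH :: "'k::field \<Rightarrow> 'h::ring_1 \<Rightarrow> 'h"
    and \<Delta> :: "'h \<Rightarrow> ('h \<Rightarrow> 'h \<Rightarrow> 'k) \<Rightarrow> 'k"
    and \<epsilon> :: "'h \<Rightarrow> 'k"
    and S :: "'h \<Rightarrow> 'h"
    and sK :: "'k \<Rightarrow> 'a::{ring, monoid_mult} \<Rightarrow> 'a" +
  fixes \<rho> :: "'a \<Rightarrow> ('h \<Rightarrow> 'a \<Rightarrow> 'k) \<Rightarrow> 'k"
  assumes coact_linear: "\<rho> \<in> car (Hom (full sK) (full sH \<otimes>\<^sub>v full sK))"
    and coact_coassoc:
      "tensor_assoc (full sH) (full sH) (full sK)
         (tensor_map (full sH) (full sK) (full sH \<otimes>\<^sub>v full sH) (full sK) \<Delta> id (\<rho> x)) =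
       tensor_map (full sH) (full sK) (full sH) (full sH \<otimes>\<^sub>v full sK) id \<rho> (\<rho> x)"
    and coact_counit: "tlift (full sH) (full sK) (full sK) (\<lambda>a y. sK (\<epsilon> a) y) (\<rho> x) = x"
    and coact_mult: "\<rho> (x * y) = tensor_mult (full sH) (full sK) (\<rho> x) (\<rho> y)"
    and coact_one: "\<rho> 1 = pure (full sH) (full sK) 1 1"

text \<open>
  Ideals are required to be subspaces; over a unital algebra this is the same as being
  closed under addition.
\<close>

definition two_sided_ideal :: "('k::field \<Rightarrow> 'a::ring \<Rightarrow> 'a) \<Rightarrow> 'a set \<Rightarrow> bool" where
  "two_sided_ideal sK I \<longleftrightarrow>
     module.subspace sK I \<and> (\<forall>a. \<forall>x\<in>I. a * x \<in> I \<and> x * a \<in> I)"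

text \<open>The span below is the image of \<open>H \<otimes> I\<close> in \<open>H \<otimes> K\<close>.\<close>

definition subcomodule ::
  "('k::field \<Rightarrow> 'h::ab_group_add \<Rightarrow> 'h) \<Rightarrow> ('k \<Rightarrow> 'a::ab_group_add \<Rightarrow> 'a)
     \<Rightarrow> ('a \<Rightarrow> ('h \<Rightarrow> 'a \<Rightarrow> 'k) \<Rightarrow> 'k) \<Rightarrow> 'a set \<Rightarrow> bool" where
  "subcomodule sH sK \<rho> I \<longleftrightarrow>
     module.subspace sK I \<and>
     (\<forall>x\<in>I. \<rho> x \<in> module.span (scl (full sH \<otimes>\<^sub>v full sK))
                     {pure (full sH) (full sK) h y |h y. y \<in> I})"

definition H_simple ::
  "('k::field \<Rightarrow> 'h::ab_group_add \<Rightarrow> 'h) \<Rightarrow> ('k \<Rightarrow> 'a::ring \<Rightarrow> 'a)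
     \<Rightarrow> ('a \<Rightarrow> ('h \<Rightarrow> 'a \<Rightarrow> 'k) \<Rightarrow> 'k) \<Rightarrow> bool" where
  "H_simple sH sK \<rho> \<longleftrightarrow>
     (\<forall>I. two_sided_ideal sK I \<and> subcomodule sH sK \<rho> I \<longrightarrow> I = {0} \<or> I = UNIV)"

text \<open>Left modules over an algebra, with the compatible vector space structure made explicit.\<close>

locale left_module_over = A: algebra_over sA + M: vector_space sM
  for sA :: "'k::field \<Rightarrow> 'a::{ring, monoid_mult} \<Rightarrow> 'a"
    and sM :: "'k \<Rightarrow> 'm::ab_group_add \<Rightarrow> 'm" +
  fixes act :: "'a \<Rightarrow> 'm \<Rightarrow> 'm"
  assumes act_bilinear: "bilin (full sA) (full sM) (full sM) act"
    and act_one: "act 1 m = m"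
    and act_mult: "act (x * y) m = act x (act y m)"


section \<open>The Yan--Zhu stabilizer\<close>

context left_comodule_algebra
begin

abbreviation "HH \<equiv> full sH"
abbreviation "KK \<equiv> full sK"
abbreviation "Hd \<equiv> dual (full sH)"

definition conv :: "('h \<Rightarrow> 'k) \<Rightarrow> ('h \<Rightarrow> 'k) \<Rightarrow> 'h \<Rightarrow> 'k" where
  "conv \<alpha> \<beta> = (\<lambda>h. tlift HH HH ground (\<lambda>a b. \<alpha> a * \<beta> b) (\<Delta> h))"

text \<open>
  The antipode of a finite-dimensional Hopf algebra is bijective, so \<open>inv S\<close> is its inverse.
\<close>

definition dual_act :: "'h \<Rightarrow> ('h \<Rightarrow> 'k) \<Rightarrow> 'h \<Rightarrow> 'k" where
  "dual_act h \<beta> = (\<lambda>a. \<beta> (inv S h * a))"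

definition dual_tensor_act ::
  "('k \<Rightarrow> 'u::ab_group_add \<Rightarrow> 'u) \<Rightarrow> ('a \<Rightarrow> 'u \<Rightarrow> 'u)
     \<Rightarrow> 'a \<Rightarrow> ((('h \<Rightarrow> 'k) \<Rightarrow> 'u \<Rightarrow> 'k) \<Rightarrow> 'k) \<Rightarrow> ((('h \<Rightarrow> 'k) \<Rightarrow> 'u \<Rightarrow> 'k) \<Rightarrow> 'k)" where
  "dual_tensor_act sU actU x =
     tlift Hd (full sU) (Hd \<otimes>\<^sub>v full sU)
       (\<lambda>\<beta> u. tlift HH KK (Hd \<otimes>\<^sub>v full sU)
                (\<lambda>h y. pure Hd (full sU) (dual_act h \<beta>) (actU y u)) (\<rho> x))"

definition Hom_dual_tensor ::
  "('k \<Rightarrow> 'u::ab_group_add \<Rightarrow> 'u) \<Rightarrow> ('a \<Rightarrow> 'u \<Rightarrow> 'u)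
     \<Rightarrow> ('k \<Rightarrow> 'w::ab_group_add \<Rightarrow> 'w) \<Rightarrow> ('a \<Rightarrow> 'w \<Rightarrow> 'w)
     \<Rightarrow> (((('h \<Rightarrow> 'k) \<Rightarrow> 'u \<Rightarrow> 'k) \<Rightarrow> 'k) \<Rightarrow> ((('h \<Rightarrow> 'k) \<Rightarrow> 'w \<Rightarrow> 'k) \<Rightarrow> 'k)) set" where
  "Hom_dual_tensor sU actU sW actW =
     {f \<in> car (Hom (Hd \<otimes>\<^sub>v full sU) (Hd \<otimes>\<^sub>v full sW)).
        \<forall>x. \<forall>t\<in>car (Hd \<otimes>\<^sub>v full sU).
          f (dual_tensor_act sU actU x t) = dual_tensor_act sW actW x (f t)}"

definition LL ::
  "('k \<Rightarrow> 'u::ab_group_add \<Rightarrow> 'u) \<Rightarrow> ('k \<Rightarrow> 'w::ab_group_add \<Rightarrow> 'w)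
     \<Rightarrow> ((('h \<Rightarrow> 'k) \<Rightarrow> ('u \<Rightarrow> 'w) \<Rightarrow> 'k) \<Rightarrow> 'k)
     \<Rightarrow> ((('h \<Rightarrow> 'k) \<Rightarrow> 'u \<Rightarrow> 'k) \<Rightarrow> 'k) \<Rightarrow> ((('h \<Rightarrow> 'k) \<Rightarrow> 'w \<Rightarrow> 'k) \<Rightarrow> 'k)" where
  "LL sU sW =
     tlift Hd (Hom (full sU) (full sW)) (Hom (Hd \<otimes>\<^sub>v full sU) (Hd \<otimes>\<^sub>v full sW))
       (\<lambda>\<alpha> f. tlift Hd (full sU) (Hd \<otimes>\<^sub>v full sW)
                (\<lambda>\<beta> u. pure Hd (full sW) (conv \<alpha> \<beta>) (f u)))"

definition Stab ::
  "('k \<Rightarrow> 'u::ab_group_add \<Rightarrow> 'u) \<Rightarrow> ('a \<Rightarrow> 'u \<Rightarrow> 'u)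
     \<Rightarrow> ('k \<Rightarrow> 'w::ab_group_add \<Rightarrow> 'w) \<Rightarrow> ('a \<Rightarrow> 'w \<Rightarrow> 'w)
     \<Rightarrow> (((('h \<Rightarrow> 'k) \<Rightarrow> 'u \<Rightarrow> 'k) \<Rightarrow> 'k) \<Rightarrow> ((('h \<Rightarrow> 'k) \<Rightarrow> 'w \<Rightarrow> 'k) \<Rightarrow> 'k)) set" where
  "Stab sU actU sW actW =
     Hom_dual_tensor sU actU sW actW \<inter> LL sU sW ` car (Hd \<otimes>\<^sub>v Hom (full sU) (full sW))"

definition dim_Stab ::
  "('k \<Rightarrow> 'u::ab_group_add \<Rightarrow> 'u) \<Rightarrow> ('a \<Rightarrow> 'u \<Rightarrow> 'u)
     \<Rightarrow> ('k \<Rightarrow> 'w::ab_group_add \<Rightarrow> 'w) \<Rightarrow> ('a \<Rightarrow> 'w \<Rightarrow> 'w) \<Rightarrow> nat" where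
  "dim_Stab sU actU sW actW =
     vector_space.dim (scl (Hom (Hd \<otimes>\<^sub>v full sU) (Hd \<otimes>\<^sub>v full sW))) (Stab sU actU sW actW)"

end

end

theory Submission
  imports Defs
begin

text \<open>
  Identifying \<open>H\<^sup>* \<otimes> U\<close> with the linear maps from \<open>H\<close> to \<open>U\<close>, the stabilizer becomes
  \<open>Hom\<^sub>K(M, W)\<close> for the Hopf module \<open>M = H \<otimes> U\<close> with the diagonal action of \<open>K\<close>. So it has to be
  shown that \<open>h(W) = dim Hom\<^sub>K(M, W)\<close> satisfies \<open>dim K \<cdot> h(W) = dim M \<cdot> dim W\<close> for all finite-dimensional
  modules \<open>W\<close>.

  Let \<open>\<lambda>\<close> be the maximum of \<open>h / dim\<close> over nonzero modules, and call a module tight if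
  \<open>h = \<lambda> \<cdot> dim\<close> on it. Since \<open>h\<close> is subadditive on short exact sequences, submodules and quotients
  of tight modules are tight, as are their powers. If \<open>V\<close> is tight then so is \<open>Hom(H, V)\<close> with the action
  \<open>(x g)(a) = x\<^sub>(\<^sub>0\<^sub>) g(a x\<^sub>(\<^sub>-\<^sub>1\<^sub>))\<close>, because \<open>M\<close> is a Hopf module. The annihilator of that module
  is a stable ideal, hence \<open>0\<close> if \<open>V\<close> is nonzero, so that \<open>K\<close> embeds in a power of it and is tight.
  Hence every module, being a quotient of a power of \<open>K\<close>, is tight. The module \<open>K\<^sup>*\<close>, for which
  \<open>h(K\<^sup>*) = dim M\<close>, yields \<open>\<lambda> = dim M / dim K\<close>.
\<close>

section \<open>Finite-dimensional subspaces\<close>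

text \<open>The obstacle is that a tight module \<open>V\<close> need not be faithful, and
  \<open>H\<close>-simplicity says nothing about its annihilator, which is an ideal but in general
  no subcomodule. Passing to \<open>coind\<close> replaces the annihilator by the set of elements
  whose coaction lies in \<open>H \<otimes> Ann V\<close>, the largest stable ideal inside it.
  Tightness survives because this passage multiplies \<open>dim\<close> by \<open>dim H\<close> and
  \<open>h\<close> by at least that factor. The maximum cannot be formed over all modules at once,
  since they live in different types. It is formed over the submodules of \<open>K^*\<close>, where
  only finitely many pairs of values of \<open>h\<close> and \<open>dim\<close> occur. Each nonzero
  module has a nonzero quotient in \<open>K^*\<close>, so the bound spreads to all modules by
  induction on the dimension. Quotients are represented by images of equivariant maps into function
  spaces, and the maximal ratio by a pair of natural numbers, with all inequalities
  cross-multiplied.\<close>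

definition fscale :: "('k \<Rightarrow> 'v \<Rightarrow> 'v) \<Rightarrow> 'k \<Rightarrow> ('x \<Rightarrow> 'v) \<Rightarrow> 'x \<Rightarrow> 'v" where
  "fscale s c f = (\<lambda>x. s c (f x))"

lemma fscale_apply [simp]: "fscale s c f x = s c (f x)"
  by (simp add: fscale_def)

lemma vector_space_fscale: "vector_space s \<Longrightarrow> vector_space (fscale s)"
  using vector_space_function[of s] by (simp add: fscale_def[abs_def])

text \<open>Values outside the subset are left free, so that a map can be restricted to a subspace
  without being redefined.\<close>

definition linear_on ::
  "('k \<Rightarrow> 'v::ab_group_add \<Rightarrow> 'v) \<Rightarrow> ('k \<Rightarrow> 'w::ab_group_add \<Rightarrow> 'w) \<Rightarrow> 'v set \<Rightarrow> ('v \<Rightarrow> 'w) \<Rightarrow> bool"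
  where "linear_on s t V f \<longleftrightarrow>
    (\<forall>x\<in>V. \<forall>y\<in>V. f (x + y) = f x + f y) \<and> (\<forall>c. \<forall>x\<in>V. f (s c x) = t c (f x))"

lemma linear_onI:
  assumes "\<And>x y. x \<in> V \<Longrightarrow> y \<in> V \<Longrightarrow> f (x + y) = f x + f y"
    and "\<And>c x. x \<in> V \<Longrightarrow> f (s c x) = t c (f x)"
  shows "linear_on s t V f"
  using assms by (simp add: linear_on_def)

lemma linear_on_add: "linear_on s t V f \<Longrightarrow> x \<in> V \<Longrightarrow> y \<in> V \<Longrightarrow> f (x + y) = f x + f y"
  by (simp add: linear_on_def)

lemma linear_on_scale: "linear_on s t V f \<Longrightarrow> x \<in> V \<Longrightarrow> f (s c x) = t c (f x)"
  by (simp add: linear_on_def)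

lemma linear_on_subset: "linear_on s t V f \<Longrightarrow> U \<subseteq> V \<Longrightarrow> linear_on s t U f"
  unfolding linear_on_def by blast

lemma linear_on_0:
  assumes "linear_on s t V f" "vector_space s" "module.subspace s V"
  shows "f 0 = 0"
proof -
  interpret s: vector_space s by fact
  have "f (0 + 0) = f 0 + f 0"
    using assms by (intro linear_on_add[OF assms(1)]) (auto intro: s.subspace_0)
  then show ?thesis by simp
qed

lemma linear_on_sum:
  assumes f: "linear_on s t V f" and vs: "vector_space s" "module.subspace s V"
    and g: "\<And>i. i \<in> I \<Longrightarrow> g i \<in> V"
  shows "f (sum g I) = (\<Sum>i\<in>I. f (g i))"
proof -
  interpret s: vector_space s by fact
  show ?thesis
    using g
  proof (induction I rule: infinite_finite_induct)
    case (insert i I)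
    then have "sum g I \<in> V" by (intro s.subspace_sum vs) auto
    then show ?case using insert by (simp add: linear_on_add[OF f])
  qed (simp_all add: linear_on_0[OF f vs])
qed

lemma linear_on_diff:
  assumes f: "linear_on s t V f" and "vector_space s" "module.subspace s V"
    and "x \<in> V" "y \<in> V"
  shows "f (x - y) = f x - f y"
proof -
  interpret s: vector_space s by fact
  have "f ((x - y) + y) = f (x - y) + f y"
    using assms by (intro linear_on_add[OF f]) (auto intro: s.subspace_diff)
  then show ?thesis by simp
qed

lemma linear_on_span_eq_0:
  assumes f: "linear_on s t V f" and vs: "vector_space s" "module.subspace s V" "vector_space t"
    and A: "A \<subseteq> V" "\<And>a. a \<in> A \<Longrightarrow> f a = 0" and x: "x \<in> module.span s A"
  shows "f x = 0"
proof -
  interpret s: vector_space s by fact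
  interpret t: vector_space t by fact
  have "s.span A \<subseteq> {x \<in> V. f x = 0}"
  proof (rule s.span_minimal)
    show "s.subspace {x \<in> V. f x = 0}"
      using vs(2) linear_on_0[OF f vs(1,2)]
      by (auto simp: s.subspace_def linear_on_add[OF f] linear_on_scale[OF f])
  qed (use A in auto)
  with x show ?thesis by auto
qed

text \<open>Finiteness is asked of the subspace alone: the ambient type may be infinite-dimensional,
  for instance a space of functions indexed by all functionals on a module.\<close>

definition findim :: "('k::field \<Rightarrow> 'v::ab_group_add \<Rightarrow> 'v) \<Rightarrow> 'v set \<Rightarrow> bool" where
  "findim s V \<longleftrightarrow> vector_space s \<and> module.subspace s V \<and> (\<exists>A. finite A \<and> V \<subseteq> module.span s A)"

lemma findimD: "findim s V \<Longrightarrow> vector_space s" "findim s V \<Longrightarrow> module.subspace s V"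
  by (simp_all add: findim_def)

lemma findim_basis:
  assumes "findim s V"
  obtains B where "finite B" "B \<subseteq> V" "\<not> module.dependent s B" "module.span s B = V"
    "card B = vector_space.dim s V"
proof -
  interpret s: vector_space s using assms by (simp add: findim_def)
  obtain A where A: "finite A" "V \<subseteq> s.span A" using assms by (auto simp: findim_def)
  obtain B where B: "B \<subseteq> V" "s.independent B" "V \<subseteq> s.span B" "card B = s.dim V"
    by (rule s.basis_exists[of V])
  have "finite B" using s.independent_span_bound[OF A(1) B(2)] A(2) B(1) by blast
  moreover have "s.span B = V"
    using B(1,3) assms by (intro s.span_subspace) (auto simp: findim_def)
  ultimately show thesis using that B by blast
qed

lemma findim_extend_basis:
  assumes V: "findim s V" and C: "C \<subseteq> V" "\<not> module.dependent s C"
  obtains B where "finite B" "C \<subseteq> B" "B \<subseteq> V" "\<not> module.dependent s B" "module.span s B = V"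
    "card B = vector_space.dim s V"
proof -
  interpret s: vector_space s using assms by (simp add: findim_def)
  obtain A where A: "finite A" "V \<subseteq> s.span A" using assms by (auto simp: findim_def)
  obtain B where B: "C \<subseteq> B" "B \<subseteq> V" "s.independent B" "V \<subseteq> s.span B"
    using s.maximal_independent_subset_extend[OF C] by blast
  have "finite B" using s.independent_span_bound[OF A(1) B(3)] A(2) B(2) by blast
  moreover have "s.span B = V"
    using B(2,4) V by (intro s.span_subspace) (auto simp: findim_def)
  ultimately show thesis using that B s.basis_card_eq_dim[OF B(2,4,3)] by blast
qed

lemma findim_subspace: "findim s V \<Longrightarrow> W \<subseteq> V \<Longrightarrow> module.subspace s W \<Longrightarrow> findim s W"
  unfolding findim_def by (meson subset_trans)

lemma dim_mono_findim:
  assumes V: "findim s V" and W: "W \<subseteq> V" "module.subspace s W"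
  shows "vector_space.dim s W \<le> vector_space.dim s V"
proof -
  interpret s: vector_space s using assms by (simp add: findim_def)
  obtain B where B: "finite B" "s.span B = V" "card B = s.dim V" using findim_basis[OF V] by metis
  then show ?thesis using s.dim_le_card[of W B] W(1) by simp
qed

lemma dim_subset_eq_findim:
  assumes V: "findim s V" and W: "W \<subseteq> V" "module.subspace s W"
    and dim: "vector_space.dim s W = vector_space.dim s V"
  shows "W = V"
proof -
  interpret s: vector_space s using assms by (simp add: findim_def)
  obtain C where C: "finite C" "C \<subseteq> W" "s.independent C" "s.span C = W" "card C = s.dim W"
    using findim_basis[OF findim_subspace[OF V W]] by metis
  then have CV: "C \<subseteq> V" using W by blast
  obtain B where B: "finite B" "C \<subseteq> B" "s.span B = V" "card B = s.dim V"
    using findim_extend_basis[OF V CV C(3)] by metis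
  have "C = B" using B(1,2,4) C(5) dim by (intro card_subset_eq) auto
  then show ?thesis using B C by simp
qed

lemma dim_eq_0_iff_findim:
  assumes V: "findim s V"
  shows "vector_space.dim s V = 0 \<longleftrightarrow> V = {0}"
proof -
  interpret s: vector_space s using assms by (simp add: findim_def)
  obtain B where B: "finite B" "s.span B = V" "card B = s.dim V" "s.independent B"
    using findim_basis[OF V] by metis
  show ?thesis
  proof
    assume "s.dim V = 0"
    then have "B = {}" using B by simp
    then show "V = {0}" using B by simp
  next
    assume "V = {0}"
    then have "V \<subseteq> s.span {}" by simp
    then show "s.dim V = 0" using s.dim_le_card[of V "{}"] by simp
  qed
qed

section \<open>Kernel, image and rank-nullity for maps given on a subspace\<close>

context
  fixes s :: "'k::field \<Rightarrow> 'v::ab_group_add \<Rightarrow> 'v" and t :: "'k \<Rightarrow> 'w::ab_group_add \<Rightarrow> 'w" and V f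
  assumes V: "findim s V" and t: "vector_space t" and f: "linear_on s t V f"
begin

lemma findim_kernel: "findim s {x \<in> V. f x = 0}"
proof -
  interpret s: vector_space s using V by (simp add: findim_def)
  interpret t: vector_space t by (fact t)
  note vs = findimD[OF V]
  show ?thesis
    using vs(2) linear_on_0[OF f vs(1,2)]
    by (intro findim_subspace[OF V])
      (auto simp: s.subspace_def linear_on_add[OF f] linear_on_scale[OF f])
qed

lemma findim_image: "findim t (f ` V)"
proof -
  interpret s: vector_space s using V by (simp add: findim_def)
  interpret t: vector_space t by (fact t)
  note vs = findimD[OF V]
  have sub: "t.subspace (f ` V)"
    unfolding t.subspace_def
  proof (intro conjI ballI allI)
    show "0 \<in> f ` V"
      using linear_on_0[OF f vs] s.subspace_0[OF vs(2)] by (auto intro!: image_eqI[of _ _ 0])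
    show "x + y \<in> f ` V" if "x \<in> f ` V" "y \<in> f ` V" for x y
    proof -
      obtain a b where "a \<in> V" "b \<in> V" "x = f a" "y = f b" using \<open>x \<in> f ` V\<close> \<open>y \<in> f ` V\<close> by blast
      then show ?thesis using linear_on_add[OF f] s.subspace_add[OF vs(2)] by (metis imageI)
    qed
    show "t c x \<in> f ` V" if "x \<in> f ` V" for c x
    proof -
      obtain a where "a \<in> V" "x = f a" using \<open>x \<in> f ` V\<close> by blast
      then show ?thesis using linear_on_scale[OF f] s.subspace_scale[OF vs(2)] by (metis imageI)
    qed
  qed
  obtain A where A: "finite A" "A \<subseteq> V" "s.span A = V" using findim_basis[OF V] by metis
  have "V \<subseteq> {x \<in> V. f x \<in> t.span (f ` A)}"
  proof -
    have "s.span A \<subseteq> {x \<in> V. f x \<in> t.span (f ` A)}"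
    proof (rule s.span_minimal)
      show "s.subspace {x \<in> V. f x \<in> t.span (f ` A)}"
        using vs(2) linear_on_0[OF f vs(1,2)]
        by (auto simp: s.subspace_def linear_on_add[OF f] linear_on_scale[OF f]
            t.span_zero t.span_add t.span_scale)
    qed (use A in \<open>auto intro: t.span_base\<close>)
    then show ?thesis using A by simp
  qed
  then show ?thesis using sub A(1) t by (auto simp: findim_def intro!: exI[of _ "f ` A"])
qed

lemma rank_nullity:
  "vector_space.dim s V = vector_space.dim s {x \<in> V. f x = 0} + vector_space.dim t (f ` V)"
proof -
  interpret s: vector_space s using V by (simp add: findim_def)
  interpret t: vector_space t by (fact t)
  note vs = findimD[OF V]
  let ?N = "{x \<in> V. f x = 0}"
  obtain C where C: "finite C" "C \<subseteq> ?N" "s.independent C" "s.span C = ?N" "card C = s.dim ?N"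
    by (rule findim_basis[OF findim_kernel])
  then have "C \<subseteq> V" by auto
  then obtain B where B: "finite B" "C \<subseteq> B" "B \<subseteq> V" "s.independent B" "s.span B = V" "card B = s.dim V"
    using findim_extend_basis[OF V _ C(3)] by metis
  let ?D = "B - C"
  have DV: "?D \<subseteq> V" using B by blast
  \<comment> \<open>A relation among the images puts the corresponding combination of
    \<open>?D\<close> into the kernel, hence into the span of \<open>C\<close>; together this is a
    relation among the independent vectors of \<open>B\<close>.\<close>
  have key: "u b = 0"
    if 0: "(\<Sum>d\<in>?D. t (u d) (f d)) = 0" and b: "b \<in> ?D" for u b
  proof -
    let ?x = "\<Sum>d\<in>?D. s (u d) d"
    have xV: "?x \<in> V" using DV by (intro s.subspace_sum vs) (auto intro: s.subspace_scale[OF vs(2)])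
    have "f ?x = (\<Sum>d\<in>?D. f (s (u d) d))"
      using DV by (intro linear_on_sum[OF f vs]) (auto intro: s.subspace_scale[OF vs(2)])
    also have "\<dots> = (\<Sum>d\<in>?D. t (u d) (f d))"
      using DV by (intro sum.cong) (auto simp: linear_on_scale[OF f])
    finally have "f ?x = 0" using 0 by simp
    then have "?x \<in> s.span C" using xV C(4) by simp
    then obtain v where v: "?x = (\<Sum>c\<in>C. s (v c) c)" using s.span_finite[OF C(1)] by auto
    define w where "w = (\<lambda>x. if x \<in> C then - v x else u x)"
    have "(\<Sum>x\<in>B. s (w x) x) = (\<Sum>x\<in>?D. s (w x) x) + (\<Sum>x\<in>C. s (w x) x)"
      using B by (subst sum.subset_diff[OF B(2,1)]) simp
    also have "(\<Sum>x\<in>?D. s (w x) x) = ?x" by (intro sum.cong) (auto simp: w_def)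
    also have "(\<Sum>x\<in>C. s (w x) x) = - (\<Sum>x\<in>C. s (v x) x)"
      by (simp add: w_def sum_negf)
    finally have "(\<Sum>x\<in>B. s (w x) x) = 0" using v by simp
    then have "w b = 0" using s.independentD[OF B(4,1) subset_refl] b by blast
    then show ?thesis using b by (simp add: w_def)
  qed
  have inj: "inj_on f ?D"
  proof (rule inj_onI, rule ccontr)
    fix x y assume xy: "x \<in> ?D" "y \<in> ?D" "f x = f y" "x \<noteq> y"
    \<comment> \<open>These coefficients express \<open>f x - f y = 0\<close> as a relation of the
      form that \<open>key\<close> excludes.\<close>
    define u :: "'v \<Rightarrow> 'k" where "u = (\<lambda>d. if d = x then 1 else if d = y then - 1 else 0)"
    have "(\<Sum>d\<in>?D. t (u d) (f d)) = (\<Sum>d\<in>{x, y}. t (u d) (f d))"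
      using xy B by (intro sum.mono_neutral_right) (auto simp: u_def)
    also have "\<dots> = 0" using xy by (simp add: u_def)
    finally have "u x = 0" using key xy(1) by blast
    then show False by (simp add: u_def)
  qed
  have ind: "t.independent (f ` ?D)"
  proof (rule t.independent_if_scalars_zero)
    show "finite (f ` ?D)" using B by simp
    fix u x assume "(\<Sum>x\<in>f ` ?D. t (u x) x) = 0" "x \<in> f ` ?D"
    then have "(\<Sum>d\<in>?D. t (u (f d)) (f d)) = 0"
      by (simp add: sum.reindex[OF inj])
    then show "u x = 0" using key[of "\<lambda>d. u (f d)"] \<open>x \<in> f ` ?D\<close> by auto
  qed
  have "f ` V \<subseteq> t.span (f ` ?D)"
  proof
    fix y assume "y \<in> f ` V"
    then obtain x where x: "x \<in> V" "y = f x" by blast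
    then have "x \<in> s.span B" using B by simp
    then obtain u where u: "x = (\<Sum>b\<in>B. s (u b) b)" using s.span_finite[OF B(1)] by auto
    have "y = (\<Sum>b\<in>B. f (s (u b) b))"
      unfolding x(2) u using B(3) by (intro linear_on_sum[OF f vs] s.subspace_scale[OF vs(2)]) auto
    also have "\<dots> = (\<Sum>b\<in>B. t (u b) (f b))"
      using B(3) by (intro sum.cong) (auto simp: linear_on_scale[OF f])
    also have "\<dots> = (\<Sum>b\<in>?D. t (u b) (f b))"
      using B(1) C(2) by (intro sum.mono_neutral_right) auto
    finally have y: "y = (\<Sum>b\<in>?D. t (u b) (f b))" .
    show "y \<in> t.span (f ` ?D)"
      unfolding y by (intro t.span_sum t.span_scale t.span_base imageI)
  qed
  then have "card (f ` ?D) = t.dim (f ` V)"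
    using ind DV by (intro t.basis_card_eq_dim) auto
  then have "card ?D = t.dim (f ` V)" by (simp add: card_image[OF inj])
  moreover have "card B = card C + card ?D"
    using card_Diff_subset[OF C(1) B(2)] card_mono[OF B(1,2)] by simp
  ultimately show ?thesis using B C by simp
qed

lemma dim_image_inj:
  assumes "\<And>x. x \<in> V \<Longrightarrow> f x = 0 \<Longrightarrow> x = 0"
  shows "vector_space.dim t (f ` V) = vector_space.dim s V"
proof -
  interpret s: vector_space s using V by (simp add: findim_def)
  have "{x \<in> V. f x = 0} = {0}"
    using assms linear_on_0[OF f] findimD[OF V] s.subspace_0 by auto
  then show ?thesis
    using rank_nullity dim_eq_0_iff_findim[OF findim_kernel] by simp
qed

end

lemma findim_inj_surj:
  assumes V: "findim s V" and f: "linear_on s s V f" and "f ` V \<subseteq> V"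
    and inj: "\<And>x. x \<in> V \<Longrightarrow> f x = 0 \<Longrightarrow> x = 0"
  shows "f ` V = V"
  using assms findimD[OF V] findim_image[OF V _ f] dim_image_inj[OF V _ f]
  by (intro dim_subset_eq_findim[OF V]) (auto simp: findim_def)

text \<open>Rank-nullity presupposes a finite-dimensional domain. This supplies it: a finite
  spanning set of the kernel together with preimages of one of the image spans
  \<open>V\<close>.\<close>

lemma findim_by_kernel_image:
  assumes vs: "vector_space s" "module.subspace s V" and t: "vector_space t"
    and f: "linear_on s t V f"
    and ker: "findim s {x \<in> V. f x = 0}" and im: "findim t (f ` V)"
  shows "findim s V"
proof -
  interpret s: vector_space s by fact
  interpret t: vector_space t by fact
  obtain C where C: "finite C" "s.span C = {x \<in> V. f x = 0}"
    by (rule findim_basis[OF ker])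
  obtain D where D: "finite D" "D \<subseteq> f ` V" "t.span D = f ` V"
    by (rule findim_basis[OF im])
  define g where "g = inv_into V f"
  have g: "g d \<in> V" "f (g d) = d" if "d \<in> D" for d
    using that D(2) by (auto simp: g_def inv_into_into f_inv_into_f)
  have "x \<in> s.span (C \<union> g ` D)" if x: "x \<in> V" for x
  proof -
    have "f x \<in> t.span D" using x D by auto
    then obtain u where u: "f x = (\<Sum>d\<in>D. t (u d) d)" using t.span_finite[OF D(1)] by auto
    let ?y = "\<Sum>d\<in>D. s (u d) (g d)"
    have sg: "s (u d) (g d) \<in> V" if "d \<in> D" for d
      using g(1)[OF that] by (rule s.subspace_scale[OF vs(2)])
    have yV: "?y \<in> V" using sg by (rule s.subspace_sum[OF vs(2)])
    have "f ?y = (\<Sum>d\<in>D. f (s (u d) (g d)))" by (rule linear_on_sum[OF f vs sg])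
    also have "\<dots> = f x" unfolding u by (intro sum.cong) (simp_all add: linear_on_scale[OF f] g)
    finally have "f (x - ?y) = 0" by (simp add: linear_on_diff[OF f vs x yV])
    then have "x - ?y \<in> s.span C" unfolding C(2) using s.subspace_diff[OF vs(2) x yV] by simp
    then have "x - ?y \<in> s.span (C \<union> g ` D)" using s.span_mono[of C "C \<union> g ` D"] by blast
    moreover have "?y \<in> s.span (C \<union> g ` D)"
      by (intro s.span_sum s.span_scale s.span_base) auto
    ultimately have "(x - ?y) + ?y \<in> s.span (C \<union> g ` D)" by (rule s.span_add)
    then show ?thesis by simp
  qed
  then show ?thesis
    unfolding findim_def using vs C(1) D(1) by (auto intro!: exI[of _ "C \<union> g ` D"])
qed

lemma findim_zero:
  assumes "vector_space s"
  shows "findim s {0} \<and> vector_space.dim s {0} = 0"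
proof -
  interpret s: vector_space s by fact
  have "findim s {0}"
    unfolding findim_def using assms by (auto intro!: exI[of _ "{}"])
  then show ?thesis using dim_eq_0_iff_findim by blast
qed

text \<open>Vanishing outside \<open>I\<close> makes a family determined by its entries in
  \<open>I\<close>, although the index type may be larger.\<close>

definition fpow :: "'i set \<Rightarrow> 'v::zero set \<Rightarrow> ('i \<Rightarrow> 'v) set" where
  "fpow I X = {g. (\<forall>i\<in>I. g i \<in> X) \<and> (\<forall>i. i \<notin> I \<longrightarrow> g i = 0)}"

lemma subspace_fpow:
  assumes "vector_space s" "module.subspace s X"
  shows "module.subspace (fscale s) (fpow I X)"
proof -
  interpret s: vector_space s by fact
  interpret f: vector_space "fscale s" by (rule vector_space_fscale) fact
  show ?thesis
    using assms(2) by (auto simp: f.subspace_def s.subspace_def fpow_def)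
qed

text \<open>Evaluation at a new index maps the larger power onto \<open>X\<close>, with the smaller
  power as kernel.\<close>

lemma fpow_findim:
  fixes I :: "'i set" and s :: "'k::field \<Rightarrow> 'v::ab_group_add \<Rightarrow> 'v"
  assumes X: "findim s X" and "finite I"
  shows "findim (fscale s) (fpow I X) \<and>
    vector_space.dim (fscale s) (fpow I X) = card I * vector_space.dim s X"
  using assms(2)
proof induction
  case empty
  have "fpow ({} :: 'i set) X = {0}" by (auto simp: fpow_def)
  then show ?case
    using findim_zero[OF vector_space_fscale[OF findimD(1)[OF X]]] by (simp del: fscale_apply)
next
  case (insert i I)
  interpret s: vector_space s using X by (rule findimD)
  interpret f: vector_space "fscale s" by (rule vector_space_fscale) (rule s.vector_space_axioms)
  note subX = findimD(2)[OF X]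
  let ?V = "fpow (insert i I) X" and ?f = "\<lambda>g. g i"
  have lin: "linear_on (fscale s) s ?V ?f" by (simp add: linear_on_def)
  have ker: "{g \<in> ?V. g i = 0} = fpow I X"
    using insert(2) s.subspace_0[OF subX] by (auto simp: fpow_def)
  have im: "?f ` ?V = X"
  proof
    show "X \<subseteq> ?f ` ?V"
    proof
      fix x assume "x \<in> X"
      then have "(\<lambda>j. if j = i then x else 0) \<in> ?V"
        using s.subspace_0[OF subX] by (auto simp: fpow_def)
      then show "x \<in> ?f ` ?V" by (rule rev_image_eqI) simp
    qed
  qed (auto simp: fpow_def)
  have "findim (fscale s) ?V"
    by (rule findim_by_kernel_image[OF f.vector_space_axioms subspace_fpow[OF s.vector_space_axioms subX]
          s.vector_space_axioms lin]) (use insert X ker im in \<open>simp_all del: fscale_apply\<close>)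
  then show ?case
    using rank_nullity[OF _ s.vector_space_axioms lin] insert ker im by (simp del: fscale_apply)
qed

abbreviation lmap :: "('k \<Rightarrow> 'v::ab_group_add \<Rightarrow> 'v) \<Rightarrow> ('k \<Rightarrow> 'w::ab_group_add \<Rightarrow> 'w) \<Rightarrow> ('v \<Rightarrow> 'w) \<Rightarrow> bool"
  where "lmap s t \<equiv> linear_on s t UNIV"

abbreviation bmap where
  "bmap s t r \<phi> \<equiv> (\<forall>a. lmap t r (\<phi> a)) \<and> (\<forall>b. lmap s r (\<lambda>a. \<phi> a b))"

section \<open>Tensor products in coordinates\<close>

lemma is_vspaceD:
  assumes "is_vspace V"
  shows "vector_space (scl V)" and "module.subspace (scl V) (car V)"
  using assms by (simp_all add: is_vspace_def)

lemma lin_iff: "lin V W f \<longleftrightarrow> (\<forall>x\<in>car V. f x \<in> car W) \<and> linear_on (scl V) (scl W) (car V) f"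
  by (auto simp: lin_def linear_on_def)

lemma full_simps [simp]: "scl (full s) = s" "car (full s) = UNIV"
  by (simp_all add: full_def)

lemma ground_simps [simp]: "scl ground = (*)" "car ground = UNIV"
  by (simp_all add: ground_def)

lemma lin_full: "lin (full s) (full t) f \<longleftrightarrow> lmap s t f"
  by (simp add: lin_iff)

lemma bilin_full: "bilin (full s) (full t) (full r) \<phi> \<longleftrightarrow> bmap s t r \<phi>"
  by (simp add: bilin_def lin_full)

lemma scl_tensor [simp]: "scl (V \<otimes>\<^sub>v W) = fscale (*)"
  by (simp add: tensor_def fscale_def[abs_def])

lemma car_tensor: "car (V \<otimes>\<^sub>v W) = module.span (fscale (*)) {pure V W v w |v w. v \<in> car V \<and> w \<in> car W}"
  by (simp add: tensor_def fscale_def[abs_def])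

lemma pure_in_tensor:
  fixes V :: "('k::field, 'v::ab_group_add) vspace" and W :: "('k, 'w::ab_group_add) vspace"
  assumes "v \<in> car V" "w \<in> car W"
  shows "pure V W v w \<in> car (V \<otimes>\<^sub>v W)"
proof -
  interpret t: vector_space "fscale (*) :: 'k \<Rightarrow> (('v \<Rightarrow> 'w \<Rightarrow> 'k) \<Rightarrow> 'k) \<Rightarrow> _"
    by (rule vector_space_fscale[OF vector_space_ground])
  show ?thesis
    unfolding car_tensor using assms by (auto intro!: t.span_base)
qed

lemma linear_on_eq_tensor:
  assumes f: "linear_on (fscale (*)) t (car (V \<otimes>\<^sub>v W)) f"
    and g: "linear_on (fscale (*)) t (car (V \<otimes>\<^sub>v W)) g" and t: "vector_space t"
    and eq: "\<And>v w. v \<in> car V \<Longrightarrow> w \<in> car W \<Longrightarrow> f (pure V W v w) = g (pure V W v w)"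
    and z: "z \<in> car (V \<otimes>\<^sub>v W)"
  shows "f z = g z"
proof -
  interpret t: vector_space t by fact
  have vs: "vector_space (scl (V \<otimes>\<^sub>v W))" "module.subspace (scl (V \<otimes>\<^sub>v W)) (car (V \<otimes>\<^sub>v W))"
    by (rule is_vspaceD[OF is_vspace_tensor])+
  have "f z - g z = 0"
  proof (rule linear_on_span_eq_0[where f = "\<lambda>z. f z - g z", OF _ vs[unfolded scl_tensor] t])
    show "linear_on (fscale (*)) t (car (V \<otimes>\<^sub>v W)) (\<lambda>z. f z - g z)"
      using f g by (auto simp: linear_on_def t.scale_right_diff_distrib)
    show "z \<in> module.span (fscale (*)) {pure V W v w |v w. v \<in> car V \<and> w \<in> car W}"
      using z by (simp add: car_tensor)
  qed (auto simp: eq intro: pure_in_tensor)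
  then show ?thesis by simp
qed

context
  fixes V :: "('k::field, 'v::ab_group_add) vspace" and W :: "('k, 'w::ab_group_add) vspace"
    and X :: "('k, 'x::ab_group_add) vspace" and \<phi>
  assumes vs: "is_vspace V" "is_vspace W" "is_vspace X" and bil: "bilin V W X \<phi>"
begin

lemma tlift_linear: "linear_on (fscale (*)) (scl X) (car (V \<otimes>\<^sub>v W)) (tlift V W X \<phi>)"
  using tlift_in_Hom[OF vs bil] by (simp add: Hom_def lin_iff)

lemma tlift_car: "z \<in> car (V \<otimes>\<^sub>v W) \<Longrightarrow> tlift V W X \<phi> z \<in> car X"
  using tlift_in_Hom[OF vs bil] by (simp add: Hom_def lin_iff)

end

text \<open>A finite family with coordinate functionals. It is used for a basis of \<open>H\<close>
  with its coordinates, and for \<open>H^*\<close> with the coordinate functionals as vectors and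
  evaluation at the basis elements as coordinates.\<close>

locale framed =
  fixes V :: "('k::field, 'v::ab_group_add) vspace" and I :: "'i set" and b :: "'i \<Rightarrow> 'v"
    and c :: "'i \<Rightarrow> 'v \<Rightarrow> 'k"
  assumes vspace: "is_vspace V" and finite: "finite I" and b_car: "i \<in> I \<Longrightarrow> b i \<in> car V"
    and c_linear: "linear_on (scl V) (*) (car V) (c i)"
    and expand: "v \<in> car V \<Longrightarrow> v = (\<Sum>i\<in>I. scl V (c i v) (b i))"
begin

text \<open>Contraction of the first factor with \<open>c i\<close>; it extracts the coefficient, in
  the second factor, of \<open>b i\<close>.\<close>

definition tcomp :: "('k, 'w::ab_group_add) vspace \<Rightarrow> 'i \<Rightarrow> (('v \<Rightarrow> 'w \<Rightarrow> 'k) \<Rightarrow> 'k) \<Rightarrow> 'w" where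
  "tcomp W i z = tlift V W W (\<lambda>v w. scl W (c i v) w) z"

context
  fixes W :: "('k, 'w::ab_group_add) vspace"
  assumes W: "is_vspace W"
begin

lemma tcomp_bilin: "bilin V W W (\<lambda>v w. scl W (c i v) w)"
proof -
  interpret w: vector_space "scl W" using W by (simp add: is_vspace_def)
  have "w.subspace (car W)" using W by (simp add: is_vspace_def)
  then show ?thesis
    unfolding bilin_def lin_iff linear_on_def
    by (auto simp: w.subspace_scale w.scale_right_distrib w.scale_left_distrib
        linear_on_add[OF c_linear] linear_on_scale[OF c_linear] mult.commute)
qed

lemma tcomp_pure: "v \<in> car V \<Longrightarrow> w \<in> car W \<Longrightarrow> tcomp W i (pure V W v w) = scl W (c i v) w"
  unfolding tcomp_def by (rule tlift_pure[OF vspace W W tcomp_bilin])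

lemma tcomp_linear: "linear_on (fscale (*)) (scl W) (car (V \<otimes>\<^sub>v W)) (tcomp W i)"
  unfolding tcomp_def[abs_def] by (rule tlift_linear[OF vspace W W tcomp_bilin])

lemma tcomp_car: "z \<in> car (V \<otimes>\<^sub>v W) \<Longrightarrow> tcomp W i z \<in> car W"
  unfolding tcomp_def by (rule tlift_car[OF vspace W W tcomp_bilin])

text \<open>Both sides are linear in \<open>z\<close>, so pure tensors suffice, and there
  \<open>v\<close> is expanded in the frame. This turns the abstract \<open>tlift\<close> in all
  Hopf algebra axioms into a finite sum.\<close>

lemma tlift_eq_sum:
  assumes X: "is_vspace X" and bil: "bilin V W X \<phi>" and z: "z \<in> car (V \<otimes>\<^sub>v W)"
  shows "tlift V W X \<phi> z = (\<Sum>i\<in>I. \<phi> (b i) (tcomp W i z))"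
proof (rule linear_on_eq_tensor[OF tlift_linear[OF vspace W X bil] _ _ _ z])
  interpret x: vector_space "scl X" using X by (simp add: is_vspace_def)
  interpret v: vector_space "scl V" using vspace by (simp add: is_vspace_def)
  show "vector_space (scl X)" by (rule x.vector_space_axioms)
  have lw: "linear_on (scl W) (scl X) (car W) (\<phi> v)" if "v \<in> car V" for v
    using bil that by (simp add: bilin_def lin_iff)
  have lv: "linear_on (scl V) (scl X) (car V) (\<lambda>v. \<phi> v w)" if "w \<in> car W" for w
    using bil that by (simp add: bilin_def lin_iff)
  show "linear_on (fscale (*)) (scl X) (car (V \<otimes>\<^sub>v W)) (\<lambda>z. \<Sum>i\<in>I. \<phi> (b i) (tcomp W i z))"
    by (intro linear_onI)
      (simp_all add: linear_on_add[OF tcomp_linear] linear_on_add[OF lw] linear_on_scale[OF tcomp_linear]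
        linear_on_scale[OF lw] b_car tcomp_car sum.distrib x.scale_sum_right)
  fix v w assume v: "v \<in> car V" and w: "w \<in> car W"
  have vs: "v.subspace (car V)" using vspace by (simp add: is_vspace_def)
  have "\<phi> v w = \<phi> (\<Sum>i\<in>I. scl V (c i v) (b i)) w" using expand[OF v] by simp
  also have "\<dots> = (\<Sum>i\<in>I. \<phi> (scl V (c i v) (b i)) w)"
    by (rule linear_on_sum[OF lv[OF w] v.vector_space_axioms vs]) (simp add: b_car v.subspace_scale[OF vs])
  also have "\<dots> = (\<Sum>i\<in>I. \<phi> (b i) (scl W (c i v) w))"
    by (intro sum.cong) (simp_all add: linear_on_scale[OF lv[OF w]] linear_on_scale[OF lw] b_car w)
  finally show "tlift V W X \<phi> (pure V W v w) = (\<Sum>i\<in>I. \<phi> (b i) (tcomp W i (pure V W v w)))"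
    by (simp add: tlift_pure[OF vspace W X bil v w] tcomp_pure v w)
qed

lemma tensor_expand:
  assumes z: "z \<in> car (V \<otimes>\<^sub>v W)"
  shows "z = (\<Sum>i\<in>I. pure V W (b i) (tcomp W i z))"
proof -
  have bil: "bilin V W (V \<otimes>\<^sub>v W) (pure V W)" by (rule bilin_pure[OF vspace W])
  have "z = tlift V W (V \<otimes>\<^sub>v W) (pure V W) z"
    by (rule linear_on_eq_tensor[OF _ tlift_linear[OF vspace W is_vspace_tensor bil,
          unfolded scl_tensor] _ _ z])
      (auto simp: linear_on_def tlift_pure[OF vspace W is_vspace_tensor bil]
        intro: vector_space_fscale[OF vector_space_ground])
  also have "\<dots> = (\<Sum>i\<in>I. pure V W (b i) (tcomp W i z))"
    by (rule tlift_eq_sum[OF is_vspace_tensor bil z])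
  finally show ?thesis .
qed

end

end

definition crd :: "('k::field \<Rightarrow> 'v::ab_group_add \<Rightarrow> 'v) \<Rightarrow> 'v set \<Rightarrow> 'v \<Rightarrow> 'v \<Rightarrow> 'k" where
  "crd s B e a = module.representation s B a e"

context finite_dimensional_vector_space
begin

lemma crd_linear: "lmap scale (*) (crd scale Basis e)"
  by (rule linear_onI)
    (simp_all add: crd_def representation_add representation_scale independent_Basis span_Basis)

lemma crd_expand: "a = (\<Sum>e\<in>Basis. scale (crd scale Basis e a) e)"
  using sum_representation_eq[OF independent_Basis _ finite_Basis subset_refl, of a]
  by (simp add: crd_def span_Basis)

lemma crd_basis: "e \<in> Basis \<Longrightarrow> crd scale Basis d e = (if d = e then 1 else 0)"
  by (simp add: crd_def representation_basis independent_Basis)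

lemma lmap_expand:
  assumes f: "lmap scale t f" and t: "vector_space t"
  shows "f a = (\<Sum>e\<in>Basis. t (crd scale Basis e a) (f e))"
proof -
  have "f a = f (\<Sum>e\<in>Basis. scale (crd scale Basis e a) e)" using crd_expand[of a] by simp
  also have "\<dots> = (\<Sum>e\<in>Basis. f (scale (crd scale Basis e a) e))"
    by (rule linear_on_sum[OF f]) (auto intro: vector_space_axioms)
  finally show ?thesis by (simp add: linear_on_scale[OF f])
qed

lemma findim_UNIV: "findim scale UNIV"
  unfolding findim_def using vector_space_axioms finite_Basis span_Basis by auto

text \<open>Linear extension from the basis identifies the power of \<open>X\<close> indexed by
  \<open>Basis\<close> with the space of linear maps into \<open>X\<close>.\<close>

lemma lmaps_findim:
  assumes X: "findim t X"
  shows "findim (fscale t) {g. lmap scale t g \<and> (\<forall>a. g a \<in> X)} \<and>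
    vector_space.dim (fscale t) {g. lmap scale t g \<and> (\<forall>a. g a \<in> X)} = card Basis * vector_space.dim t X"
proof -
  interpret t: vector_space t using X by (rule findimD)
  note subX = findimD(2)[OF X]
  let ?V = "fpow Basis X" and ?f = "\<lambda>g a. \<Sum>e\<in>Basis. t (crd scale Basis e a) (g e)"
  note P = fpow_findim[OF X finite_Basis]
  have lin: "linear_on (fscale t) (fscale t) ?V ?f"
    by (rule linear_onI)
      (auto simp: fun_eq_iff t.scale_right_distrib sum.distrib t.scale_sum_right mult.commute)
  have fb: "?f g e = g e" if "e \<in> Basis" for g e
  proof -
    have "?f g e = (\<Sum>d\<in>Basis. if d = e then g e else 0)"
      by (intro sum.cong) (simp_all add: crd_basis that)
    then show ?thesis using that finite_Basis by simp
  qed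
  have im: "?f ` ?V = {g. lmap scale t g \<and> (\<forall>a. g a \<in> X)}"
  proof (intro equalityI subsetI)
    fix g assume "g \<in> ?f ` ?V"
    then obtain h where h: "h \<in> ?V" "g = ?f h" by blast
    have "lmap scale t g"
      unfolding h(2) by (rule linear_onI)
        (simp_all add: linear_on_add[OF crd_linear] linear_on_scale[OF crd_linear]
          t.scale_left_distrib sum.distrib t.scale_sum_right)
    moreover have "g a \<in> X" for a
      unfolding h(2) using h(1) by (intro t.subspace_sum[OF subX] t.subspace_scale[OF subX]) (simp add: fpow_def)
    ultimately show "g \<in> {g. lmap scale t g \<and> (\<forall>a. g a \<in> X)}" by simp
  next
    fix g assume g: "g \<in> {g. lmap scale t g \<and> (\<forall>a. g a \<in> X)}"
    show "g \<in> ?f ` ?V"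
    proof (rule image_eqI)
      show "(\<lambda>e. if e \<in> Basis then g e else 0) \<in> ?V" using g by (simp add: fpow_def)
      show "g = ?f (\<lambda>e. if e \<in> Basis then g e else 0)"
      proof
        fix a
        have "g a = (\<Sum>e\<in>Basis. t (crd scale Basis e a) (g e))"
          using g by (intro lmap_expand t.vector_space_axioms) simp
        also have "\<dots> = ?f (\<lambda>e. if e \<in> Basis then g e else 0) a" by (intro sum.cong) simp_all
        finally show "g a = ?f (\<lambda>e. if e \<in> Basis then g e else 0) a" .
      qed
    qed
  qed
  have inj: "g = 0" if g: "g \<in> ?V" "?f g = 0" for g
  proof
    fix e show "g e = 0 e"
      using fb[of e g] fun_cong[OF g(2), of e] g(1)
      by (cases "e \<in> Basis") (simp_all add: fpow_def)
  qed
  have vs: "vector_space (fscale t)" by (rule vector_space_fscale) (rule t.vector_space_axioms)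
  show ?thesis
    using findim_image[OF conjunct1[OF P] vs lin] dim_image_inj[OF conjunct1[OF P] vs lin inj] P
    unfolding im by simp
qed

lemma framed_full: "framed (full scale) Basis (\<lambda>e. e) (crd scale Basis)"
  using crd_expand finite_Basis crd_linear
  by (auto simp: framed_def is_vspace_full[OF vector_space_axioms])

end

section \<open>Sweedler sums and the antipode\<close>

lemma linear_on_const_0: "vector_space t \<Longrightarrow> linear_on s t V (\<lambda>_. 0)"
  by (rule linear_onI) (simp_all add: vector_space.scale_eq_0_iff)

lemma linear_on_sum_fun:
  assumes t: "vector_space t" and f: "\<And>i. i \<in> I \<Longrightarrow> linear_on s t V (f i)"
  shows "linear_on s t V (\<lambda>x. \<Sum>i\<in>I. f i x)"
proof -
  interpret t: vector_space t by fact
  show ?thesis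
    using f unfolding linear_on_def by (simp add: sum.distrib t.scale_sum_right)
qed

lemma linear_on_compose:
  assumes "linear_on t r W g" "linear_on s t V f" "f ` V \<subseteq> W"
  shows "linear_on s r V (\<lambda>x. g (f x))"
  using assms unfolding linear_on_def by (simp add: image_subset_iff)

lemma lmap_compose: "lmap t r g \<Longrightarrow> lmap s t f \<Longrightarrow> lmap s r (\<lambda>x. g (f x))"
  unfolding linear_on_def by simp

lemma lmap_ident: "lmap s s (\<lambda>x. x)"
  by (rule linear_onI) simp_all

lemma lmap_scale_right:
  assumes "vector_space t" "lmap s t f" shows "lmap s t (\<lambda>x. t c (f x))"
proof -
  interpret t: vector_space t by fact
  show ?thesis
    using assms(2) unfolding linear_on_def by (simp add: t.scale_right_distrib mult.commute)
qed

lemma lmap_scale_left: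
  assumes "vector_space t" "lmap s (*) f" shows "lmap s t (\<lambda>x. t (f x) w)"
proof -
  interpret t: vector_space t by fact
  show ?thesis
    using assms(2) unfolding linear_on_def by (simp add: t.scale_left_distrib)
qed

context algebra_over
begin

lemma lmap_mult_left: "lmap t s f \<Longrightarrow> lmap t s (\<lambda>x. f x * c)"
  unfolding linear_on_def by (simp add: distrib_right scale_mult_left)

lemma lmap_mult_right: "lmap t s f \<Longrightarrow> lmap t s (\<lambda>x. c * f x)"
  unfolding linear_on_def by (simp add: distrib_left scale_mult_right)

end

definition trilinear where
  "trilinear r s t q \<phi> \<longleftrightarrow> (\<forall>b c. lmap r q (\<lambda>a. \<phi> a b c)) \<and> (\<forall>a c. lmap s q (\<lambda>b. \<phi> a b c)) \<and>
    (\<forall>a b. lmap t q (\<phi> a b))"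

lemma tensor_vs:
  "vector_space (fscale (*))" "module.subspace (fscale (*)) (car (V \<otimes>\<^sub>v W))"
  using is_vspaceD(2)[OF is_vspace_tensor] vector_space_fscale[OF vector_space_ground] by simp_all

lemma bilin_pure_comp:
  assumes X: "is_vspace X" and Y: "is_vspace Y" and f: "lin V X f" and g: "lin W Y g"
  shows "bilin V W (X \<otimes>\<^sub>v Y) (\<lambda>v w. pure X Y (f v) (g w))"
proof -
  have "bilin X Y (X \<otimes>\<^sub>v Y) (pure X Y)" by (rule bilin_pure[OF X Y])
  then show ?thesis using f g unfolding bilin_def lin_def by simp
qed

lemma lin_id: "lin V V id" "lin V V (\<lambda>x. x)"
  by (simp_all add: lin_def)

locale fd_hopf_algebra = hopf_algebra sH \<Delta> \<epsilon> S
  for sH :: "'k::field \<Rightarrow> 'h::ring_1 \<Rightarrow> 'h"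
    and \<Delta> :: "'h \<Rightarrow> ('h \<Rightarrow> 'h \<Rightarrow> 'k) \<Rightarrow> 'k"
    and \<epsilon> :: "'h \<Rightarrow> 'k"
    and S :: "'h \<Rightarrow> 'h" +
  fixes B :: "'h set"
  assumes basis: "finite_dimensional_vector_space sH B"
begin

sublocale HB: finite_dimensional_vector_space sH B by (rule basis)

sublocale F: framed "full sH" B "\<lambda>e. e" "crd sH B" by (rule HB.framed_full)

abbreviation "HS \<equiv> full sH"

lemma vsH: "vector_space sH" by (rule vector_space_axioms)

lemma is_vspace_H: "is_vspace HS" by (rule is_vspace_full[OF vsH])

text \<open>
  The second tensor factors in \<open>\<Delta> a = (\<Sum>e\<in>B. e \<otimes> dcomp e a)\<close>. With them,
  \<open>\<phi>(a\<^sub>(\<^sub>1\<^sub>), a\<^sub>(\<^sub>2\<^sub>))\<close> becomes a finite sum, written \<open>sw a \<phi>\<close> below; for the coaction,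
  \<open>\<phi>(x\<^sub>(\<^sub>-\<^sub>1\<^sub>), x\<^sub>(\<^sub>0\<^sub>))\<close> is likewise \<open>co x \<phi>\<close>, with components \<open>rcomp e x\<close>.
\<close>

definition dcomp :: "'h \<Rightarrow> 'h \<Rightarrow> 'h" where
  "dcomp e a = F.tcomp HS e (\<Delta> a)"

lemma comult_car: "\<Delta> a \<in> car (HS \<otimes>\<^sub>v HS)"
  using comult_linear by (simp add: Hom_def lin_iff)

lemma lin_comult: "lin HS (HS \<otimes>\<^sub>v HS) \<Delta>"
  using comult_linear by (simp add: Hom_def)

section \<open>Coactions of \<open>H\<close> in components, covering both the comultiplication and
  the coaction on \<open>K\<close>\<close>

context
  fixes sW :: "'k \<Rightarrow> 'w::ab_group_add \<Rightarrow> 'w" and \<delta> :: "'w \<Rightarrow> ('h \<Rightarrow> 'w \<Rightarrow> 'k) \<Rightarrow> 'k"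
  assumes vsW: "vector_space sW" and coaction: "\<delta> \<in> car (Hom (full sW) (HS \<otimes>\<^sub>v full sW))"
begin

lemma coaction_car: "\<delta> w \<in> car (HS \<otimes>\<^sub>v full sW)"
  using coaction by (simp add: Hom_def lin_iff)

lemma coaction_lin: "lin (full sW) (HS \<otimes>\<^sub>v full sW) \<delta>"
  using coaction by (simp add: Hom_def)

lemma is_vspace_W: "is_vspace (full sW)" by (rule is_vspace_full[OF vsW])

lemma coaction_comp_linear: "lmap sW sW (\<lambda>w. F.tcomp (full sW) e (\<delta> w))"
proof (rule linear_on_compose[OF F.tcomp_linear[OF is_vspace_W, of e, unfolded full_simps]])
  show "linear_on sW (fscale (*)) UNIV \<delta>" "range \<delta> \<subseteq> car (HS \<otimes>\<^sub>v full sW)"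
    using coaction_lin by (auto simp: lin_iff)
qed

lemma coaction_tlift:
  assumes t: "vector_space t" and \<phi>: "bmap sH sW t \<phi>"
  shows "tlift HS (full sW) (full t) \<phi> (\<delta> w) = (\<Sum>e\<in>B. \<phi> e (F.tcomp (full sW) e (\<delta> w)))"
  by (rule F.tlift_eq_sum[OF is_vspace_W is_vspace_full[OF t] _ coaction_car]) (simp add: bilin_full \<phi>)

text \<open>The axiom is an equation in \<open>H \<otimes> (H \<otimes> W)\<close>. Applying the
  linear map induced by the trilinear \<open>\<phi>\<close> to both sides leaves an identity of
  finite sums, which no longer mentions tensors.\<close>

lemma coaction_coassoc:
  assumes coassoc: "tensor_assoc HS HS (full sW)
         (tensor_map HS (full sW) (HS \<otimes>\<^sub>v HS) (full sW) \<Delta> id (\<delta> w)) =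
       tensor_map HS (full sW) HS (HS \<otimes>\<^sub>v full sW) id \<delta> (\<delta> w)"
    and t: "vector_space t" and \<phi>: "trilinear sH sH sW t \<phi>"
  shows "(\<Sum>e\<in>B. \<Sum>d\<in>B. \<phi> d (dcomp d e) (F.tcomp (full sW) e (\<delta> w))) =
    (\<Sum>e\<in>B. \<Sum>d\<in>B. \<phi> e d (F.tcomp (full sW) d (\<delta> (F.tcomp (full sW) e (\<delta> w)))))"
proof -
  let ?W = "full sW" and ?T = "full t" and ?c = "\<lambda>e w. F.tcomp (full sW) e (\<delta> w)"
  let ?HW = "HS \<otimes>\<^sub>v full sW"
  note is_t = is_vspace_full[OF t]
  define \<psi> where "\<psi> = tlift HS ?HW ?T (\<lambda>a z. tlift HS ?W ?T (\<phi> a) z)"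
  have bil: "bilin HS ?W ?T (\<phi> a)" for a
    using \<phi> by (simp add: bilin_full trilinear_def)
  have bil2: "bilin HS ?HW ?T (\<lambda>a z. tlift HS ?W ?T (\<phi> a) z)"
    unfolding bilin_def
  proof (intro conjI ballI)
    show "lin ?HW ?T (tlift HS ?W ?T (\<phi> a))" for a
      using tlift_linear[OF is_vspace_H is_vspace_W is_t bil] by (simp add: lin_iff)
    fix z assume z: "z \<in> car ?HW"
    have "lmap sH t (\<lambda>a. \<Sum>e\<in>B. \<phi> a e (F.tcomp ?W e z))"
      using \<phi> by (intro linear_on_sum_fun[OF t]) (simp add: trilinear_def)
    then show "lin HS ?T (\<lambda>a. tlift HS ?W ?T (\<phi> a) z)"
      by (simp add: lin_full F.tlift_eq_sum[OF is_vspace_W is_t bil z])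
  qed
  have psi_lin: "linear_on (fscale (*)) t (car (HS \<otimes>\<^sub>v ?HW)) \<psi>"
    unfolding \<psi>_def using tlift_linear[OF is_vspace_H is_vspace_tensor is_t bil2] by simp
  have psi_pure: "\<psi> (pure HS ?HW a z) = tlift HS ?W ?T (\<phi> a) z" if "z \<in> car ?HW" for a z
    unfolding \<psi>_def using tlift_pure[OF is_vspace_H is_vspace_tensor is_t bil2] that by simp
  have psi_pure2: "\<psi> (pure HS ?HW a (pure HS ?W b w)) = \<phi> a b w" for a b w
    using psi_pure[OF pure_in_tensor] tlift_pure[OF is_vspace_H is_vspace_W is_t bil] by simp
  have "tensor_map HS ?W HS ?HW id \<delta> (\<delta> w) = (\<Sum>e\<in>B. pure HS ?HW e (\<delta> (?c e w)))"
    unfolding tensor_map_def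
    by (subst F.tlift_eq_sum[OF is_vspace_W is_vspace_tensor _ coaction_car])
      (auto intro!: bilin_pure_comp is_vspace_H is_vspace_tensor lin_id coaction_lin)
  then have "\<psi> (tensor_map HS ?W HS ?HW id \<delta> (\<delta> w)) = (\<Sum>e\<in>B. \<psi> (pure HS ?HW e (\<delta> (?c e w))))"
    by (simp add: linear_on_sum[OF psi_lin tensor_vs pure_in_tensor] coaction_car)
  also have "\<dots> = (\<Sum>e\<in>B. \<Sum>d\<in>B. \<phi> e d (?c d (?c e w)))"
    by (simp add: psi_pure coaction_car F.tlift_eq_sum[OF is_vspace_W is_t bil])
  finally have R: "\<psi> (tensor_map HS ?W HS ?HW id \<delta> (\<delta> w)) = \<dots>" .
  let ?HH = "HS \<otimes>\<^sub>v HS"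
  have L1: "tensor_map HS ?W ?HH ?W \<Delta> id (\<delta> w) = (\<Sum>e\<in>B. pure ?HH ?W (\<Delta> e) (?c e w))"
    unfolding tensor_map_def
    by (subst F.tlift_eq_sum[OF is_vspace_W is_vspace_tensor _ coaction_car])
      (auto intro!: bilin_pure_comp is_vspace_W is_vspace_tensor lin_id lin_comult)
  have bw: "bilin HS ?W ?HW (pure HS ?W)" by (rule bilin_pure[OF is_vspace_H is_vspace_W])
  have bhw: "bilin HS ?HW (HS \<otimes>\<^sub>v ?HW) (pure HS ?HW)" by (rule bilin_pure[OF is_vspace_H is_vspace_tensor])
  \<comment> \<open>\<open>tensor_assoc\<close> consists of two nested lifts. Each has to be shown
    bilinear before its \<open>tlift\<close> can be evaluated.\<close>
  have bi: "bilin HS HS (HS \<otimes>\<^sub>v ?HW) (\<lambda>u v. pure HS ?HW u (pure HS ?W v w))" for w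
    using bw bhw by (simp add: bilin_def lin_def)
  have bo: "bilin ?HH ?W (HS \<otimes>\<^sub>v ?HW)
      (\<lambda>z w. tlift HS HS (HS \<otimes>\<^sub>v ?HW) (\<lambda>u v. pure HS ?HW u (pure HS ?W v w)) z)"
    unfolding bilin_def
  proof (intro conjI ballI)
    show "lin ?HH (HS \<otimes>\<^sub>v ?HW) (tlift HS HS (HS \<otimes>\<^sub>v ?HW) (\<lambda>u v. pure HS ?HW u (pure HS ?W v w)))" for w
      using tlift_linear[OF is_vspace_H is_vspace_H is_vspace_tensor bi]
        tlift_car[OF is_vspace_H is_vspace_H is_vspace_tensor bi] by (simp add: lin_iff)
    fix z assume z: "z \<in> car ?HH"
    have "lmap sW (fscale (*)) (\<lambda>w. \<Sum>e\<in>B. pure HS ?HW e (pure HS ?W (F.tcomp HS e z) w))"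
      using bw bhw by (intro linear_on_sum_fun[OF tensor_vs(1)] linear_onI) (simp_all add: bilin_def lin_def)
    then show "lin ?W (HS \<otimes>\<^sub>v ?HW)
        (\<lambda>w. tlift HS HS (HS \<otimes>\<^sub>v ?HW) (\<lambda>u v. pure HS ?HW u (pure HS ?W v w)) z)"
      using tlift_car[OF is_vspace_H is_vspace_H is_vspace_tensor bi z]
      by (simp add: lin_iff F.tlift_eq_sum[OF is_vspace_H is_vspace_tensor bi z])
  qed
  have "tensor_assoc HS HS ?W (\<Sum>e\<in>B. pure ?HH ?W (\<Delta> e) (?c e w)) =
      (\<Sum>e\<in>B. tensor_assoc HS HS ?W (pure ?HH ?W (\<Delta> e) (?c e w)))"
    unfolding tensor_assoc_def
    by (rule linear_on_sum[OF tlift_linear[OF is_vspace_tensor is_vspace_W is_vspace_tensor bo] tensor_vs])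
      (simp add: pure_in_tensor comult_car)
  also have "\<dots> = (\<Sum>e\<in>B. \<Sum>d\<in>B. pure HS ?HW d (pure HS ?W (dcomp d e) (?c e w)))"
    unfolding tensor_assoc_def dcomp_def
    by (simp add: tlift_pure[OF is_vspace_tensor is_vspace_W is_vspace_tensor bo] comult_car
        F.tlift_eq_sum[OF is_vspace_H is_vspace_tensor bi])
  finally have "\<psi> (tensor_assoc HS HS ?W (\<Sum>e\<in>B. pure ?HH ?W (\<Delta> e) (?c e w))) =
      (\<Sum>e\<in>B. \<Sum>d\<in>B. \<psi> (pure HS ?HW d (pure HS ?W (dcomp d e) (?c e w))))"
    by (simp add: linear_on_sum[OF psi_lin tensor_vs] pure_in_tensor
        module.subspace_sum[OF _ tensor_vs(2)] tensor_vs(1) module_iff_vector_space)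
  then have L: "\<psi> (tensor_assoc HS HS ?W (tensor_map HS ?W ?HH ?W \<Delta> id (\<delta> w))) =
      (\<Sum>e\<in>B. \<Sum>d\<in>B. \<phi> d (dcomp d e) (?c e w))"
    by (simp add: L1 psi_pure2)
  show ?thesis using L R coassoc by simp
qed

end

text \<open>Multiplicativity is an equation in \<open>H \<otimes> W\<close>; the linear map induced
  by \<open>\<phi>\<close> carries it over to finite sums.\<close>

lemma coaction_mult:
  fixes sW :: "'k \<Rightarrow> 'w::{ring, monoid_mult} \<Rightarrow> 'w"
  assumes W: "algebra_over sW"
    and \<delta>: "\<delta> \<in> car (Hom (full sW) (HS \<otimes>\<^sub>v full sW))"
    and mult: "\<delta> (x * y) = tensor_mult HS (full sW) (\<delta> x) (\<delta> y)"
    and t: "vector_space t" and \<phi>: "bmap sH sW t \<phi>"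
  shows "(\<Sum>e\<in>B. \<phi> e (F.tcomp (full sW) e (\<delta> (x * y)))) =
    (\<Sum>e\<in>B. \<Sum>d\<in>B. \<phi> (e * d) (F.tcomp (full sW) e (\<delta> x) * F.tcomp (full sW) d (\<delta> y)))"
proof -
  interpret W: algebra_over sW by fact
  note vsW = W.vector_space_axioms
  let ?W = "full sW" and ?c = "\<lambda>e w. F.tcomp (full sW) e (\<delta> w)"
  let ?HW = "HS \<otimes>\<^sub>v full sW"
  note is_W = is_vspace_full[OF vsW] and is_t = is_vspace_full[OF t]
  have bp: "bilin HS ?W ?HW (pure HS ?W)" by (rule bilin_pure[OF is_vspace_H is_W])
  have bi: "bilin HS ?W ?HW (\<lambda>c d. pure HS ?W (a * c) (b * d))" for a b
    using bp by (simp add: bilin_def lin_def distrib_left scale_mult_right W.scale_mult_right)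
  have bi': "bilin HS ?W ?HW (\<lambda>a b. pure HS ?W (a * c) (b * d))" for c d
    using bp by (simp add: bilin_def lin_def distrib_right scale_mult_left W.scale_mult_left)
  have inner: "tlift HS ?W ?HW (\<lambda>c d. pure HS ?W (a * c) (b * d)) (\<delta> y) =
      (\<Sum>d\<in>B. pure HS ?W (a * d) (b * ?c d y))" for a b
    by (rule F.tlift_eq_sum[OF is_W is_vspace_tensor bi coaction_car[OF vsW \<delta>]])
  have bo: "bilin HS ?W ?HW (\<lambda>a b. tlift HS ?W ?HW (\<lambda>c d. pure HS ?W (a * c) (b * d)) (\<delta> y))"
    unfolding inner
    using bi' by (auto simp: bilin_def lin_iff intro!: linear_on_sum_fun tensor_vs
        module.subspace_sum[OF _ tensor_vs(2)] simp: module_iff_vector_space)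
  have "\<delta> (x * y) = (\<Sum>e\<in>B. \<Sum>d\<in>B. pure HS ?W (e * d) (?c e x * ?c d y))"
    unfolding mult tensor_mult_def
    by (subst F.tlift_eq_sum[OF is_W is_vspace_tensor bo coaction_car[OF vsW \<delta>]]) (simp add: inner)
  moreover have bt: "bilin HS ?W (full t) \<phi>" using \<phi> by (simp add: bilin_full)
  ultimately have "tlift HS ?W (full t) \<phi> (\<delta> (x * y)) =
      (\<Sum>e\<in>B. \<Sum>d\<in>B. tlift HS ?W (full t) \<phi> (pure HS ?W (e * d) (?c e x * ?c d y)))"
    by (simp add: linear_on_sum[OF tlift_linear[OF is_vspace_H is_W is_t bt] tensor_vs] pure_in_tensor
        module.subspace_sum[OF _ tensor_vs(2)] tensor_vs(1) module_iff_vector_space)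
  then show ?thesis
    by (simp add: tlift_pure[OF is_vspace_H is_W is_t bt] coaction_tlift[OF vsW \<delta> t \<phi>])
qed

definition sw :: "'h \<Rightarrow> ('h \<Rightarrow> 'h \<Rightarrow> 'x::comm_monoid_add) \<Rightarrow> 'x" where
  "sw a \<phi> = (\<Sum>e\<in>B. \<phi> e (dcomp e a))"

lemma comult_tlift:
  "vector_space t \<Longrightarrow> bmap sH sH t \<phi> \<Longrightarrow> tlift HS HS (full t) \<phi> (\<Delta> a) = sw a \<phi>"
  unfolding sw_def dcomp_def by (rule coaction_tlift[OF vsH comult_linear])

lemma dcomp_linear: "lmap sH sH (dcomp e)"
  using coaction_comp_linear[OF vsH comult_linear, of e] by (simp add: dcomp_def[abs_def])

lemma sw_coassoc:
  assumes "vector_space t" "trilinear sH sH sH t \<phi>"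
  shows "sw a (\<lambda>p r. sw p (\<lambda>p q. \<phi> p q r)) = sw a (\<lambda>p r. sw r (\<phi> p))"
  using coaction_coassoc[where \<delta> = \<Delta> and w = a, OF vsH comult_linear coassoc assms] by (simp add: sw_def flip: dcomp_def)

lemma sw_mult:
  assumes "vector_space t" "bmap sH sH t \<phi>"
  shows "sw (a * b) \<phi> = sw a (\<lambda>a1 a2. sw b (\<lambda>b1 b2. \<phi> (a1 * b1) (a2 * b2)))"
  using coaction_mult[where \<delta> = \<Delta> and x = a and y = b, OF algebra_over_axioms comult_linear comult_mult assms]
  by (simp add: sw_def flip: dcomp_def)

lemma sw_one:
  assumes t: "vector_space t" and \<phi>: "bmap sH sH t \<phi>"
  shows "sw 1 \<phi> = \<phi> 1 1"
  using tlift_pure[OF is_vspace_H is_vspace_H is_vspace_full[OF t] bilin_full[THEN iffD2, OF \<phi>], of 1 1]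
  by (simp add: comult_one flip: comult_tlift[OF t \<phi>])

lemma counit_lmap: "lmap sH (*) \<epsilon>"
  using counit_linear by (simp add: dual_def Hom_def lin_iff)

lemma antipode_lmap: "lmap sH sH S"
  using antipode_linear by (simp add: Hom_def lin_iff)

text \<open>Each rearrangement of a Sweedler sum requires its summand to be linear in every slot.
  These rules derive that from the shape of the term.\<close>

named_theorems lin_intros

lemmas [lin_intros] = lmap_ident lmap_mult_left lmap_mult_right
  lmap_compose[OF antipode_lmap] lmap_compose[OF counit_lmap]
  lmap_scale_left lmap_scale_right vsH vector_space_ground

lemma lmap_sw [lin_intros]:
  assumes "vector_space t" "lmap s sH f" "\<And>p. lmap sH t (\<phi> p)"
  shows "lmap s t (\<lambda>x. sw (f x) \<phi>)"
  unfolding sw_def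
  by (rule linear_on_sum_fun[OF assms(1)] lmap_compose[OF assms(3)] lmap_compose[OF dcomp_linear] assms(2))+

lemma lmap_sw_fun [lin_intros]:
  assumes "vector_space t" "\<And>p q. lmap s t (\<lambda>x. \<phi> x p q)"
  shows "lmap s t (\<lambda>x. sw a (\<phi> x))"
  unfolding sw_def by (rule linear_on_sum_fun[OF assms(1)]) (rule assms(2))

lemma sw_linear_image:
  assumes "lmap t r f" "vector_space t"
  shows "f (sw a \<phi>) = sw a (\<lambda>p q. f (\<phi> p q))"
proof -
  interpret t: vector_space t by fact
  show ?thesis unfolding sw_def by (rule linear_on_sum[OF assms]) simp_all
qed

lemma sw_mult_left: "sw a (\<lambda>p q. c * \<phi> p q) = c * sw a \<phi>" for c :: "'x::ring"
  by (simp add: sw_def sum_distrib_left)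

lemma sw_mult_right: "sw a (\<lambda>p q. \<phi> p q * c) = sw a \<phi> * c" for c :: "'x::ring"
  by (simp add: sw_def sum_distrib_right)

lemma sw_scale: "vector_space t \<Longrightarrow> sw a (\<lambda>p q. t c (\<phi> p q)) = t c (sw a \<phi>)"
  by (simp add: sw_def vector_space.vector_space_assms module.scale_sum_right module_iff_vector_space)

lemma sw_swap: "sw a (\<lambda>p q. sw b (\<lambda>r s. \<phi> p q r s)) = sw b (\<lambda>r s. sw a (\<lambda>p q. \<phi> p q r s))"
  unfolding sw_def by (rule sum.swap)

lemma sw_counit_left:
  assumes t: "vector_space t" and f: "lmap sH t f"
  shows "sw a (\<lambda>p q. t (\<epsilon> p) (f q)) = f a"
proof -
  have "f (sw a (\<lambda>p q. sH (\<epsilon> p) q)) = sw a (\<lambda>p q. t (\<epsilon> p) (f q))"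
    by (simp add: sw_linear_image[OF f vsH] linear_on_scale[OF f])
  moreover have "sw a (\<lambda>p q. sH (\<epsilon> p) q) = a"
    by (subst comult_tlift[symmetric]) (auto intro!: lin_intros counit_left)
  ultimately show ?thesis by simp
qed

lemma sw_counit_right:
  assumes t: "vector_space t" and f: "lmap sH t f"
  shows "sw a (\<lambda>p q. t (\<epsilon> q) (f p)) = f a"
proof -
  have "f (sw a (\<lambda>p q. sH (\<epsilon> q) p)) = sw a (\<lambda>p q. t (\<epsilon> q) (f p))"
    by (simp add: sw_linear_image[OF f vsH] linear_on_scale[OF f])
  moreover have "sw a (\<lambda>p q. sH (\<epsilon> q) p) = a"
    by (subst comult_tlift[symmetric]) (auto intro!: lin_intros counit_right)
  ultimately show ?thesis by simp
qed

lemma sw_antipode_left: "sw a (\<lambda>p q. S p * q) = sH (\<epsilon> a) 1"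
  by (subst comult_tlift[symmetric]) (auto intro!: lin_intros antipode_left)

lemma sw_antipode_right: "sw a (\<lambda>p q. p * S q) = sH (\<epsilon> a) 1"
  by (subst comult_tlift[symmetric]) (auto intro!: lin_intros antipode_right)

section \<open>The antipode is antimultiplicative and bijective\<close>

lemma antipode_one: "S 1 = 1"
proof -
  have "sw 1 (\<lambda>p q. S p * q) = S 1 * 1" by (rule sw_one[OF vsH]) (auto intro!: lin_intros)
  then show ?thesis by (simp add: sw_antipode_left counit_one)
qed

text \<open>Both sides are convolution inverses of the multiplication map on \<open>H \<otimes> H\<close>.\<close>

lemma antipode_mult: "S (g * h) = S h * S g"
proof -
  \<comment> \<open>\<open>X\<close> is the convolution product of \<open>S (g * h)\<close>,
    \<open>g * h\<close> and \<open>S h * S g\<close>. Collapsing the last two factors gives one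
    side of the claim, collapsing the first two the other.\<close>
  define X where "X = sw g (\<lambda>g1 g'. sw h (\<lambda>h1 h'. S (g1 * h1) *
    sw g' (\<lambda>g2 g3. sw h' (\<lambda>h2 h3. g2 * h2 * S h3 * S g3))))"
  have inner: "sw g' (\<lambda>g2 g3. sw h' (\<lambda>h2 h3. g2 * h2 * S h3 * S g3)) = sH (\<epsilon> g' * \<epsilon> h') 1" for g' h'
  proof -
    have "sw h' (\<lambda>h2 h3. g2 * h2 * S h3 * S g3) = sH (\<epsilon> h') (g2 * S g3)" for g2 g3
    proof -
      have "sw h' (\<lambda>h2 h3. g2 * h2 * S h3 * S g3) = g2 * sw h' (\<lambda>h2 h3. h2 * S h3) * S g3"
        by (simp add: mult.assoc flip: sw_mult_left sw_mult_right)
      then show ?thesis by (simp add: sw_antipode_right scale_mult_left scale_mult_right)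
    qed
    then show ?thesis by (simp add: sw_scale[OF vsH] sw_antipode_right mult.commute)
  qed
  have "X = sw g (\<lambda>g1 g'. sH (\<epsilon> g') (sw h (\<lambda>h1 h'. sH (\<epsilon> h') (S (g1 * h1)))))"
    unfolding X_def inner by (simp add: scale_mult_right flip: sw_scale[OF vsH])
  also have "\<dots> = sw g (\<lambda>g1 g'. sH (\<epsilon> g') (S (g1 * h)))"
    by (subst sw_counit_right[OF vsH]) (auto intro!: lin_intros)
  also have "\<dots> = S (g * h)"
    by (subst sw_counit_right[OF vsH]) (auto intro!: lin_intros)
  finally have 1: "X = S (g * h)" .
  have "X = sw g (\<lambda>g1 g'. sw g' (\<lambda>g2 g3. sw h (\<lambda>h1 h'. sw h' (\<lambda>h2 h3.
      S (g1 * h1) * (g2 * h2) * S h3 * S g3))))"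
    unfolding X_def
    by (subst (2) sw_swap) (simp add: mult.assoc flip: sw_mult_left)
  \<comment> \<open>Regrouping both comultiplications puts \<open>S (g1 * h1)\<close> next to
    \<open>g2 * h2\<close>, where the antipode axiom for the product \<open>g' * h'\<close>
    applies.\<close>
  also have "\<dots> = sw g (\<lambda>g' g3. sw g' (\<lambda>g1 g2. sw h (\<lambda>h1 h'. sw h' (\<lambda>h2 h3.
      S (g1 * h1) * (g2 * h2) * S h3 * S g3))))"
    by (rule sw_coassoc[symmetric, OF vsH]) (auto simp: trilinear_def intro!: lin_intros)
  also have "\<dots> = sw g (\<lambda>g' g3. sw g' (\<lambda>g1 g2. sw h (\<lambda>h' h3. sw h' (\<lambda>h1 h2.
      S (g1 * h1) * (g2 * h2) * S h3 * S g3))))"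
    by (subst sw_coassoc[OF vsH]) (auto simp: trilinear_def intro!: lin_intros)
  also have "\<dots> = sw g (\<lambda>g' g3. sw h (\<lambda>h' h3.
      sw g' (\<lambda>g1 g2. sw h' (\<lambda>h1 h2. S (g1 * h1) * (g2 * h2))) * S h3 * S g3))"
    by (subst sw_swap) (simp flip: sw_mult_right)
  also have "\<dots> = sw g (\<lambda>g' g3. sw h (\<lambda>h' h3. sw (g' * h') (\<lambda>p q. S p * q) * S h3 * S g3))"
    by (subst sw_mult[OF vsH]) (auto intro!: lin_intros)
  also have "\<dots> = sw g (\<lambda>g' g3. sH (\<epsilon> g') (sw h (\<lambda>h' h3. sH (\<epsilon> h') (S h3 * S g3))))"
    by (simp add: sw_antipode_left counit_mult scale_mult_left flip: sw_scale[OF vsH])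
  also have "\<dots> = sw g (\<lambda>g' g3. sH (\<epsilon> g') (S h * S g3))"
    by (subst sw_counit_left[OF vsH]) (auto intro!: lin_intros)
  also have "\<dots> = S h * S g"
    by (subst sw_counit_left[OF vsH]) (auto intro!: lin_intros)
  finally show ?thesis using 1 by simp
qed

text \<open>The identity map is a left convolution inverse of this left convolution by
  \<open>S\<close>, which is therefore injective.\<close>

lemma convolution_left_inverse:
  assumes f: "lmap sH sH f"
  shows "sw h (\<lambda>p q. p * sw q (\<lambda>q r. S q * f r)) = f h"
proof -
  have "sw h (\<lambda>p q. p * sw q (\<lambda>q r. S q * f r)) = sw h (\<lambda>p q. sw q (\<lambda>q r. p * S q * f r))"
    by (simp add: mult.assoc flip: sw_mult_left)
  also have "\<dots> = sw h (\<lambda>p r. sw p (\<lambda>p q. p * S q * f r))"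
    by (rule sw_coassoc[symmetric, OF vsH])
      (auto simp: trilinear_def intro!: lin_intros lmap_compose[OF f])
  also have "\<dots> = sw h (\<lambda>p r. sH (\<epsilon> p) (f r))"
    by (simp add: sw_mult_right sw_antipode_right scale_mult_left)
  also have "\<dots> = f h" by (rule sw_counit_left[OF vsH f])
  finally show ?thesis .
qed

text \<open>
  The linear endomorphisms with values in the subalgebra \<open>S ` H\<close> form a finite-dimensional
  convolution algebra that contains \<open>S\<close>, hence also its convolution inverse, which is the identity.
\<close>

lemma surj_antipode: "surj S"
proof -
  let ?A = "{f. lmap sH sH f \<and> (\<forall>a. f a \<in> range S)}" and ?L = "\<lambda>f h. sw h (\<lambda>p q. S p * f q)"
  have X: "findim sH (range S)" by (rule findim_image[OF HB.findim_UNIV vsH antipode_lmap])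
  have A: "findim (fscale sH) ?A" using HB.lmaps_findim[OF X] by blast
  have lin: "linear_on (fscale sH) (fscale sH) ?A ?L"
    by (rule linear_onI)
      (auto simp: fun_eq_iff distrib_left scale_mult_right sw_scale[OF vsH] sw_def sum.distrib scale_sum_right)
  have "?L ` ?A \<subseteq> ?A"
  proof
    fix g assume "g \<in> ?L ` ?A"
    then obtain f where g: "g = ?L f" and f: "lmap sH sH f" "\<And>a. f a \<in> range S" by auto
    \<comment> \<open>Antimultiplicativity gives \<open>S p * S b = S (b * p)\<close>, so
      convolution by \<open>S\<close> preserves the maps with values in
      \<open>range S\<close>.\<close>
    have "S p * f q \<in> range S" for p q
    proof -
      obtain b where "f q = S b" using f(2)[of q] by auto
      then show ?thesis by (simp flip: antipode_mult)
    qed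
    then have "g a \<in> range S" for a
      unfolding g sw_def by (intro subspace_sum[OF findimD(2)[OF X]])
    moreover have "lmap sH sH g" unfolding g by (intro lin_intros lmap_compose[OF f(1)])
    ultimately show "g \<in> ?A" by simp
  qed
  moreover have "f = 0" if "f \<in> ?A" "?L f = 0" for f
  proof
    fix h show "f h = 0 h"
      using convolution_left_inverse[of f h] that by (simp add: fun_eq_iff sw_def)
  qed
  ultimately have surj: "?L ` ?A = ?A" by (intro findim_inj_surj[OF A lin])
  \<comment> \<open>The convolution unit takes values in \<open>range S\<close> because
    \<open>S 1 = 1\<close>; by surjectivity it is the convolution of \<open>S\<close> with some
    \<open>g\<close> in \<open>?A\<close>.\<close>
  have "(\<lambda>h. sH (\<epsilon> h) 1) \<in> ?A"
    using subspace_scale[OF findimD(2)[OF X]] antipode_one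
    by (auto intro!: lin_intros counit_lmap)
  then have "(\<lambda>h. sH (\<epsilon> h) 1) \<in> ?L ` ?A" by (simp only: surj)
  then obtain g where g: "g \<in> ?A" "(\<lambda>h. sH (\<epsilon> h) 1) = ?L g" by (rule imageE)
  have "h \<in> range S" for h
  proof -
    \<comment> \<open>Convolving the unit with the identity map on the left shows that
      \<open>g\<close> is the identity, whose values thus lie in \<open>range S\<close>.\<close>
    have "g h = sw h (\<lambda>p q. p * sH (\<epsilon> q) 1)"
      using convolution_left_inverse[of g h] g(1) by (simp flip: fun_cong[OF g(2)])
    also have "\<dots> = h"
      using sw_counit_right[OF vsH lmap_ident] by (simp add: scale_mult_right)
    finally show ?thesis using g(1) by (metis (no_types, lifting) mem_Collect_eq)
  qed
  then show ?thesis by blast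
qed

lemma inj_antipode: "inj S"
proof (rule injI)
  have "vector_space.dim sH {x \<in> UNIV. S x = 0} = 0"
    using rank_nullity[OF HB.findim_UNIV vsH antipode_lmap] surj_antipode by simp
  then have ker: "{x \<in> UNIV. S x = 0} = {0}"
    using dim_eq_0_iff_findim[OF findim_kernel[OF HB.findim_UNIV vsH antipode_lmap]] by simp
  fix x y assume "S x = S y"
  then have "S (x - y) = 0" using linear_on_diff[OF antipode_lmap vsH] by simp
  then have "x - y \<in> {x \<in> UNIV. S x = 0}" by simp
  then have "x - y \<in> {0}" by (simp only: ker)
  then show "x = y" by simp
qed

abbreviation "T \<equiv> inv S"

lemma antipode_T [simp]: "S (T h) = h" by (rule surj_f_inv_f[OF surj_antipode])

lemma T_lmap: "lmap sH sH T"
proof (rule linear_onI)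
  show "T (x + y) = T x + T y" for x y
    by (rule injD[OF inj_antipode]) (simp add: linear_on_add[OF antipode_lmap])
  show "T (sH c x) = sH c (T x)" for c x
    by (rule injD[OF inj_antipode]) (simp add: linear_on_scale[OF antipode_lmap])
qed

lemmas [lin_intros] = lmap_compose[OF T_lmap]

text \<open>The injective \<open>S\<close> turns \<open>T q * p\<close> into \<open>S p * q\<close>,
  which the antipode axiom evaluates.\<close>

lemma sw_T_left: "sw a (\<lambda>p q. T q * p) = sH (\<epsilon> a) 1"
  by (rule injD[OF inj_antipode])
    (simp add: sw_linear_image[OF antipode_lmap vsH] antipode_mult sw_antipode_left
      linear_on_scale[OF antipode_lmap] antipode_one)

lemma sw_T_right: "sw a (\<lambda>p q. q * T p) = sH (\<epsilon> a) 1"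
  by (rule injD[OF inj_antipode])
    (simp add: sw_linear_image[OF antipode_lmap vsH] antipode_mult sw_antipode_right
      linear_on_scale[OF antipode_lmap] antipode_one)

end

section \<open>Modules over a comodule algebra\<close>

lemma exists_separating_functional:
  fixes s :: "'k::field \<Rightarrow> 'v::ab_group_add \<Rightarrow> 'v"
  assumes s: "vector_space s" and V: "module.subspace s V" and v: "v \<notin> V"
  obtains \<xi> where "lmap s (*) \<xi>" "\<And>x. x \<in> V \<Longrightarrow> \<xi> x = 0" "\<xi> v = (1 :: 'k)"
proof -
  interpret s: vector_space s by fact
  interpret k: vector_space "(*) :: 'k \<Rightarrow> 'k \<Rightarrow> 'k" by (rule vector_space_ground)
  interpret p: vector_space_pair s "(*) :: 'k \<Rightarrow> 'k \<Rightarrow> 'k" by unfold_locales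
  obtain C where C: "C \<subseteq> V" "s.independent C" "V \<subseteq> s.span C"
    using s.maximal_independent_subset[of V] by blast
  have "s.span C = V" using C V by (intro s.span_subspace)
  then have vC: "v \<notin> s.span C" using v by simp
  have ind: "s.independent (insert v C)" using C(2) vC by (rule s.independent_insertI[rotated])
  define \<xi> where "\<xi> = p.construct (insert v C) (\<lambda>x. if x = v then 1 else 0)"
  have lin: "Vector_Spaces.linear s (*) \<xi>" unfolding \<xi>_def by (rule p.linear_construct[OF ind])
  have l: "lmap s (*) \<xi>"
    by (rule linear_onI) (simp_all add: p.linear_add[OF lin] p.linear_scale[OF lin])
  have C0: "\<xi> x = 0" if "x \<in> C" for x
  proof -
    have "x \<noteq> v" using that vC s.span_base[of x C] by blast
    then show ?thesis unfolding \<xi>_def by (subst p.construct_basis[OF ind]) (use that in auto)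
  qed
  have "\<xi> x = 0" if "x \<in> V" for x
    by (rule linear_on_span_eq_0[OF l s _ vector_space_ground _ C0]) (use C(3) that in auto)
  moreover have "\<xi> v = 1" unfolding \<xi>_def by (subst p.construct_basis[OF ind]) auto
  ultimately show thesis using that l by blast
qed

locale fd_comodule_algebra =
  fd_hopf_algebra sH \<Delta> \<epsilon> S B + left_comodule_algebra sH \<Delta> \<epsilon> S sK \<rho>
  for sH :: "'k::field \<Rightarrow> 'h::ring_1 \<Rightarrow> 'h"
    and \<Delta> :: "'h \<Rightarrow> ('h \<Rightarrow> 'h \<Rightarrow> 'k) \<Rightarrow> 'k"
    and \<epsilon> :: "'h \<Rightarrow> 'k"
    and S :: "'h \<Rightarrow> 'h"
    and B :: "'h set"
    and sK :: "'k \<Rightarrow> 'a::{ring, monoid_mult} \<Rightarrow> 'a"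
    and \<rho> :: "'a \<Rightarrow> ('h \<Rightarrow> 'a \<Rightarrow> 'k) \<Rightarrow> 'k"
begin

lemma vsK: "vector_space sK" by (rule K.vector_space_axioms)

definition rcomp :: "'h \<Rightarrow> 'a \<Rightarrow> 'a" where
  "rcomp e x = F.tcomp KK e (\<rho> x)"

definition co :: "'a \<Rightarrow> ('h \<Rightarrow> 'a \<Rightarrow> 'x::comm_monoid_add) \<Rightarrow> 'x" where
  "co x \<phi> = (\<Sum>e\<in>B. \<phi> e (rcomp e x))"

lemma coact_tlift:
  "vector_space t \<Longrightarrow> bmap sH sK t \<phi> \<Longrightarrow> tlift HH KK (full t) \<phi> (\<rho> x) = co x \<phi>"
  unfolding co_def rcomp_def by (rule coaction_tlift[OF vsK coact_linear])

lemma rcomp_linear: "lmap sK sK (rcomp e)"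
  using coaction_comp_linear[OF vsK coact_linear, of e] by (simp add: rcomp_def[abs_def])

lemma co_coassoc:
  assumes "vector_space t" "trilinear sH sH sK t \<phi>"
  shows "co x (\<lambda>a y. sw a (\<lambda>p q. \<phi> p q y)) = co x (\<lambda>a y. co y (\<phi> a))"
  using coaction_coassoc[where \<delta> = \<rho> and w = x, OF vsK coact_linear coact_coassoc assms]
  by (simp add: sw_def co_def flip: dcomp_def rcomp_def)

lemma co_mult:
  assumes "vector_space t" "bmap sH sK t \<phi>"
  shows "co (x * y) \<phi> = co x (\<lambda>a x'. co y (\<lambda>b y'. \<phi> (a * b) (x' * y')))"
  using coaction_mult[where \<delta> = \<rho> and x = x and y = y,
      OF K.algebra_over_axioms coact_linear coact_mult assms]
  by (simp add: co_def flip: rcomp_def)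

lemma co_one:
  assumes t: "vector_space t" and \<phi>: "bmap sH sK t \<phi>"
  shows "co 1 \<phi> = \<phi> 1 1"
  using tlift_pure[OF is_vspace_H is_vspace_full[OF vsK] is_vspace_full[OF t]
      bilin_full[THEN iffD2, OF \<phi>], of 1 1]
  by (simp add: coact_one flip: coact_tlift[OF t \<phi>])

lemmas [lin_intros] = K.lmap_mult_left K.lmap_mult_right vsK lmap_compose[OF rcomp_linear]

lemma lmap_co [lin_intros]:
  assumes "vector_space t" "lmap s sK f" "\<And>p. lmap sK t (\<phi> p)"
  shows "lmap s t (\<lambda>x. co (f x) \<phi>)"
  unfolding co_def
  by (rule linear_on_sum_fun[OF assms(1)] lmap_compose[OF assms(3)] lmap_compose[OF rcomp_linear] assms(2))+

lemma lmap_co_fun [lin_intros]: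
  assumes "vector_space t" "\<And>p q. lmap s t (\<lambda>x. \<phi> x p q)"
  shows "lmap s t (\<lambda>x. co a (\<phi> x))"
  unfolding co_def by (rule linear_on_sum_fun[OF assms(1)]) (rule assms(2))

lemma co_linear_image:
  assumes f: "linear_on t r V f" "vector_space t" "module.subspace t V" and \<phi>: "\<And>p q. \<phi> p q \<in> V"
  shows "f (co a \<phi>) = co a (\<lambda>p q. f (\<phi> p q))"
  unfolding co_def by (rule linear_on_sum[OF f \<phi>])

lemma co_in:
  assumes "vector_space t" "module.subspace t V" "\<And>p q. \<phi> p q \<in> V"
  shows "co a \<phi> \<in> V"
proof -
  interpret t: vector_space t by fact
  show ?thesis unfolding co_def by (rule t.subspace_sum[OF assms(2,3)])
qed

lemma sw_in:
  assumes "vector_space t" "module.subspace t V" "\<And>p q. \<phi> p q \<in> V"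
  shows "sw a \<phi> \<in> V"
proof -
  interpret t: vector_space t by fact
  show ?thesis unfolding sw_def by (rule t.subspace_sum[OF assms(2,3)])
qed

lemma sw_linear_on_image:
  assumes f: "linear_on t r V f" "vector_space t" "module.subspace t V" and \<phi>: "\<And>p q. \<phi> p q \<in> V"
  shows "f (sw a \<phi>) = sw a (\<lambda>p q. f (\<phi> p q))"
  unfolding sw_def by (rule linear_on_sum[OF f \<phi>])

lemma co_sw_swap: "co x (\<lambda>d z. sw b (\<lambda>p q. \<phi> d z p q)) = sw b (\<lambda>p q. co x (\<lambda>d z. \<phi> d z p q))"
  unfolding sw_def co_def by (rule sum.swap)

lemma co_counit:
  assumes t: "vector_space t" and f: "lmap sK t f"
  shows "co x (\<lambda>a y. t (\<epsilon> a) (f y)) = f x"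
proof -
  have "f (co x (\<lambda>a y. sK (\<epsilon> a) y)) = co x (\<lambda>a y. t (\<epsilon> a) (f y))"
    by (simp add: co_linear_image[OF f vsK] linear_on_scale[OF f])
  moreover have "co x (\<lambda>a y. sK (\<epsilon> a) y) = x"
    by (subst coact_tlift[symmetric]) (auto intro!: lin_intros coact_counit)
  ultimately show ?thesis by simp
qed

text \<open>
  The action is constrained on the carrier \<open>V\<close> only.
\<close>

definition kmod :: "('k \<Rightarrow> 'v::ab_group_add \<Rightarrow> 'v) \<Rightarrow> ('a \<Rightarrow> 'v \<Rightarrow> 'v) \<Rightarrow> 'v set \<Rightarrow> bool" where
  "kmod s act V \<longleftrightarrow> findim s V \<and> (\<forall>x. \<forall>v\<in>V. act x v \<in> V) \<and> (\<forall>x. linear_on s s V (act x)) \<and>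
     (\<forall>v\<in>V. lmap sK s (\<lambda>x. act x v)) \<and> (\<forall>v\<in>V. act 1 v = v) \<and>
     (\<forall>v\<in>V. \<forall>x y. act (x * y) v = act x (act y v))"

lemma kmodD:
  assumes "kmod s act V"
  shows "findim s V" "vector_space s" "module.subspace s V" "linear_on s s V (act x)"
    "v \<in> V \<Longrightarrow> act x v \<in> V" "v \<in> V \<Longrightarrow> lmap sK s (\<lambda>x. act x v)" "v \<in> V \<Longrightarrow> act 1 v = v"
    "v \<in> V \<Longrightarrow> act (x * y) v = act x (act y v)"
  using assms by (simp_all add: kmod_def findim_def)

definition kmap where
  "kmap s act V t act' f \<longleftrightarrow> vector_space t \<and> linear_on s t V f \<and> (\<forall>x. \<forall>v\<in>V. f (act x v) = act' x (f v))"

lemma kmod_kernel: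
  assumes V: "kmod s act V" and f: "kmap s act V t act' f"
    and act0: "\<And>x. act' x 0 = 0"
  shows "kmod s act {v \<in> V. f v = 0}"
proof -
  have "findim s {v \<in> V. f v = 0}"
    using f kmodD(1)[OF V] by (intro findim_kernel) (auto simp: kmap_def)
  then show ?thesis
    using V f act0 unfolding kmod_def kmap_def by (auto intro: linear_on_subset)
qed

text \<open>Equivariance alone transports the module axioms to the image, which plays the part of
  the quotient of \<open>V\<close> by the kernel of \<open>f\<close>.\<close>

lemma kmod_image:
  assumes V: "kmod s act V" and f: "kmap s act V t act' f"
  shows "kmod t act' (f ` V)"
proof -
  interpret s: vector_space s by (rule kmodD(2)[OF V])
  have t: "vector_space t" and lin: "linear_on s t V f"
    and eq: "\<And>x v. v \<in> V \<Longrightarrow> act' x (f v) = f (act x v)"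
    using f by (auto simp: kmap_def)
  note subV = kmodD(3)[OF V] and vact = kmodD(5)[OF V] and lact = kmodD(4)[OF V]
  have "linear_on t t (f ` V) (act' x)" for x
  proof (rule linear_onI)
    fix a b assume "a \<in> f ` V" "b \<in> f ` V"
    then obtain v w where [simp]: "v \<in> V" "w \<in> V" "a = f v" "b = f w" by blast
    have "act' x (a + b) = act' x (f (v + w))" by (simp add: linear_on_add[OF lin])
    also have "\<dots> = f (act x (v + w))" by (rule eq) (simp add: s.subspace_add[OF subV])
    also have "\<dots> = act' x a + act' x b"
      by (simp add: linear_on_add[OF lact] linear_on_add[OF lin] vact eq)
    finally show "act' x (a + b) = act' x a + act' x b" .
  next
    fix c a assume "a \<in> f ` V"
    then obtain v where [simp]: "v \<in> V" "a = f v" by blast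
    have "act' x (t c a) = act' x (f (s c v))" by (simp add: linear_on_scale[OF lin])
    also have "\<dots> = f (act x (s c v))" by (rule eq) (simp add: s.subspace_scale[OF subV])
    also have "\<dots> = t c (act' x a)"
      by (simp add: linear_on_scale[OF lact] linear_on_scale[OF lin] vact eq)
    finally show "act' x (t c a) = t c (act' x a)" .
  qed
  moreover have "lmap sK t (\<lambda>x. act' x (f v))" if "v \<in> V" for v
    using linear_on_compose[OF lin kmodD(6)[OF V that]] vact that by (simp add: eq image_subset_iff)
  moreover have "findim t (f ` V)"
    by (rule findim_image[OF kmodD(1)[OF V] t lin])
  ultimately show ?thesis
    unfolding kmod_def by (auto simp: eq vact kmodD(7)[OF V] kmodD(8)[OF V])
qed

end

section \<open>Module maps out of the Hopf module \<open>H \<otimes> U\<close> and their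
  dimension\<close>

locale fd_hopf_module =
  fd_comodule_algebra sH \<Delta> \<epsilon> S B sK \<rho> + U: left_module_over sK sU actU +
  UB: finite_dimensional_vector_space sU BU
  for sH :: "'k::field \<Rightarrow> 'h::ring_1 \<Rightarrow> 'h"
    and \<Delta> :: "'h \<Rightarrow> ('h \<Rightarrow> 'h \<Rightarrow> 'k) \<Rightarrow> 'k"
    and \<epsilon> :: "'h \<Rightarrow> 'k"
    and S :: "'h \<Rightarrow> 'h"
    and B :: "'h set"
    and sK :: "'k \<Rightarrow> 'a::{ring, monoid_mult} \<Rightarrow> 'a"
    and \<rho> :: "'a \<Rightarrow> ('h \<Rightarrow> 'a \<Rightarrow> 'k) \<Rightarrow> 'k"
    and sU :: "'k \<Rightarrow> 'u::ab_group_add \<Rightarrow> 'u" and actU :: "'a \<Rightarrow> 'u \<Rightarrow> 'u" and BU :: "'u set"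
begin

lemma vsU: "vector_space sU" by (rule U.M.vector_space_axioms)

lemma actU_right: "lmap sU sU (actU x)" and actU_left: "lmap sK sU (\<lambda>x. actU x u)"
  using U.act_bilinear by (simp_all add: bilin_full)

text \<open>The linear maps from \<open>H \<otimes> U\<close> to \<open>V\<close> in curried form.
  Reading them as linear maps from \<open>H\<close> into a space of linear maps lets the dimension
  count be applied twice.\<close>

definition bilforms :: "('k \<Rightarrow> 'v::ab_group_add \<Rightarrow> 'v) \<Rightarrow> 'v set \<Rightarrow> ('h \<Rightarrow> 'u \<Rightarrow> 'v) set" where
  "bilforms s V = {F. (\<forall>a u. F a u \<in> V) \<and> bmap sH sU s F}"

lemma bilforms_eq:
  "bilforms s V = {F. lmap sH (fscale s) F \<and> (\<forall>a. F a \<in> {g. lmap sU s g \<and> (\<forall>u. g u \<in> V)})}"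
  by (auto simp: bilforms_def linear_on_def fun_eq_iff)

lemma bilforms_findim:
  assumes V: "findim s V"
  shows "findim (fscale (fscale s)) (bilforms s V) \<and>
    vector_space.dim (fscale (fscale s)) (bilforms s V) = card B * (card BU * vector_space.dim s V)"
  using HB.lmaps_findim[OF conjunct1[OF UB.lmaps_findim[OF V]]] UB.lmaps_findim[OF V]
  by (simp add: bilforms_eq del: fscale_apply)

text \<open>
  The \<open>K\<close>-linear maps from the Hopf module \<open>H \<otimes> U\<close>, with diagonal \<open>K\<close>-action, to \<open>V\<close>.
\<close>

definition HomM :: "('k \<Rightarrow> 'v::ab_group_add \<Rightarrow> 'v) \<Rightarrow> ('a \<Rightarrow> 'v \<Rightarrow> 'v) \<Rightarrow> 'v set \<Rightarrow> ('h \<Rightarrow> 'u \<Rightarrow> 'v) set"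
  where "HomM s act V =
    {F \<in> bilforms s V. \<forall>x a u. act x (F a u) = co x (\<lambda>e y. F (e * a) (actU y u))}"

definition hdim :: "('k \<Rightarrow> 'v::ab_group_add \<Rightarrow> 'v) \<Rightarrow> ('a \<Rightarrow> 'v \<Rightarrow> 'v) \<Rightarrow> 'v set \<Rightarrow> nat" where
  "hdim s act V = vector_space.dim (fscale (fscale s)) (HomM s act V)"

lemma HomM_subspace:
  assumes V: "kmod s act V"
  shows "module.subspace (fscale (fscale s)) (HomM s act V)"
proof -
  interpret s: vector_space s by (rule kmodD(2)[OF V])
  interpret f: vector_space "fscale (fscale s)"
    by (intro vector_space_fscale) (rule s.vector_space_axioms)
  have sub: "f.subspace (bilforms s V)"
    using bilforms_findim[OF kmodD(1)[OF V]] by (simp add: findim_def)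
  have "F a u \<in> V" if "F \<in> bilforms s V" for F a u
    using that by (simp add: bilforms_def)
  then show ?thesis
    unfolding f.subspace_def HomM_def using f.subspace_0[OF sub] f.subspace_add[OF sub] f.subspace_scale[OF sub]
    by (auto simp: linear_on_0[OF kmodD(4)[OF V] kmodD(2,3)[OF V]] linear_on_add[OF kmodD(4)[OF V]]
        linear_on_scale[OF kmodD(4)[OF V]] co_def sum.distrib s.scale_sum_right)
qed

lemma HomM_findim:
  assumes V: "kmod s act V"
  shows "findim (fscale (fscale s)) (HomM s act V)"
  by (rule findim_subspace[OF conjunct1[OF bilforms_findim[OF kmodD(1)[OF V]]] _ HomM_subspace[OF V]])
    (auto simp: HomM_def)

lemma hdim_le: "kmod s act V \<Longrightarrow> hdim s act V \<le> card B * (card BU * vector_space.dim s V)"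
  unfolding hdim_def
  using dim_mono_findim[OF conjunct1[OF bilforms_findim[OF kmodD(1)]] _ HomM_subspace] bilforms_findim[OF kmodD(1)]
  by (metis (no_types, lifting) HomM_def mem_Collect_eq subsetI)

lemma hdim_mono:
  assumes "kmod s act V" "kmod s act V'" "V' \<subseteq> V"
  shows "hdim s act V' \<le> hdim s act V"
  unfolding hdim_def
  by (rule dim_mono_findim[OF HomM_findim[OF assms(1)] _ HomM_subspace[OF assms(2)]])
    (use assms(3) in \<open>auto simp: HomM_def bilforms_def\<close>)

text \<open>Left exactness of Hom: the maps killed by composition with \<open>f\<close> are those
  into its kernel. Only an inequality results, as a map into the image need not lift to
  \<open>V\<close>.\<close>

lemma hdim_kernel_image:
  assumes V: "kmod s act V" and f: "kmap s act V t act' f" and act0: "\<And>x. act' x 0 = 0"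
  shows "hdim s act V \<le> hdim s act {v \<in> V. f v = 0} + hdim t act' (f ` V)"
proof -
  have t: "vector_space t" and lin: "linear_on s t V f"
    and eq: "\<And>x v. v \<in> V \<Longrightarrow> f (act x v) = act' x (f v)"
    using f by (auto simp: kmap_def)
  let ?\<Phi> = "\<lambda>F a u. f (F a u)"
  have FV: "F a u \<in> V" if "F \<in> HomM s act V" for F a u
    using that by (simp add: HomM_def bilforms_def)
  have l: "linear_on (fscale (fscale s)) (fscale (fscale t)) (HomM s act V) ?\<Phi>"
    by (rule linear_onI) (simp_all add: fun_eq_iff FV linear_on_add[OF lin] linear_on_scale[OF lin])
  have tt: "vector_space (fscale (fscale t))" by (intro vector_space_fscale t)
  have ker: "{F \<in> HomM s act V. ?\<Phi> F = 0} = HomM s act {v \<in> V. f v = 0}"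
    by (auto simp: HomM_def bilforms_def fun_eq_iff)
  have "?\<Phi> F \<in> HomM t act' (f ` V)" if F: "F \<in> HomM s act V" for F
    unfolding HomM_def bilforms_def
  proof (intro CollectI conjI allI)
    have b: "lmap sU s (F a)" "lmap sH s (\<lambda>a. F a u)" for a u
      using F by (auto simp: HomM_def bilforms_def)
    show "f (F a u) \<in> f ` V" for a u using FV[OF F] by blast
    show "lmap sU t (\<lambda>u. f (F a u))" for a
      using FV[OF F] by (intro linear_on_compose[OF lin b(1)]) auto
    show "lmap sH t (\<lambda>a. f (F a u))" for u
      using FV[OF F] by (intro linear_on_compose[OF lin b(2)]) auto
    fix x a u
    have "act' x (f (F a u)) = f (co x (\<lambda>e y. F (e * a) (actU y u)))"
      using F by (simp add: HomM_def flip: eq[OF FV[OF F]])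
    also have "\<dots> = co x (\<lambda>e y. f (F (e * a) (actU y u)))"
      using kmodD[OF V] by (intro co_linear_image[OF lin]) (simp_all add: FV[OF F])
    finally show "act' x (f (F a u)) = co x (\<lambda>e y. f (F (e * a) (actU y u)))" .
  qed
  then have "vector_space.dim (fscale (fscale t)) (?\<Phi> ` HomM s act V) \<le> hdim t act' (f ` V)"
    unfolding hdim_def using findim_image[OF HomM_findim[OF V] tt l]
    by (intro dim_mono_findim[OF HomM_findim[OF kmod_image[OF V f]]]) (auto simp: findim_def)
  then show ?thesis
    using rank_nullity[OF HomM_findim[OF V] tt l] unfolding ker by (simp add: hdim_def)
qed

end

section \<open>The dual of the regular module and the maximal ratio\<close>

lemma sum_fun_apply: "(\<Sum>i\<in>I. f i) x = (\<Sum>i\<in>I. f i x)"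
  by (induction I rule: infinite_finite_induct) simp_all

lemma findim_ground:
  "findim ((*) :: 'k::field \<Rightarrow> 'k \<Rightarrow> 'k) UNIV \<and> vector_space.dim ((*) :: 'k \<Rightarrow> 'k \<Rightarrow> 'k) UNIV = 1"
proof -
  interpret k: vector_space "(*) :: 'k \<Rightarrow> 'k \<Rightarrow> 'k" by (rule vector_space_ground)
  have span: "UNIV \<subseteq> k.span {1}" by (auto simp: k.span_singleton)
  then have "findim ((*) :: 'k \<Rightarrow> 'k \<Rightarrow> 'k) UNIV"
    unfolding findim_def using k.vector_space_axioms by (auto intro!: exI[of _ "{1}"])
  moreover have "card {1 :: 'k} = k.dim UNIV"
    by (rule k.basis_card_eq_dim[OF _ span]) simp_all
  ultimately show ?thesis by simp
qed

context fd_comodule_algebra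
begin

lemma co_apply: "co x \<phi> z = co x (\<lambda>e y. \<phi> e y z)"
  by (simp add: co_def sum_fun_apply)

lemma co_swap: "co x (\<lambda>p q. co y (\<lambda>r s. \<phi> p q r s)) = co y (\<lambda>r s. co x (\<lambda>p q. \<phi> p q r s))"
  unfolding co_def by (rule sum.swap)

definition dact :: "'a \<Rightarrow> ('a \<Rightarrow> 'k) \<Rightarrow> 'a \<Rightarrow> 'k" where
  "dact y g = (\<lambda>x. g (x * y))"

definition Kd :: "('a \<Rightarrow> 'k) set" where
  "Kd = {g. lmap sK (*) g}"

end

locale fd_setting =
  fd_hopf_module sH \<Delta> \<epsilon> S B sK \<rho> sU actU BU + KB: finite_dimensional_vector_space sK BK
  for sH :: "'k::field \<Rightarrow> 'h::ring_1 \<Rightarrow> 'h"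
    and \<Delta> :: "'h \<Rightarrow> ('h \<Rightarrow> 'h \<Rightarrow> 'k) \<Rightarrow> 'k"
    and \<epsilon> :: "'h \<Rightarrow> 'k"
    and S :: "'h \<Rightarrow> 'h"
    and B :: "'h set"
    and sK :: "'k \<Rightarrow> 'a::{ring, monoid_mult} \<Rightarrow> 'a"
    and \<rho> :: "'a \<Rightarrow> ('h \<Rightarrow> 'a \<Rightarrow> 'k) \<Rightarrow> 'k"
    and sU :: "'k \<Rightarrow> 'u::ab_group_add \<Rightarrow> 'u" and actU :: "'a \<Rightarrow> 'u \<Rightarrow> 'u" and BU :: "'u set"
    and BK :: "'a set"
begin

abbreviation "sD \<equiv> fscale ((*) :: 'k \<Rightarrow> 'k \<Rightarrow> 'k)"

lemma kmod_dual: "kmod sD dact Kd" and dim_dual: "vector_space.dim sD Kd = card BK"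
proof -
  have Kd: "Kd = {g. lmap sK (*) g \<and> (\<forall>a. g a \<in> UNIV)}" by (simp add: Kd_def)
  note fin = KB.lmaps_findim[OF conjunct1[OF findim_ground], folded Kd]
  show "vector_space.dim sD Kd = card BK" using fin findim_ground[where 'k = 'k] by simp
  have "lmap sK (*) (\<lambda>x. g (x * y))" "lmap sK (*) (\<lambda>y. g (x * y))" if "lmap sK (*) g" for g x y
    using that by (intro lmap_compose[OF that] lin_intros)+
  then show "kmod sD dact Kd"
    unfolding kmod_def using fin
    by (auto simp: Kd_def dact_def linear_on_def fun_eq_iff mult.assoc)
qed

text \<open>Evaluation at \<open>1\<close> identifies the module maps from
  \<open>M = H \<otimes> U\<close> to \<open>K^*\<close> with all linear forms on \<open>M\<close>.
  The inverse \<open>?f\<close> sends \<open>\<phi>\<close> to the map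
  \<open>m \<mapsto> (x \<mapsto> \<phi>(x m))\<close>.\<close>

lemma hdim_dual: "hdim sD dact Kd = card B * card BU"
proof -
  let ?V = "bilforms ((*) :: 'k \<Rightarrow> 'k \<Rightarrow> 'k) UNIV"
  let ?f = "\<lambda>\<phi> a u x. co x (\<lambda>e y. \<phi> (e * a) (actU y u))"
  have fin: "findim (fscale sD) ?V" and dim: "vector_space.dim (fscale sD) ?V = card B * card BU"
    using bilforms_findim[OF conjunct1[OF findim_ground]] findim_ground[where 'k = 'k] by simp_all
  have vs: "vector_space (fscale (fscale sD))" by (intro vector_space_fscale vector_space_ground)
  have lin: "linear_on (fscale sD) (fscale (fscale sD)) ?V ?f"
    by (rule linear_onI) (simp_all add: fun_eq_iff co_def sum.distrib sum_distrib_left)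
  have one: "?f \<phi> a u 1 = \<phi> a u" if \<phi>: "\<phi> \<in> ?V" for \<phi> a u
  proof -
    have l: "lmap sU (*) (\<phi> a)" "lmap sH (*) (\<lambda>a. \<phi> a u)" for a u
      using \<phi> by (auto simp: bilforms_def)
    show ?thesis
      by (subst co_one[OF vector_space_ground])
        (auto simp: U.act_one intro!: lin_intros lmap_compose[OF l(1)] lmap_compose[OF l(2)]
          lmap_compose[OF actU_left])
  qed
  have "?f ` ?V = HomM sD dact Kd"
  proof (intro equalityI subsetI)
    fix F assume "F \<in> ?f ` ?V"
    then obtain \<phi> where \<phi>: "\<phi> \<in> ?V" and F: "F = ?f \<phi>" by blast
    have l: "lmap sU (*) (\<phi> a)" "lmap sH (*) (\<lambda>a. \<phi> a u)" for a u
      using \<phi> by (auto simp: bilforms_def)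
    have kd: "F a u \<in> Kd" for a u
      unfolding F Kd_def
      by (intro CollectI lin_intros lmap_compose[OF l(1)] lmap_compose[OF actU_left])
    have "lmap sU sD (F a)" for a
    proof (rule linear_onI)
      show "F a (u + v) = F a u + F a v" "F a (sU c u) = sD c (F a u)" for u v c
        unfolding F fun_eq_iff
        by (simp_all add: linear_on_add[OF actU_right] linear_on_scale[OF actU_right]
            linear_on_add[OF l(1)] linear_on_scale[OF l(1)] co_def sum.distrib sum_distrib_left)
    qed
    moreover have "lmap sH sD (\<lambda>a. F a u)" for u
    proof (rule linear_onI)
      show "F (a + b) u = F a u + F b u" "F (sH c a) u = sD c (F a u)" for a b c
        unfolding F fun_eq_iff
        by (simp_all add: distrib_left scale_mult_right
            linear_on_add[OF l(2)] linear_on_scale[OF l(2)] co_def sum.distrib sum_distrib_left)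
    qed
    moreover have "dact y (F a u) = co y (\<lambda>e z. F (e * a) (actU z u))" for y a u
    proof
      fix x
      have "dact y (F a u) x = co (x * y) (\<lambda>e z. \<phi> (e * a) (actU z u))"
        by (simp add: dact_def F)
      \<comment> \<open>This is the associativity of the diagonal action on \<open>M\<close>, which
        makes \<open>?f \<phi>\<close> equivariant.\<close>
      also have "\<dots> = co x (\<lambda>e x'. co y (\<lambda>d y'. \<phi> (e * d * a) (actU (x' * y') u)))"
        by (rule co_mult[OF vector_space_ground])
          (auto intro!: lin_intros lmap_compose[OF l(1)] lmap_compose[OF l(2)] lmap_compose[OF actU_left])
      also have "\<dots> = co y (\<lambda>d y'. co x (\<lambda>e x'. \<phi> (e * (d * a)) (actU x' (actU y' u))))"
        by (subst co_swap) (simp add: mult.assoc U.act_mult)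
      finally show "dact y (F a u) x = co y (\<lambda>e z. F (e * a) (actU z u)) x"
        by (simp add: co_apply F)
    qed
    ultimately show "F \<in> HomM sD dact Kd" using kd by (simp add: HomM_def bilforms_def)
  next
    fix F assume F: "F \<in> HomM sD dact Kd"
    show "F \<in> ?f ` ?V"
    proof (rule image_eqI)
      show "(\<lambda>a u. F a u 1) \<in> ?V"
        using F by (auto simp: HomM_def bilforms_def linear_on_def)
      show "F = ?f (\<lambda>a u. F a u 1)"
      proof (intro ext)
        fix a u x
        have "dact x (F a u) 1 = co x (\<lambda>e y. F (e * a) (actU y u)) 1"
          using F by (simp add: HomM_def)
        then show "F a u x = ?f (\<lambda>a u. F a u 1) a u x"
          by (simp add: dact_def co_apply)
      qed
    qed
  qed
  moreover have "\<phi> = 0" if "\<phi> \<in> ?V" "?f \<phi> = 0" for \<phi>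
    using one[OF that(1)] that(2) by (simp add: fun_eq_iff)
  ultimately show ?thesis
    using dim_image_inj[OF fin vs lin] dim by (simp add: hdim_def)
qed

lemma kmod_zero_hdim: "kmod s act V \<Longrightarrow> vector_space.dim s V = 0 \<Longrightarrow> hdim s act V = 0"
  using hdim_le[of s act V] by simp

text \<open>The ratios come from pairs of natural numbers bounded by the values for
  \<open>K^*\<close>, so there are only finitely many. The result is stated in cross-multiplied
  form, which includes the zero module.\<close>

lemma max_ratio:
  assumes "card BK > 0"
  obtains V0 where "kmod sD dact V0" "V0 \<subseteq> Kd" "vector_space.dim sD V0 > 0"
    "\<forall>V. kmod sD dact V \<and> V \<subseteq> Kd \<longrightarrow>
      vector_space.dim sD V0 * hdim sD dact V \<le> hdim sD dact V0 * vector_space.dim sD V"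
proof -
  let ?d = "vector_space.dim sD" and ?h = "hdim sD dact"
  define \<V> where "\<V> = {V. kmod sD dact V \<and> V \<subseteq> Kd \<and> ?d V > 0}"
  define R where "R = (\<lambda>V. real (?h V) / real (?d V)) ` \<V>"
  have "R \<subseteq> (\<lambda>(h, d). real h / real d) ` ({..?h Kd} \<times> {..?d Kd})"
  proof
    fix r assume "r \<in> R"
    then obtain V where V: "V \<in> \<V>" "r = real (?h V) / real (?d V)" by (auto simp: R_def)
    then have *: "kmod sD dact V" "V \<subseteq> Kd" by (auto simp: \<V>_def)
    have "?h V \<le> ?h Kd" "?d V \<le> ?d Kd"
      by (rule hdim_mono[OF kmod_dual *])
        (rule dim_mono_findim[OF kmodD(1)[OF kmod_dual] *(2) kmodD(3)[OF *(1)]])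
    then show "r \<in> (\<lambda>(h, d). real h / real d) ` ({..?h Kd} \<times> {..?d Kd})"
      using V(2) by (intro image_eqI[of _ _ "(?h V, ?d V)"]) auto
  qed
  then have fin: "finite R" by (rule finite_subset) simp
  have "Kd \<in> \<V>" using kmod_dual dim_dual assms by (simp add: \<V>_def)
  then have "R \<noteq> {}" by (auto simp: R_def)
  then have "Max R \<in> R" by (rule Max_in[OF fin])
  then obtain V0 where V0: "V0 \<in> \<V>" "Max R = real (?h V0) / real (?d V0)" by (auto simp: R_def)
  have "?d V0 * ?h V \<le> ?h V0 * ?d V" if V: "kmod sD dact V" "V \<subseteq> Kd" for V
  proof (cases "?d V = 0")
    case True
    then show ?thesis using kmod_zero_hdim[OF V(1)] by simp
  next
    case False
    then have "real (?h V) / real (?d V) \<in> R" using V by (auto simp: R_def \<V>_def)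
    then have "real (?h V) / real (?d V) \<le> real (?h V0) / real (?d V0)"
      using Max_ge[OF fin] V0(2) by simp
    then have "real (?h V) * real (?d V0) \<le> real (?h V0) * real (?d V)"
      using False V0(1) by (simp add: field_simps \<V>_def)
    then show ?thesis by (metis mult.commute of_nat_le_iff of_nat_mult)
  qed
  then have "\<forall>V. kmod sD dact V \<and> V \<subseteq> Kd \<longrightarrow> ?d V0 * ?h V \<le> ?h V0 * ?d V" by blast
  moreover have "kmod sD dact V0" "V0 \<subseteq> Kd" "?d V0 > 0" using V0(1) by (simp_all add: \<V>_def)
  ultimately show thesis by (intro that)
qed

end

section \<open>Powers and coinduced modules\<close>

context fd_comodule_algebra
begin

definition iact :: "'a \<Rightarrow> ('i \<Rightarrow> 'a \<Rightarrow> 'k) \<Rightarrow> 'i \<Rightarrow> 'a \<Rightarrow> 'k" where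
  "iact y g = (\<lambda>i. dact y (g i))"

definition pact :: "('a \<Rightarrow> 'v \<Rightarrow> 'v) \<Rightarrow> 'a \<Rightarrow> ('i \<Rightarrow> 'v) \<Rightarrow> 'i \<Rightarrow> 'v" where
  "pact act x g = (\<lambda>i. act x (g i))"

text \<open>Multiplying the argument on the right is what makes this a left action: acting with
  \<open>y\<close> and then with \<open>x\<close> evaluates \<open>g\<close> at
  \<open>a x_(-1) y_(-1)\<close>, as does acting with \<open>x * y\<close>.\<close>

definition cact :: "('a \<Rightarrow> 'v \<Rightarrow> 'v::ab_group_add) \<Rightarrow> 'a \<Rightarrow> ('h \<Rightarrow> 'v) \<Rightarrow> 'h \<Rightarrow> 'v" where
  "cact act x g = (\<lambda>a. co x (\<lambda>e y. act y (g (a * e))))"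

definition coind :: "('k \<Rightarrow> 'v::ab_group_add \<Rightarrow> 'v) \<Rightarrow> 'v set \<Rightarrow> ('h \<Rightarrow> 'v) set" where
  "coind s V = {g. lmap sH s g \<and> (\<forall>a. g a \<in> V)}"

lemma kmod_act_0: "kmod s act V \<Longrightarrow> act x 0 = 0"
  by (rule linear_on_0[OF kmodD(4) kmodD(2,3)])

lemma kmod_pow:
  assumes V: "kmod s act V" and "finite I"
  shows "kmod (fscale s) (pact act) (fpow I V)"
proof -
  have fin: "findim (fscale s) (fpow I V)"
    using fpow_findim[OF kmodD(1)[OF V] assms(2)] by blast
  have V0: "0 \<in> V" using module.subspace_0[OF _ kmodD(3)[OF V]] kmodD(2)[OF V] by (simp add: module_iff_vector_space)
  have gV: "g i \<in> V" if "g \<in> fpow I V" for g i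
    using that V0 by (cases "i \<in> I") (auto simp: fpow_def)
  show ?thesis
    unfolding kmod_def
    using fin kmodD(5,7,8)[OF V]
    by (auto simp: pact_def gV fun_eq_iff linear_on_add[OF kmodD(4)[OF V]] linear_on_scale[OF kmodD(4)[OF V]]
        linear_on_add[OF kmodD(6)[OF V]] linear_on_scale[OF kmodD(6)[OF V]] linear_on_def)
      (auto simp: fpow_def kmodD(5)[OF V] kmod_act_0[OF V])
qed

lemma kmod_coind:
  assumes V: "kmod s act V"
  shows "kmod (fscale s) (cact act) (coind s V)"
proof -
  note vs = kmodD(2,3)[OF V] and lact = kmodD(4)[OF V] and vact = kmodD(5)[OF V]
  interpret s: vector_space s by (fact vs)
  have fin: "findim (fscale s) (coind s V)"
    using HB.lmaps_findim[OF kmodD(1)[OF V]] by (simp add: coind_def)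
  have gV: "g a \<in> V" and gl: "lmap sH s g" if "g \<in> coind s V" for g a
    using that by (auto simp: coind_def)
  have l1: "lmap sK s (\<lambda>y. act (f y) v)" if "v \<in> V" "lmap sK sK f" for v f
    by (rule lmap_compose[OF kmodD(6)[OF V that(1)] that(2)])
  have l2: "lmap sH s (\<lambda>a. act y (g (f a)))" if "g \<in> coind s V" "lmap sH sH f" for y g f
    by (rule linear_on_compose[OF lact lmap_compose[OF gl[OF that(1)] that(2)]]) (auto simp: gV that)
  show ?thesis
    unfolding kmod_def
  proof (intro conjI allI ballI fin)
    fix x g assume g: "g \<in> coind s V"
    have "lmap sH s (cact act x g)"
      unfolding cact_def by (intro lmap_co_fun[OF vs(1)] l2[OF g] lin_intros)
    moreover have "cact act x g a \<in> V" for a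
      unfolding cact_def by (rule co_in[OF vs]) (simp add: vact gV g)
    ultimately show "cact act x g \<in> coind s V" by (simp add: coind_def)
  next
    fix x
    show "linear_on (fscale s) (fscale s) (coind s V) (cact act x)"
      by (rule linear_onI)
        (simp_all add: cact_def fun_eq_iff gV linear_on_add[OF lact] linear_on_scale[OF lact]
          co_def sum.distrib s.scale_sum_right)
  next
    fix g assume g: "g \<in> coind s V"
    have "lmap sK s (\<lambda>x. cact act x g a)" for a
      unfolding cact_def by (intro lmap_co[OF vs(1)] l1 gV g lmap_ident)
    then show "lmap sK (fscale s) (\<lambda>x. cact act x g)"
      by (auto simp: linear_on_def fun_eq_iff)
    show "cact act 1 g = g"
    proof
      fix a
      have "cact act 1 g a = act 1 (g (a * 1))"
        unfolding cact_def
        by (rule co_one[OF vs(1)]) (auto intro!: l1 l2 gV g lin_intros)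
      then show "cact act 1 g a = g a" by (simp add: kmodD(7)[OF V] gV g)
    qed
    fix x y
    show "cact act (x * y) g = cact act x (cact act y g)"
    proof
      fix a
      have "cact act (x * y) g a = co x (\<lambda>e x'. co y (\<lambda>d y'. act (x' * y') (g (a * (e * d)))))"
        unfolding cact_def
        by (rule co_mult[OF vs(1)]) (auto intro!: l1 l2 gV g lin_intros)
      also have "\<dots> = co x (\<lambda>e x'. act x' (co y (\<lambda>d y'. act y' (g (a * e * d)))))"
        by (simp add: co_linear_image[OF lact vs] vact gV g kmodD(8)[OF V] mult.assoc)
      finally show "cact act (x * y) g a = cact act x (cact act y g) a"
        by (simp add: cact_def)
    qed
  qed
qed

end

context fd_hopf_module
begin

lemma HomM_in: "F \<in> HomM s act V \<Longrightarrow> F a u \<in> V"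
  and HomM_lmap: "F \<in> HomM s act V \<Longrightarrow> lmap sU s (F a)" "F \<in> HomM s act V \<Longrightarrow> lmap sH s (\<lambda>a. F a u)"
  and HomM_act: "F \<in> HomM s act V \<Longrightarrow> act x (F a u) = co x (\<lambda>e y. F (e * a) (actU y u))"
  by (auto simp: HomM_def bilforms_def)

text \<open>A family of module maps is a module map into the power. The lower bound is what
  tightness asks for.\<close>

lemma hdim_pow:
  fixes I :: "'i set"
  assumes V: "kmod s act V" and I: "finite I"
  shows "card I * hdim s act V \<le> hdim (fscale s) (pact act) (fpow I V)"
proof -
  note P = fpow_findim[OF HomM_findim[OF V] I]
  interpret s: vector_space s by (rule kmodD(2)[OF V])
  let ?f = "\<lambda>G a u (i :: 'i). G i a u"
  have vs: "vector_space (fscale (fscale (fscale s)))"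
    by (intro vector_space_fscale) (rule s.vector_space_axioms)
  have lin: "linear_on (fscale (fscale (fscale s))) (fscale (fscale (fscale s))) (fpow I (HomM s act V)) ?f"
    by (rule linear_onI) (simp_all add: fun_eq_iff)
  have inj: "G = 0" if "?f G = 0" for G
    using that by (simp add: fun_eq_iff)
  have "?f G \<in> HomM (fscale s) (pact act) (fpow I V)" if G: "G \<in> fpow I (HomM s act V)" for G
  proof -
    have 0: "G i = 0" if "i \<notin> I" for i using G that by (simp add: fpow_def)
    have Gi: "G i \<in> HomM s act V" if "i \<in> I" for i using G that by (simp add: fpow_def)
    have "lmap sU s (\<lambda>u. G i a u)" "lmap sH s (\<lambda>a. G i a u)" for i a u
      using HomM_lmap[OF Gi] 0[of i] by (cases "i \<in> I"; simp add: linear_on_const_0 s.vector_space_axioms)+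
    then have "bmap sH sU (fscale s) (?f G)"
      by (simp add: linear_on_def fun_eq_iff)
    moreover have "?f G a u \<in> fpow I V" for a u
      using HomM_in[OF Gi] 0 by (simp add: fpow_def)
    moreover have "pact act x (?f G a u) = co x (\<lambda>e y. ?f G (e * a) (actU y u))" for x a u
    proof
      fix i show "pact act x (?f G a u) i = co x (\<lambda>e y. ?f G (e * a) (actU y u)) i"
        using HomM_act[OF Gi] 0[of i] by (cases "i \<in> I") (simp_all add: pact_def co_apply kmod_act_0[OF V], simp add: co_def)
    qed
    ultimately show ?thesis by (simp add: HomM_def bilforms_def)
  qed
  then have "?f ` fpow I (HomM s act V) \<subseteq> HomM (fscale s) (pact act) (fpow I V)" by blast
  then have "vector_space.dim (fscale (fscale (fscale s))) (?f ` fpow I (HomM s act V)) \<le>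
      hdim (fscale s) (pact act) (fpow I V)"
    unfolding hdim_def
    by (intro dim_mono_findim[OF HomM_findim[OF kmod_pow[OF V I]]] findimD(2)[OF findim_image[OF conjunct1[OF P] vs lin]])
  then show ?thesis
    using dim_image_inj[OF conjunct1[OF P] vs lin inj] P by (simp add: hdim_def)
qed

text \<open>
  For a Hopf module \<open>M\<close>, maps \<open>G\<close> from \<open>H\<close> to \<open>Hom\<^sub>K(M, V)\<close> correspond to \<open>K\<close>-linear maps
  \<open>m \<mapsto> (a \<mapsto> G(a m\<^sub>(\<^sub>-\<^sub>1\<^sub>))(m\<^sub>(\<^sub>0\<^sub>)))\<close> from \<open>M\<close> to \<open>coind V\<close>; the antipode undoes the twist.
\<close>

lemma hdim_coind:
  assumes V: "kmod s act V"
  shows "card B * hdim s act V \<le> hdim (fscale s) (cact act) (coind s V)"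
proof -
  note vs = kmodD(2,3)[OF V] and lact = kmodD(4)[OF V] and vact = kmodD(5)[OF V]
  interpret s: vector_space s by (fact vs)
  note P = HB.lmaps_findim[OF HomM_findim[OF V]]
  let ?X = "{G. lmap sH (fscale (fscale s)) G \<and> (\<forall>a. G a \<in> HomM s act V)}"
  let ?f = "\<lambda>G b u a. sw b (\<lambda>p q. G (a * p) q u)"
  have vs3: "vector_space (fscale (fscale (fscale s)))"
    by (intro vector_space_fscale) (rule s.vector_space_axioms)
  have lin: "linear_on (fscale (fscale (fscale s))) (fscale (fscale (fscale s))) ?X ?f"
    by (rule linear_onI) (simp_all add: fun_eq_iff sw_def sum.distrib s.scale_sum_right)
  have GM: "G a \<in> HomM s act V" if "G \<in> ?X" for G a using that by simp
  note GV = HomM_in[OF GM] and lu = HomM_lmap(1)[OF GM] and lb = HomM_lmap(2)[OF GM]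
    and act = HomM_act[OF GM]
  have la: "lmap sH s (\<lambda>a. G a b u)" if "G \<in> ?X" for G b u
    using that by (auto simp: linear_on_def fun_eq_iff)
  have "?f G \<in> HomM (fscale s) (cact act) (coind s V)" if G: "G \<in> ?X" for G
  proof -
    note la' = lmap_compose[OF la[OF G]] and lb' = lmap_compose[OF lb[OF G]] and lu' = lmap_compose[OF lu[OF G]]
    have "?f G b u \<in> coind s V" for b u
      unfolding coind_def by (auto intro!: sw_in[OF vs] GV[OF G] lmap_sw_fun[OF vs(1)] la' lin_intros)
    moreover have "lmap sU s (\<lambda>u. ?f G b u a)" for a b
      by (intro lmap_sw_fun[OF vs(1)] lu' lmap_ident)
    moreover have "lmap sH s (\<lambda>b. ?f G b u a)" for a u
      by (intro lmap_sw[OF vs(1)] lb' lmap_ident)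
    moreover have "cact act x (?f G b u) = co x (\<lambda>e y. ?f G (e * b) (actU y u))" for x b u
    proof
      fix a
      have "cact act x (?f G b u) a = co x (\<lambda>e y. sw b (\<lambda>p q. act y (G (a * e * p) q u)))"
        by (simp add: cact_def sw_linear_on_image[OF lact vs] GV[OF G])
      \<comment> \<open>Equivariance of the values of \<open>G\<close> moves \<open>y\<close> into
        their arguments at the price of a second coaction. Coassociativity merges the two coactions
        into a comultiplication of \<open>e\<close>, and multiplicativity of \<open>\<Delta>\<close>
        then assembles \<open>e * b\<close>.\<close>
      also have "\<dots> = co x (\<lambda>e y. co y (\<lambda>d z. sw b (\<lambda>p q. G (a * e * p) (d * q) (actU z u))))"
        by (simp add: act[OF G] co_sw_swap)
      also have "\<dots> = co x (\<lambda>e y. sw e (\<lambda>e d. sw b (\<lambda>p q. G (a * e * p) (d * q) (actU y u))))"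
        by (rule co_coassoc[symmetric, OF vs(1)])
          (auto simp: trilinear_def intro!: lmap_sw_fun[OF vs(1)] la' lb' lu' actU_left lin_intros)
      also have "\<dots> = co x (\<lambda>e y. sw (e * b) (\<lambda>p q. G (a * p) q (actU y u)))"
        by (subst sw_mult[OF vs(1)]) (auto simp: mult.assoc intro!: la' lb' lin_intros)
      finally show "cact act x (?f G b u) a = co x (\<lambda>e y. ?f G (e * b) (actU y u)) a"
        by (simp add: co_apply)
    qed
    ultimately show ?thesis by (auto simp: HomM_def bilforms_def linear_on_def fun_eq_iff)
  qed
  then have "?f ` ?X \<subseteq> HomM (fscale s) (cact act) (coind s V)" by blast
  then have le: "vector_space.dim (fscale (fscale (fscale s))) (?f ` ?X) \<le>
      hdim (fscale s) (cact act) (coind s V)"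
    unfolding hdim_def
    by (intro dim_mono_findim[OF HomM_findim[OF kmod_coind[OF V]]] findimD(2)[OF findim_image[OF conjunct1[OF P] vs3 lin]])
  have inj: "G = 0" if G: "G \<in> ?X" and 0: "?f G = 0" for G
  proof (intro ext)
    fix a b u
    note la' = lmap_compose[OF la[OF G]] and lb' = lmap_compose[OF lb[OF G]]
    \<comment> \<open>Evaluating the second leg's map at \<open>a * S p\<close> produces
      \<open>S p * p'\<close>, which collapses to the counit and leaves
      \<open>G a b u\<close>.\<close>
    have "sw b (\<lambda>p q. ?f G q u (a * S p)) = sw b (\<lambda>r q. sw r (\<lambda>p p'. G (a * S p * p') q u))"
      by (rule sw_coassoc[symmetric, OF vs(1)]) (auto simp: trilinear_def intro!: la' lb' lin_intros)
    also have "\<dots> = sw b (\<lambda>r q. G (a * sw r (\<lambda>p p'. S p * p')) q u)"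
      by (simp add: mult.assoc sw_linear_image[OF la[OF G] vsH] flip: sw_mult_left)
    also have "\<dots> = sw b (\<lambda>r q. s (\<epsilon> r) (G a q u))"
      by (simp add: sw_antipode_left scale_mult_right linear_on_scale[OF la[OF G]])
    also have "\<dots> = G a b u"
      by (rule sw_counit_left[OF vs(1) lb[OF G]])
    finally show "G a b u = 0 a b u" using fun_cong[OF fun_cong[OF fun_cong[OF 0]]] by (simp add: sw_def)
  qed
  show ?thesis
    using dim_image_inj[OF conjunct1[OF P] vs3 lin inj] P le by (simp add: hdim_def)
qed

end

section \<open>The use of \<open>H\<close>-simplicity\<close>

context fd_comodule_algebra
begin

text \<open>Writing a component as a Sweedler expression makes coassociativity and multiplicativity
  of the coaction applicable to it.\<close>

lemma rcomp_eq_co: "e \<in> B \<Longrightarrow> co x (\<lambda>a y. sK (crd sH B e a) y) = rcomp e x"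
proof -
  assume e: "e \<in> B"
  have "co x (\<lambda>a y. sK (crd sH B e a) y) = (\<Sum>d\<in>B. if d = e then rcomp e x else 0)"
    unfolding co_def by (intro sum.cong) (auto simp: HB.crd_basis)
  then show ?thesis using e HB.finite_Basis by simp
qed

lemmas crd_lmap = lmap_compose[OF HB.crd_linear]

lemma co_in_if_comps:
  assumes "module.subspace sK I" "\<And>e. e \<in> B \<Longrightarrow> rcomp e x \<in> I" "\<And>a y. y \<in> I \<Longrightarrow> \<phi> a y \<in> I"
  shows "co x \<phi> \<in> I"
  unfolding co_def using assms by (intro K.subspace_sum) auto

lemma kmod_regular: "findim sK UNIV \<Longrightarrow> kmod sK (*) UNIV"
  unfolding kmod_def
  by (auto simp: linear_on_def distrib_left distrib_right K.scale_mult_left K.scale_mult_right mult.assoc)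

text \<open>
  The elements \<open>x\<close> whose coaction lies in \<open>H \<otimes> Ann V\<close> form a proper ideal and subcomodule.
\<close>

lemma H_simple_faithful:
  assumes simple: "H_simple sH sK \<rho>" and V: "kmod s act V" "V \<noteq> {0}"
    and x: "\<And>e v. e \<in> B \<Longrightarrow> v \<in> V \<Longrightarrow> act (rcomp e x) v = 0"
  shows "x = 0"
proof -
  note vs = kmodD(2,3)[OF V(1)] and lact = kmodD(4)[OF V(1)] and vact = kmodD(5)[OF V(1)]
  interpret s: vector_space s by (fact vs)
  define I where "I = {y. \<forall>v\<in>V. act y v = 0}"
  define J where "J = {x. \<forall>e\<in>B. rcomp e x \<in> I}"
  have subI: "K.subspace I"
    unfolding K.subspace_def I_def
    by (auto simp: linear_on_add[OF kmodD(6)[OF V(1)]] linear_on_scale[OF kmodD(6)[OF V(1)]]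
        linear_on_0[OF kmodD(6)[OF V(1)] vsK])
  have idealI: "a * y \<in> I" "y * a \<in> I" if "y \<in> I" for a y
    using that by (auto simp: I_def kmodD(8)[OF V(1)] kmod_act_0[OF V(1)] vact)
  have subJ: "K.subspace J"
    using K.subspace_0[OF subI] K.subspace_add[OF subI] K.subspace_scale[OF subI]
    unfolding K.subspace_def J_def
    by (auto simp: linear_on_add[OF rcomp_linear] linear_on_scale[OF rcomp_linear]
        linear_on_0[OF rcomp_linear vsK])
  have coJ: "co x \<phi> \<in> I" if "x \<in> J" "\<And>a y. y \<in> I \<Longrightarrow> \<phi> a y \<in> I" for x \<phi>
    using that by (intro co_in_if_comps[OF subI]) (auto simp: J_def)
  \<comment> \<open>A component of a product is a combination of products of components, so it lies
    in the ideal \<open>I\<close> as soon as one factor has all its components there.\<close>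
  have rmult: "rcomp e (x * y) = co x (\<lambda>a x'. co y (\<lambda>b y'. sK (crd sH B e (a * b)) (x' * y')))"
    if "e \<in> B" for e x y
    by (subst rcomp_eq_co[OF that, symmetric], subst co_mult[OF vsK])
      (auto intro!: lin_intros crd_lmap)
  have ideal: "two_sided_ideal sK J"
    unfolding two_sided_ideal_def
  proof (intro conjI subJ allI ballI)
    fix a x assume x: "x \<in> J"
    have "rcomp e (a * x) \<in> I" if "e \<in> B" for e
      unfolding rmult[OF that]
      by (intro co_in[OF vsK subI] coJ[OF x] K.subspace_scale[OF subI] idealI)
    then show "a * x \<in> J" by (simp add: J_def)
    have "rcomp e (x * a) \<in> I" if "e \<in> B" for e
      unfolding rmult[OF that]
      by (intro coJ[OF x] co_in[OF vsK subI] K.subspace_scale[OF subI] idealI)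
    then show "x * a \<in> J" by (simp add: J_def)
  qed
  \<comment> \<open>By its definition \<open>J\<close> has coaction in \<open>H \<otimes> I\<close>
    only; coassociativity sharpens this to \<open>H \<otimes> J\<close>, which makes
    \<open>J\<close> a subcomodule.\<close>
  have "rcomp d (rcomp e x) \<in> I" if x: "x \<in> J" and e: "e \<in> B" and d: "d \<in> B" for x d e
  proof -
    have "rcomp d (rcomp e x) = co x (\<lambda>a y. sK (crd sH B e a) (rcomp d y))"
      by (subst rcomp_eq_co[OF e, symmetric])
        (simp add: co_linear_image[OF rcomp_linear vsK] linear_on_scale[OF rcomp_linear])
    also have "\<dots> = co x (\<lambda>a y. co y (\<lambda>b z. sK (crd sH B e a * crd sH B d b) z))"
      by (simp add: rcomp_eq_co[OF d, symmetric] co_linear_image[OF lmap_scale_right[OF vsK lmap_ident] vsK])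
    also have "\<dots> = co x (\<lambda>a y. sw a (\<lambda>p q. sK (crd sH B e p * crd sH B d q) y))"
    proof (rule co_coassoc[symmetric, OF vsK])
      show "trilinear sH sH sK sK (\<lambda>a b z. sK (crd sH B e a * crd sH B d b) z)"
        using HB.crd_linear[of e] HB.crd_linear[of d]
        by (auto simp: trilinear_def linear_on_def algebra_simps K.scale_left_distrib K.scale_right_distrib)
    qed
    also have "\<dots> \<in> I"
      by (intro coJ[OF x] sw_in[OF vsK subI] K.subspace_scale[OF subI])
    finally show ?thesis .
  qed
  then have rJ: "rcomp e x \<in> J" if "x \<in> J" "e \<in> B" for x e using that by (simp add: J_def)
  have "subcomodule sH sK \<rho> J"
    unfolding subcomodule_def scl_tensor
  proof (intro conjI subJ ballI)
    interpret t: vector_space "fscale (*) :: 'k \<Rightarrow> (('h \<Rightarrow> 'a \<Rightarrow> 'k) \<Rightarrow> 'k) \<Rightarrow> _"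
      by (rule tensor_vs(1))
    fix x assume x: "x \<in> J"
    have \<rho>: "\<rho> x = (\<Sum>e\<in>B. pure HH KK e (rcomp e x))"
      unfolding rcomp_def
      by (rule F.tensor_expand[OF is_vspace_full[OF vsK] coaction_car[OF vsK coact_linear]])
    show "\<rho> x \<in> t.span {pure HH KK h y |h y. y \<in> J}"
      unfolding \<rho> using rJ[OF x] by (intro t.span_sum t.span_base) blast
  qed
  with ideal simple have "J = {0} \<or> J = UNIV" by (simp add: H_simple_def)
  \<comment> \<open>The counit recovers \<open>1\<close> from its coaction, so
    \<open>J = UNIV\<close> would put \<open>1\<close> into the annihilator of the nonzero
    \<open>V\<close>.\<close>
  moreover have "J \<noteq> UNIV"
  proof
    assume "J = UNIV"
    then have "co 1 (\<lambda>a y. sK (\<epsilon> a) y) \<in> I" by (intro coJ K.subspace_scale[OF subI]) auto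
    then have "1 \<in> I" by (simp add: co_counit[OF vsK lmap_ident])
    then have "V \<subseteq> {0}" using kmodD(7)[OF V(1)] by (auto simp: I_def)
    then show False using V(2) s.subspace_0[OF vs(2)] by blast
  qed
  moreover have "x \<in> J" using x by (simp add: J_def I_def)
  ultimately show "x = 0" by simp
qed

end

section \<open>Tight modules: those that attain the maximal ratio\<close>

context fd_setting
begin

context
  fixes p q :: nat
  assumes bound: "\<forall>V. kmod sD dact V \<and> V \<subseteq> Kd \<longrightarrow> p * hdim sD dact V \<le> q * vector_space.dim sD V"
begin

text \<open>
  Every nonzero module has a nonzero quotient inside \<open>K\<^sup>*\<close>, given by the matrix coefficients of a
  functional.
\<close>

lemma hdim_upper: "kmod s act V \<Longrightarrow> p * hdim s act V \<le> q * vector_space.dim s V"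
proof (induction "vector_space.dim s V" arbitrary: V rule: less_induct)
  case less
  note V = less.prems
  note vs = kmodD(2,3)[OF V] and lact = kmodD(4)[OF V] and vact = kmodD(5)[OF V]
  interpret s: vector_space s by (fact vs)
  show ?case
  proof (cases "V = {0}")
    case True
    then have "s.dim V = 0" using dim_eq_0_iff_findim[OF kmodD(1)[OF V]] by simp
    then show ?thesis using kmod_zero_hdim[OF V] by simp
  next
    case False
    then obtain v0 where v0: "v0 \<in> V" "v0 \<notin> {0}" using s.subspace_0[OF vs(2)] by blast
    obtain \<xi> where \<xi>: "lmap s (*) \<xi>" "\<xi> v0 = 1"
      by (rule exists_separating_functional[OF s.vector_space_axioms s.subspace_single_0 v0(2)])
    define f where "f = (\<lambda>v x. \<xi> (act x v))"
    have f: "kmap s act V sD dact f"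
      unfolding kmap_def
      by (auto simp: f_def dact_def fun_eq_iff linear_on_def linear_on_add[OF lact] linear_on_scale[OF lact]
          linear_on_add[OF \<xi>(1)] linear_on_scale[OF \<xi>(1)] kmodD(8)[OF V]
          intro: vector_space_fscale[OF vector_space_ground])
    have lin: "linear_on s sD V f" using f by (simp add: kmap_def)
    have vD: "vector_space (sD :: 'k \<Rightarrow> ('a \<Rightarrow> 'k) \<Rightarrow> _)"
      by (intro vector_space_fscale vector_space_ground)
    have d0: "dact x 0 = 0" for x :: 'a by (simp add: dact_def fun_eq_iff)
    have fKd: "f ` V \<subseteq> Kd"
      using kmodD(6)[OF V] by (auto simp: Kd_def f_def intro!: lmap_compose[OF \<xi>(1)])
    have im: "p * hdim sD dact (f ` V) \<le> q * vector_space.dim sD (f ` V)"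
      using bound kmod_image[OF V f] fKd by simp
    \<comment> \<open>The choice of \<open>\<xi>\<close> makes the image nonzero, so the kernel has
      smaller dimension and the induction hypothesis covers it; the image is covered by
      \<open>bound\<close>.\<close>
    have "f v0 1 \<noteq> 0" using \<xi>(2) by (simp add: f_def kmodD(7)[OF V v0(1)])
    then have "f v0 \<noteq> 0" by (auto simp: fun_eq_iff)
    then have "f ` V \<noteq> {0}" using v0(1) by blast
    then have pos: "vector_space.dim sD (f ` V) > 0"
      using dim_eq_0_iff_findim[OF findim_image[OF kmodD(1)[OF V] vD lin]] by simp
    note rn = rank_nullity[OF kmodD(1)[OF V] vD lin]
    have "p * hdim s act {v \<in> V. f v = 0} \<le> q * s.dim {v \<in> V. f v = 0}"
      using rn pos by (intro less.hyps kmod_kernel[OF V f d0]) simp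
    moreover have "p * hdim s act V \<le> p * (hdim s act {v \<in> V. f v = 0} + hdim sD dact (f ` V))"
      by (rule mult_le_mono2[OF hdim_kernel_image[OF V f d0]])
    ultimately show ?thesis using im rn by (simp add: distrib_left)
  qed
qed

text \<open>
  By \<open>hdim_upper\<close> these are the modules for which \<open>hdim / dim\<close> attains its maximal value \<open>q / p\<close>.
  As \<open>hdim\<close> is subadditive, submodules and quotients of tight modules are tight.
\<close>

definition tight :: "('k \<Rightarrow> 'v::ab_group_add \<Rightarrow> 'v) \<Rightarrow> ('a \<Rightarrow> 'v \<Rightarrow> 'v) \<Rightarrow> 'v set \<Rightarrow> bool" where
  "tight s act V \<longleftrightarrow> kmod s act V \<and> q * vector_space.dim s V \<le> p * hdim s act V"

lemma tight_kmod: "tight s act V \<Longrightarrow> kmod s act V"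
  by (simp add: tight_def)

lemma tight_eq: "tight s act V \<Longrightarrow> p * hdim s act V = q * vector_space.dim s V"
  using hdim_upper[of s act V] by (simp add: tight_def)

text \<open>The upper bounds for kernel and image add up to the one for \<open>V\<close>. As the
  latter is attained and \<open>hdim\<close> is subadditive, both of the former are
  attained.\<close>

lemma tight_kernel_image:
  assumes V: "tight s act V" and f: "kmap s act V t act' f" and act0: "\<And>x. act' x 0 = 0"
  shows "tight s act {v \<in> V. f v = 0} \<and> tight t act' (f ` V)"
proof -
  note V' = tight_kmod[OF V]
  note ker = kmod_kernel[OF V' f act0] and im = kmod_image[OF V' f]
  have "p * hdim s act V \<le> p * (hdim s act {v \<in> V. f v = 0} + hdim t act' (f ` V))"
    by (rule mult_le_mono2[OF hdim_kernel_image[OF V' f act0]])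
  moreover have "vector_space.dim s V = vector_space.dim s {v \<in> V. f v = 0} + vector_space.dim t (f ` V)"
    using f kmodD(1)[OF V'] by (intro rank_nullity) (auto simp: kmap_def)
  ultimately show ?thesis
    using V ker im hdim_upper[OF ker] hdim_upper[OF im] by (simp add: tight_def distrib_left)
qed

text \<open>
  The quotient \<open>V / V'\<close> is realized in a product of copies of \<open>K\<^sup>*\<close>, indexed by the functionals
  that vanish on \<open>V'\<close>.
\<close>

lemma tight_submodule:
  fixes s :: "'k \<Rightarrow> 'v::ab_group_add \<Rightarrow> 'v"
  assumes V: "tight s act V" and V': "kmod s act V'" "V' \<subseteq> V"
  shows "tight s act V'"
proof -
  note kV = tight_kmod[OF V]
  note vs = kmodD(2,3)[OF kV] and lact = kmodD(4)[OF kV] and vact = kmodD(5)[OF kV]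
  interpret s: vector_space s by (fact vs)
  \<comment> \<open>The index ranges over all functions on the type; those that are not linear or do
    not vanish on \<open>V'\<close> contribute the default value 0.\<close>
  define f where "f = (\<lambda>v \<xi> x. if lmap s (*) \<xi> \<and> (\<forall>w\<in>V'. \<xi> w = 0) then \<xi> (act x v) else (0 :: 'k))"
  have f: "kmap s act V (fscale sD) iact f"
    unfolding kmap_def
  proof (intro conjI allI ballI)
    show "vector_space (fscale sD)" by (intro vector_space_fscale vector_space_ground)
    show "linear_on s (fscale sD) V f"
      by (rule linear_onI)
        (auto simp: f_def fun_eq_iff linear_on_add[OF lact] linear_on_scale[OF lact] linear_on_def)
    show "f (act x v) = iact x (f v)" if "v \<in> V" for x v
      using that by (auto simp: f_def fun_eq_iff iact_def dact_def kmodD(8)[OF kV])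
  qed
  \<comment> \<open>Elements of \<open>V'\<close> are killed since their whole orbit stays in
    \<open>V'\<close>. An element outside is detected by a separating functional, evaluated at
    \<open>x = 1\<close>.\<close>
  have "{v \<in> V. f v = 0} = V'"
  proof (intro equalityI subsetI)
    fix v assume v: "v \<in> V'"
    then show "v \<in> {v \<in> V. f v = 0}"
      using V'(2) kmodD(5)[OF V'(1)] by (auto simp: f_def fun_eq_iff)
  next
    fix v assume v: "v \<in> {v \<in> V. f v = 0}"
    show "v \<in> V'"
    proof (rule ccontr)
      assume "v \<notin> V'"
      then obtain \<xi> :: "'v \<Rightarrow> 'k" where \<xi>: "lmap s (*) \<xi>" "\<And>x. x \<in> V' \<Longrightarrow> \<xi> x = 0" "\<xi> v = 1"
        by (rule exists_separating_functional[OF vs(1) kmodD(3)[OF V'(1)]]) blast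
      moreover have "v \<in> V" using v by simp
      ultimately have "f v \<xi> 1 = 1" by (simp add: f_def kmodD(7)[OF kV])
      moreover have "f v \<xi> 1 = 0" using v by simp
      ultimately show False by simp
    qed
  qed
  moreover have "iact x 0 = (0 :: ('v \<Rightarrow> 'k) \<Rightarrow> 'a \<Rightarrow> 'k)" for x
    by (simp add: iact_def dact_def fun_eq_iff)
  ultimately show ?thesis using tight_kernel_image[OF V f] by simp
qed

lemma tight_pow: "tight s act V \<Longrightarrow> finite I \<Longrightarrow> tight (fscale s) (pact act) (fpow I V)"
  unfolding tight_def
proof (intro conjI)
  assume A: "kmod s act V \<and> q * vector_space.dim s V \<le> p * hdim s act V" "finite I"
  then show "kmod (fscale s) (pact act) (fpow I V)" by (intro kmod_pow) auto
  have "q * vector_space.dim (fscale s) (fpow I V) = card I * (q * vector_space.dim s V)"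
    using fpow_findim[OF kmodD(1)[OF conjunct1[OF A(1)]] A(2)] by simp
  also have "\<dots> \<le> card I * (p * hdim s act V)" using A by simp
  also have "\<dots> \<le> p * hdim (fscale s) (pact act) (fpow I V)"
    using mult_le_mono2[OF hdim_pow[OF conjunct1[OF A(1)] A(2)], of p] by (simp add: mult.left_commute)
  finally show "q * vector_space.dim (fscale s) (fpow I V) \<le> p * hdim (fscale s) (pact act) (fpow I V)" .
qed

lemma tight_coind: "tight s act V \<Longrightarrow> tight (fscale s) (cact act) (coind s V)"
  unfolding tight_def
proof (intro conjI)
  assume A: "kmod s act V \<and> q * vector_space.dim s V \<le> p * hdim s act V"
  then show "kmod (fscale s) (cact act) (coind s V)" by (intro kmod_coind) auto
  have "q * vector_space.dim (fscale s) (coind s V) = card B * (q * vector_space.dim s V)"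
    using HB.lmaps_findim[OF kmodD(1)[OF conjunct1[OF A]]] by (simp add: coind_def)
  also have "\<dots> \<le> card B * (p * hdim s act V)" using A by simp
  also have "\<dots> \<le> p * hdim (fscale s) (cact act) (coind s V)"
    using mult_le_mono2[OF hdim_coind[OF conjunct1[OF A]], of p] by (simp add: mult.left_commute)
  finally show "q * vector_space.dim (fscale s) (coind s V) \<le> p * hdim (fscale s) (cact act) (coind s V)" .
qed

text \<open>
  The orbit map of the element \<open>t0\<close> of \<open>coind (V ^ I)\<close>, made of dual bases, embeds \<open>K\<close>.
\<close>

lemma tight_regular:
  fixes s :: "'k \<Rightarrow> 'v::ab_group_add \<Rightarrow> 'v"
  assumes simple: "H_simple sH sK \<rho>" and V: "tight s act V" "V \<noteq> {0}"
  shows "tight sK (*) UNIV"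
proof -
  note kV = tight_kmod[OF V(1)]
  note vs = kmodD(2,3)[OF kV] and lact = kmodD(4)[OF kV] and vact = kmodD(5)[OF kV]
  interpret s: vector_space s by (fact vs)
  obtain BV where BV: "finite BV" "BV \<subseteq> V" "s.span BV = V"
    by (rule findim_basis[OF kmodD(1)[OF kV]])
  define I where "I = B \<times> BV"
  have fI: "finite I" unfolding I_def using BV(1) HB.finite_Basis by simp
  \<comment> \<open>Component \<open>(d, w)\<close> is the \<open>d\<close>-th coordinate functional
    times \<open>w\<close>, so that evaluating the orbit map of \<open>t0\<close> at
    \<open>1\<close> isolates the action of \<open>rcomp d x\<close> on \<open>w\<close>.\<close>
  define t0 where "t0 = (\<lambda>a i. if i \<in> I then s (crd sH B (fst i) a) (snd i) else 0)"
  let ?X = "fpow I V"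
  note kX = kmod_pow[OF kV fI] and tX = tight_pow[OF V(1) fI]
  let ?T = "coind (fscale s) ?X" and ?act = "cact (pact act)" and ?s = "fscale (fscale s)"
  note tT = tight_coind[OF tX]
  note kT = tight_kmod[OF tT]
  have t0: "t0 \<in> ?T"
    using BV(2) s.subspace_scale[OF vs(2)]
    by (auto simp: coind_def fpow_def t0_def I_def linear_on_def fun_eq_iff
        linear_on_add[OF HB.crd_linear] linear_on_scale[OF HB.crd_linear] s.scale_left_distrib)
  define j where "j = (\<lambda>x. ?act x t0)"
  have kK: "kmod sK (*) UNIV" by (rule kmod_regular[OF KB.findim_UNIV])
  note vsT = kmodD(2)[OF kT]
  have jlin: "lmap sK ?s j" unfolding j_def by (rule kmodD(6)[OF kT t0])
  have jmap: "kmap sK (*) UNIV ?s ?act j"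
    using jlin vsT kmodD(8)[OF kT t0] by (simp add: kmap_def j_def)
  have "range j \<subseteq> ?T" unfolding j_def using kmodD(5)[OF kT t0] by blast
  then have tj: "tight ?s ?act (range j)" by (rule tight_submodule[OF tT kmod_image[OF kK jmap]])
  have j0: "x = 0" if "j x = 0" for x
  proof (rule H_simple_faithful[OF simple kV V(2)])
    fix d v assume d: "d \<in> B" and v: "v \<in> V"
    show "act (rcomp d x) v = 0"
    proof (rule linear_on_span_eq_0[OF lact vs vs(1) BV(2)])
      show "v \<in> s.span BV" using v BV(3) by simp
      fix w assume w: "w \<in> BV"
      then have wV: "w \<in> V" using BV(2) by blast
      have "j x 1 (d, w) = co x (\<lambda>e y. act y (s (crd sH B d e) w))"
        using d w by (simp add: j_def cact_def pact_def t0_def I_def co_apply)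
      also have "\<dots> = (\<Sum>e\<in>B. if e = d then act (rcomp d x) w else 0)"
        unfolding co_def by (intro sum.cong) (auto simp: HB.crd_basis wV kmod_act_0[OF kV])
      also have "\<dots> = act (rcomp d x) w" using d HB.finite_Basis by simp
      finally show "act (rcomp d x) w = 0" using that by simp
    qed
  qed
  have inj: "inj j"
  proof (rule injI)
    fix x y assume "j x = j y"
    then have "j (x - y) = 0" using linear_on_diff[OF jlin vsK] by simp
    then show "x = y" using j0[of "x - y"] by simp
  qed
  \<comment> \<open>Tightness is known for the copy \<open>range j\<close> of the regular module
    inside a function space; the inverse of \<open>j\<close> carries it back to
    \<open>K\<close>.\<close>
  have jm: "kmap ?s ?act (range j) sK (*) (inv j)"
    unfolding kmap_def
  proof (intro conjI allI ballI linear_onI vsK)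
    fix a b assume "a \<in> range j" "b \<in> range j"
    then obtain x y where xy: "a = j x" "b = j y" by blast
    then have "a + b = j (x + y)" by (simp add: linear_on_add[OF jlin])
    then show "inv j (a + b) = inv j a + inv j b" using inj xy by simp
  next
    fix c a assume "a \<in> range j"
    then obtain x where x: "a = j x" by blast
    then have "?s c a = j (sK c x)" by (simp add: linear_on_scale[OF jlin])
    then show "inv j (?s c a) = sK c (inv j a)" using inj x by (simp del: fscale_apply)
  next
    fix x a assume "a \<in> range j"
    then obtain y where y: "a = j y" by blast
    then have "?act x a = j (x * y)" using jmap by (simp add: kmap_def)
    then show "inv j (?act x a) = x * inv j a" using inj y by simp
  qed
  have "tight sK (*) (inv j ` range j)"
    by (rule conjunct2[OF tight_kernel_image[OF tj jm]]) simp
  then show ?thesis using inj by (simp add: image_inv_f_f)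
qed

lemma tight_all:
  assumes K: "tight sK (*) UNIV" and W: "kmod s act W"
  shows "tight s act W"
proof -
  note vs = kmodD(2,3)[OF W] and lact = kmodD(4)[OF W] and vact = kmodD(5)[OF W]
  interpret s: vector_space s by (fact vs)
  obtain BW where BW: "finite BW" "BW \<subseteq> W" "s.span BW = W"
    by (rule findim_basis[OF kmodD(1)[OF W]])
  note tP = tight_pow[OF K BW(1)]
  have lw: "lmap sK s (\<lambda>x. act x w)" if "w \<in> BW" for w using that BW(2) kmodD(6)[OF W] by blast
  \<comment> \<open>The map from the free module on \<open>BW\<close> that sends its generators to
    the basis vectors. It is onto \<open>W\<close> since scalars act through multiples of
    \<open>1\<close>.\<close>
  define f where "f = (\<lambda>g. \<Sum>w\<in>BW. act (g w) w)"
  have fW: "f g \<in> W" for g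
    unfolding f_def using BW(2) vact by (intro s.subspace_sum[OF vs(2)]) blast
  have f: "kmap (fscale sK) (pact (*)) (fpow BW UNIV) s act f"
    unfolding kmap_def
  proof (intro conjI allI ballI linear_onI vs)
    show "f (g + h) = f g + f h" for g h
      by (simp add: f_def linear_on_add[OF lw] sum.distrib)
    show "f (fscale sK c g) = s c (f g)" for c g
      by (simp add: f_def linear_on_scale[OF lw] s.scale_sum_right)
    fix x g
    have "f (pact (*) x g) = (\<Sum>w\<in>BW. act x (act (g w) w))"
      unfolding f_def pact_def using BW(2) by (intro sum.cong) (auto simp: kmodD(8)[OF W])
    also have "\<dots> = act x (f g)"
      unfolding f_def using BW(2) vact by (intro linear_on_sum[OF lact vs, symmetric]) blast
    finally show "f (pact (*) x g) = act x (f g)" .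
  qed
  have "f ` fpow BW UNIV = W"
  proof (intro equalityI subsetI)
    fix w assume "w \<in> W"
    then have "w \<in> s.span BW" using BW(3) by simp
    then obtain u where u: "w = (\<Sum>b\<in>BW. s (u b) b)" using s.span_finite[OF BW(1)] by auto
    show "w \<in> f ` fpow BW UNIV"
    proof (rule image_eqI)
      show "(\<lambda>b. if b \<in> BW then sK (u b) 1 else 0) \<in> fpow BW UNIV" by (simp add: fpow_def)
      have "s (u b) b = act (sK (u b) 1) b" if "b \<in> BW" for b
      proof -
        have "b \<in> W" using that BW(2) by blast
        then show ?thesis by (simp add: linear_on_scale[OF kmodD(6)[OF W]] kmodD(7)[OF W])
      qed
      then show "w = f (\<lambda>b. if b \<in> BW then sK (u b) 1 else 0)" by (simp add: u f_def)
    qed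
  qed (use fW in auto)
  then show ?thesis using tight_kernel_image[OF tP f] kmod_act_0[OF W] by simp
qed

end

theorem hdim_eq:
  assumes simple: "H_simple sH sK \<rho>" and W: "kmod s act W"
  shows "card BK * hdim s act W = card BU * vector_space.dim s W * card B"
proof (cases "card BK = 0")
  case True
  then have "BK = {}" using KB.finite_Basis by simp
  then have "(UNIV :: 'a set) = {0}" using KB.span_Basis by simp
  then have "act 1 w = act 0 w" for w by (metis UNIV_I singletonD)
  then have "w = 0" if "w \<in> W" for w
    using kmodD(7)[OF W that] linear_on_0[OF kmodD(6)[OF W that] vsK] by simp
  then have "W = {0}"
    using module.subspace_0[OF _ kmodD(3)[OF W]] kmodD(2)[OF W] by (auto simp: module_iff_vector_space)
  then have "vector_space.dim s W = 0" using dim_eq_0_iff_findim[OF kmodD(1)[OF W]] by simp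
  then show ?thesis using True by simp
next
  case False
  then have "card BK > 0" by simp
  then obtain V0 where V0: "kmod sD dact V0" "V0 \<subseteq> Kd" "vector_space.dim sD V0 > 0"
    and bound: "\<forall>V. kmod sD dact V \<and> V \<subseteq> Kd \<longrightarrow>
      vector_space.dim sD V0 * hdim sD dact V \<le> hdim sD dact V0 * vector_space.dim sD V"
    by (rule max_ratio)
  \<comment> \<open>The maximal ratio is \<open>q / p\<close>; it is attained at \<open>V0\<close>
    by construction, which makes \<open>V0\<close> tight and starts the chain of tight
    modules.\<close>
  define p where "p = vector_space.dim sD V0"
  define q where "q = hdim sD dact V0"
  note bound' = bound[folded p_def q_def]
  have "tight p q sD dact V0"
    unfolding tight_def[OF bound'] unfolding p_def q_def using V0(1) by simp
  moreover have "V0 \<noteq> {0}" using dim_eq_0_iff_findim[OF kmodD(1)[OF V0(1)]] V0(3) by auto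
  ultimately have K: "tight p q sK (*) UNIV" by (rule tight_regular[OF bound' simple])
  have 1: "p * hdim s act W = q * vector_space.dim s W"
    by (rule tight_eq[OF bound' tight_all[OF bound' K W]])
  \<comment> \<open>Tightness of \<open>K^*\<close> determines the ratio: its \<open>hdim\<close> is
    \<open>dim H\<close> times \<open>dim U\<close>, and its dimension is
    \<open>dim K\<close>.\<close>
  have 2: "p * (card B * card BU) = q * card BK"
    using tight_eq[OF bound' tight_all[OF bound' K kmod_dual]] by (simp add: hdim_dual dim_dual)
  have "p * (card BK * hdim s act W) = card BK * (p * hdim s act W)" by simp
  also have "\<dots> = (q * card BK) * vector_space.dim s W" unfolding 1 by simp
  also have "\<dots> = p * (card BU * vector_space.dim s W * card B)" unfolding 2[symmetric] by simp
  finally show ?thesis using V0(3) by (simp add: p_def)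
qed

end

section \<open>The stabilizer as a space of module maps\<close>

locale fd_stab =
  fd_hopf_module sH \<Delta> \<epsilon> S B sK \<rho> sU actU BU + W: left_module_over sK sW actW
  for sH :: "'k::field \<Rightarrow> 'h::ring_1 \<Rightarrow> 'h"
    and \<Delta> :: "'h \<Rightarrow> ('h \<Rightarrow> 'h \<Rightarrow> 'k) \<Rightarrow> 'k"
    and \<epsilon> :: "'h \<Rightarrow> 'k"
    and S :: "'h \<Rightarrow> 'h"
    and B :: "'h set"
    and sK :: "'k \<Rightarrow> 'a::{ring, monoid_mult} \<Rightarrow> 'a"
    and \<rho> :: "'a \<Rightarrow> ('h \<Rightarrow> 'a \<Rightarrow> 'k) \<Rightarrow> 'k"
    and sU :: "'k \<Rightarrow> 'u::ab_group_add \<Rightarrow> 'u" and actU :: "'a \<Rightarrow> 'u \<Rightarrow> 'u" and BU :: "'u set"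
    and sW :: "'k \<Rightarrow> 'w::ab_group_add \<Rightarrow> 'w" and actW :: "'a \<Rightarrow> 'w \<Rightarrow> 'w"
begin

lemma vsW: "vector_space sW" by (rule W.M.vector_space_axioms)

lemma actW_right: "lmap sW sW (actW x)" and actW_left: "lmap sK sW (\<lambda>x. actW x w)"
  using W.act_bilinear by (simp_all add: bilin_full)

context
  fixes F :: "'h \<Rightarrow> 'u \<Rightarrow> 'w" and g :: "'h \<Rightarrow> 'u"
  assumes F: "bmap sH sU sW F" and g: "lmap sH sU g"
begin

lemma Fl: "lmap s sH f \<Longrightarrow> lmap s sW (\<lambda>x. F (f x) u)" and Fr: "lmap s sU f' \<Longrightarrow> lmap s sW (\<lambda>x. F a (f' x))"
  using F by (auto intro: lmap_compose)

lemmas lin_rules = Fl Fr lmap_compose[OF g] lmap_compose[OF actU_right] lmap_compose[OF actU_left]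
  vsU vsW lin_intros

text \<open>
  The two sides of the defining equation of the stabilizer, at \<open>x\<^sub>(\<^sub>0\<^sub>)\<close> and \<open>x\<^sub>(\<^sub>-\<^sub>1\<^sub>) a\<close> in place of \<open>x\<close>
  and \<open>a\<close>. This substitution is invertible by \<open>untwist\<close>.
\<close>

lemma twist_left:
  "co x (\<lambda>e y. sw (e * a) (\<lambda>p q. F p (co y (\<lambda>d z. actU z (g (T d * q)))))) =
    sw a (\<lambda>p q. co x (\<lambda>e y. F (e * p) (actU y (g q))))"
proof -
  define Q where "Q = (\<lambda>e1 e2 d z. sw a (\<lambda>p q. F (e1 * p) (actU z (g (T d * e2 * q)))))"
  define R where "R = (\<lambda>e1 z. sw a (\<lambda>p q. F (e1 * p) (actU z (g q))))"
  have Fr': "lmap sU sW (F a)" for a using F by blast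
  have "co x (\<lambda>e y. sw (e * a) (\<lambda>p q. F p (co y (\<lambda>d z. actU z (g (T d * q)))))) =
      co x (\<lambda>e y. sw e (\<lambda>e1 e2. sw a (\<lambda>p q. F (e1 * p) (co y (\<lambda>d z. actU z (g (T d * (e2 * q))))))))"
    by (subst sw_mult[OF vsW]) (auto intro!: lin_rules)
  also have "\<dots> = co x (\<lambda>e y. sw e (\<lambda>e1 e2. co y (\<lambda>d z. Q e1 e2 d z)))"
    unfolding Q_def by (simp add: co_linear_image[OF Fr' vsU] co_sw_swap mult.assoc)
  \<comment> \<open>Two uses of coassociativity make \<open>e2\<close> and \<open>d\<close> the legs
    of a single comultiplication, where \<open>T d * e2\<close> collapses to the counit.\<close>
  also have "\<dots> = co x (\<lambda>e1 y. co y (\<lambda>e2 y'. co y' (\<lambda>d z. Q e1 e2 d z)))"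
    by (rule co_coassoc[OF vsW]) (auto simp: trilinear_def Q_def intro!: lin_rules)
  also have "\<dots> = co x (\<lambda>e1 y. co y (\<lambda>e z. sw e (\<lambda>e2 d. Q e1 e2 d z)))"
    by (subst co_coassoc[OF vsW]) (auto simp: trilinear_def Q_def intro!: lin_rules)
  also have "\<dots> = co x (\<lambda>e1 y. co y (\<lambda>e z. sW (\<epsilon> e) (R e1 z)))"
  proof -
    have "sw e (\<lambda>e2 d. Q e1 e2 d z) = sW (\<epsilon> e) (R e1 z)" for e e1 z
    proof -
      have l: "lmap sH sW (\<lambda>h. F (e1 * p) (actU z (g (h * q))))" for p q by (auto intro!: lin_rules)
      have "sw e (\<lambda>e2 d. Q e1 e2 d z) =
          sw a (\<lambda>p q. F (e1 * p) (actU z (g (sw e (\<lambda>e2 d. T d * e2) * q))))"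
        unfolding Q_def by (subst sw_swap) (simp add: sw_linear_image[OF l vsH])
      also have "\<dots> = sw a (\<lambda>p q. sW (\<epsilon> e) (F (e1 * p) (actU z (g q))))"
        using linear_on_scale[OF l, of 1] by (simp add: sw_T_left)
      finally show ?thesis by (simp add: R_def sw_scale[OF vsW])
    qed
    then show ?thesis by simp
  qed
  also have "\<dots> = co x R"
    by (subst co_counit[OF vsW]) (auto simp: R_def intro!: lin_rules)
  also have "\<dots> = sw a (\<lambda>p q. co x (\<lambda>e y. F (e * p) (actU y (g q))))"
    by (simp add: R_def co_sw_swap)
  finally show ?thesis .
qed

lemma twist_right:
  "co x (\<lambda>e y. co y (\<lambda>d z. actW z (sw (T d * (e * a)) (\<lambda>p q. F p (g q))))) =
    actW x (sw a (\<lambda>p q. F p (g q)))"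
proof -
  define G where "G = (\<lambda>a. sw a (\<lambda>p q. F p (g q)))"
  have G: "lmap s sH f \<Longrightarrow> lmap s sW (\<lambda>x. G (f x))" for s and f :: "'x::ab_group_add \<Rightarrow> 'h"
    unfolding G_def by (auto intro!: lin_rules)
  note rules = G lmap_compose[OF actW_right] lmap_compose[OF actW_left] lin_rules
  have "co x (\<lambda>e y. co y (\<lambda>d z. actW z (G (T d * (e * a))))) =
      co x (\<lambda>e y. sw e (\<lambda>p q. actW y (G (T q * (p * a)))))"
    by (rule co_coassoc[symmetric, OF vsW]) (auto simp: trilinear_def intro!: rules)
  also have "\<dots> = co x (\<lambda>e y. actW y (G (sw e (\<lambda>p q. T q * p) * a)))"
  proof -
    have l: "lmap sH sW (\<lambda>h. actW y (G (h * a)))" for y by (auto intro!: rules)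
    show ?thesis by (simp add: sw_linear_image[OF l vsH] mult.assoc)
  qed
  also have "\<dots> = co x (\<lambda>e y. sW (\<epsilon> e) (actW y (G a)))"
    by (simp add: sw_T_left scale_mult_left linear_on_scale[OF G[OF lmap_ident]] linear_on_scale[OF actW_right])
  also have "\<dots> = actW x (G a)" by (rule co_counit[OF vsW actW_left])
  finally show ?thesis by (simp add: G_def)
qed

text \<open>Inserting \<open>T e * a\<close> before multiplying by \<open>d\<close> gives
  \<open>q * T p\<close> over one comultiplication after coassociativity, and this collapses to the
  counit.\<close>

lemma untwist:
  assumes L: "\<And>a. lmap sK sW (\<lambda>x. L x a)" "\<And>x. lmap sH sW (L x)"
  shows "co x (\<lambda>e y. co y (\<lambda>d z. L z (d * (T e * a)))) = L x a"
proof -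
  have "co x (\<lambda>e y. co y (\<lambda>d z. L z (d * (T e * a)))) = co x (\<lambda>e y. sw e (\<lambda>p q. L y (q * (T p * a))))"
    by (rule co_coassoc[symmetric, OF vsW])
      (auto simp: trilinear_def intro!: L(1) lmap_compose[OF L(2)] lin_intros)
  also have "\<dots> = co x (\<lambda>e y. L y (sw e (\<lambda>p q. q * T p) * a))"
  proof -
    have l: "lmap sH sW (\<lambda>h. L y (h * a))" for y by (auto intro!: lmap_compose[OF L(2)] lin_intros)
    show ?thesis by (simp add: sw_linear_image[OF l vsH] mult.assoc)
  qed
  also have "\<dots> = co x (\<lambda>e y. sW (\<epsilon> e) (L y a))"
    by (simp add: sw_T_right scale_mult_left linear_on_scale[OF L(2)])
  also have "\<dots> = L x a" by (rule co_counit[OF vsW L(1)])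
  finally show ?thesis .
qed

end

text \<open>
  The equation for all \<open>g\<close> follows from the case \<open>g = \<epsilon>(-) u\<close>, which is the \<open>K\<close>-linearity of \<open>F\<close>.
\<close>

lemma stabilizer_condition:
  assumes F: "bmap sH sU sW F"
  shows "(\<forall>g. lmap sH sU g \<longrightarrow> (\<forall>x a. sw a (\<lambda>p q. F p (co x (\<lambda>e y. actU y (g (T e * q))))) =
      co x (\<lambda>e y. actW y (sw (T e * a) (\<lambda>p q. F p (g q)))))) \<longleftrightarrow>
    (\<forall>x a u. actW x (F a u) = co x (\<lambda>e y. F (e * a) (actU y u)))"
proof (intro iffI allI impI)
  fix x a u
  assume *: "\<forall>g. lmap sH sU g \<longrightarrow> (\<forall>x a. sw a (\<lambda>p q. F p (co x (\<lambda>e y. actU y (g (T e * q))))) =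
      co x (\<lambda>e y. actW y (sw (T e * a) (\<lambda>p q. F p (g q)))))"
  let ?g = "\<lambda>q. sU (\<epsilon> q) u"
  have g: "lmap sH sU ?g" by (auto intro!: lin_intros vsU)
  note rules = lin_rules[OF F g]
  have Fs: "F p (sU c v) = sW c (F p v)" for p c v
    using F by (simp add: linear_on_def)
  have "actW x (F a u) = actW x (sw a (\<lambda>p q. F p (?g q)))"
    unfolding Fs by (subst sw_counit_right[OF vsW]) (auto intro!: rules)
  also have "\<dots> = co x (\<lambda>e y. co y (\<lambda>d z. actW z (sw (T d * (e * a)) (\<lambda>p q. F p (?g q)))))"
    by (rule twist_right[OF F g, symmetric])
  also have "\<dots> = co x (\<lambda>e y. sw (e * a) (\<lambda>p q. F p (co y (\<lambda>d z. actU z (?g (T d * q))))))"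
    using *[rule_format, OF g] by simp
  also have "\<dots> = sw a (\<lambda>p q. co x (\<lambda>e y. F (e * p) (actU y (?g q))))"
    by (rule twist_left[OF F g])
  also have "\<dots> = sw a (\<lambda>p q. sW (\<epsilon> q) (co x (\<lambda>e y. F (e * p) (actU y u))))"
    by (simp add: linear_on_scale[OF actU_right] Fs co_linear_image[OF lmap_scale_right[OF vsW lmap_ident] vsW])
  also have "\<dots> = co x (\<lambda>e y. F (e * a) (actU y u))"
    by (subst sw_counit_right[OF vsW]) (auto intro!: rules)
  finally show "actW x (F a u) = co x (\<lambda>e y. F (e * a) (actU y u))" .
next
  fix g x a
  assume *: "\<forall>x a u. actW x (F a u) = co x (\<lambda>e y. F (e * a) (actU y u))" and g: "lmap sH sU g"
  note rules = lin_rules[OF F g]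
  let ?A = "\<lambda>x a. sw a (\<lambda>p q. F p (co x (\<lambda>e y. actU y (g (T e * q)))))"
  \<comment> \<open>Untwisting expresses \<open>?A\<close> through its twisted values; in these the
    action sits inside \<open>F\<close>, so the equivariance of \<open>F\<close> can be
    applied.\<close>
  have "?A x a = co x (\<lambda>e y. co y (\<lambda>d z. ?A z (d * (T e * a))))"
    by (rule untwist[OF F g, symmetric]) (auto intro!: rules)
  also have "\<dots> = co x (\<lambda>e y. sw (T e * a) (\<lambda>p q. co y (\<lambda>d z. F (d * p) (actU z (g q)))))"
    by (simp add: twist_left[OF F g])
  also have "\<dots> = co x (\<lambda>e y. actW y (sw (T e * a) (\<lambda>p q. F p (g q))))"
    using * by (simp add: sw_linear_image[OF actW_right vsW])
  finally show "?A x a = co x (\<lambda>e y. actW y (sw (T e * a) (\<lambda>p q. F p (g q))))" .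
qed

end

text \<open>Sum formulas such as the one for the diagonal action hold only for functionals in the
  carrier; bilinearity transfers along such an equality.\<close>

lemma bilin_cong:
  assumes V: "is_vspace V" and W: "is_vspace W"
    and eq: "\<And>v w. v \<in> car V \<Longrightarrow> w \<in> car W \<Longrightarrow> \<phi> v w = \<psi> v w" and \<psi>: "bilin V W X \<psi>"
  shows "bilin V W X \<phi>"
proof -
  interpret v: vector_space "scl V" by (rule is_vspaceD[OF V])
  interpret w: vector_space "scl W" by (rule is_vspaceD[OF W])
  note [simp] = eq v.subspace_add[OF is_vspaceD(2)[OF V]] v.subspace_scale[OF is_vspaceD(2)[OF V]]
    w.subspace_add[OF is_vspaceD(2)[OF W]] w.subspace_scale[OF is_vspaceD(2)[OF W]]
  show ?thesis using \<psi> by (simp add: bilin_def lin_def)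
qed

section \<open>Tensor products with \<open>H^*\<close> as spaces of linear maps on
  \<open>H\<close>\<close>

context fd_comodule_algebra
begin

lemma scl_Hd [simp]: "scl Hd = fscale (*)"
  by (simp add: dual_def Hom_def fscale_def[abs_def])

lemma car_Hd: "\<beta> \<in> car Hd \<longleftrightarrow> lmap sH (*) \<beta>"
  by (simp add: dual_def Hom_def lin_iff)

lemma is_vspace_Hd: "is_vspace Hd"
  unfolding dual_def by (rule is_vspace_Hom[OF is_vspace_H is_vspace_ground])

lemma crd_Hd: "crd sH B e \<in> car Hd"
  by (simp add: car_Hd HB.crd_linear)

sublocale DF: framed Hd B "crd sH B" "\<lambda>e \<beta>. \<beta> e"
proof
  fix \<beta> assume "\<beta> \<in> car Hd"
  then have \<beta>: "lmap sH (*) \<beta>" by (simp add: car_Hd)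
  show "\<beta> = (\<Sum>e\<in>B. scl Hd (\<beta> e) (crd sH B e))"
  proof
    fix a show "\<beta> a = (\<Sum>e\<in>B. scl Hd (\<beta> e) (crd sH B e)) a"
      using HB.lmap_expand[OF \<beta> vector_space_ground, of a] by (simp add: sum_fun_apply mult.commute)
  qed
qed (simp_all add: is_vspace_Hd crd_Hd linear_on_def HB.finite_Basis)

text \<open>
  \<open>ev\<close> and \<open>unev\<close> identify \<open>H\<^sup>* \<otimes> V\<close> with the linear maps \<open>H \<rightarrow> V\<close>.
\<close>

definition ev :: "('k, 'v::ab_group_add) vspace \<Rightarrow> ((('h \<Rightarrow> 'k) \<Rightarrow> 'v \<Rightarrow> 'k) \<Rightarrow> 'k) \<Rightarrow> 'h \<Rightarrow> 'v" where
  "ev V t a = (\<Sum>e\<in>B. scl V (crd sH B e a) (DF.tcomp V e t))"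

definition unev :: "('k, 'v::ab_group_add) vspace \<Rightarrow> ('h \<Rightarrow> 'v) \<Rightarrow> ((('h \<Rightarrow> 'k) \<Rightarrow> 'v \<Rightarrow> 'k) \<Rightarrow> 'k)" where
  "unev V g = (\<Sum>e\<in>B. pure Hd V (crd sH B e) (g e))"

lemma sum_crd: "e \<in> B \<Longrightarrow> vector_space s \<Longrightarrow> (\<Sum>d\<in>B. s (crd sH B d e) (f d)) = f e"
proof -
  assume e: "e \<in> B" and "vector_space s"
  then interpret s: vector_space s by simp
  have "(\<Sum>d\<in>B. s (crd sH B d e) (f d)) = (\<Sum>d\<in>B. if d = e then f e else 0)"
    by (intro sum.cong) (auto simp: HB.crd_basis e)
  then show ?thesis using e HB.finite_Basis by simp
qed

context
  fixes V :: "('k, 'v::ab_group_add) vspace"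
  assumes V: "is_vspace V"
begin

lemma ev_basis: "e \<in> B \<Longrightarrow> ev V t e = DF.tcomp V e t"
  unfolding ev_def by (rule sum_crd[OF _ is_vspaceD(1)[OF V]])

lemma ev_car:
  assumes "t \<in> car (Hd \<otimes>\<^sub>v V)" shows "ev V t a \<in> car V"
proof -
  interpret v: vector_space "scl V" by (rule is_vspaceD[OF V])
  show ?thesis
    unfolding ev_def
    by (intro v.subspace_sum[OF is_vspaceD(2)[OF V]] v.subspace_scale[OF is_vspaceD(2)[OF V]]
        DF.tcomp_car[OF V assms])
qed

lemma ev_lmap: "lmap sH (scl V) (ev V t)"
  unfolding ev_def[abs_def]
  by (intro linear_on_sum_fun lmap_scale_left is_vspaceD[OF V] HB.crd_linear)

lemma ev_linear: "linear_on (fscale (*)) (scl V) (car (Hd \<otimes>\<^sub>v V)) (\<lambda>t. ev V t a)"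
proof -
  interpret v: vector_space "scl V" by (rule is_vspaceD[OF V])
  show ?thesis
    unfolding ev_def
    by (rule linear_onI)
      (simp_all add: linear_on_add[OF DF.tcomp_linear[OF V]] linear_on_scale[OF DF.tcomp_linear[OF V]]
        v.scale_right_distrib sum.distrib v.scale_sum_right mult.commute)
qed

lemma ev_pure:
  assumes "\<beta> \<in> car Hd" "v \<in> car V"
  shows "ev V (pure Hd V \<beta> v) a = scl V (\<beta> a) v"
proof -
  interpret v: vector_space "scl V" by (rule is_vspaceD[OF V])
  have \<beta>: "lmap sH (*) \<beta>" using assms(1) by (simp add: car_Hd)
  have "ev V (pure Hd V \<beta> v) a = scl V (\<Sum>e\<in>B. crd sH B e a * \<beta> e) v"
    unfolding ev_def by (simp add: DF.tcomp_pure[OF V assms] v.scale_sum_left)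
  then show ?thesis
    by (simp flip: HB.lmap_expand[OF \<beta> vector_space_ground])
qed

lemma unev_car: "(\<And>a. g a \<in> car V) \<Longrightarrow> unev V g \<in> car (Hd \<otimes>\<^sub>v V)"
  unfolding unev_def
  by (intro module.subspace_sum[OF _ tensor_vs(2)] pure_in_tensor crd_Hd)
    (simp_all add: module_iff_vector_space tensor_vs)

lemma unev_ev:
  assumes "t \<in> car (Hd \<otimes>\<^sub>v V)"
  shows "unev V (ev V t) = t"
proof -
  have "unev V (ev V t) = (\<Sum>e\<in>B. pure Hd V (crd sH B e) (DF.tcomp V e t))"
    unfolding unev_def by (intro sum.cong) (simp_all add: ev_basis)
  then show ?thesis by (simp flip: DF.tensor_expand[OF V assms])
qed

lemma ev_unev:
  assumes "lmap sH (scl V) g" "\<And>a. g a \<in> car V"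
  shows "ev V (unev V g) = g"
proof
  fix a
  have "ev V (unev V g) a = (\<Sum>e\<in>B. ev V (pure Hd V (crd sH B e) (g e)) a)"
    unfolding unev_def
    by (rule linear_on_sum[OF ev_linear tensor_vs]) (simp add: pure_in_tensor crd_Hd assms)
  also have "\<dots> = g a"
    by (simp add: ev_pure[OF crd_Hd assms(2)] flip: HB.lmap_expand[OF assms(1) is_vspaceD(1)[OF V]])
  finally show "ev V (unev V g) a = g a" .
qed

lemma ev_inject: "t \<in> car (Hd \<otimes>\<^sub>v V) \<Longrightarrow> t' \<in> car (Hd \<otimes>\<^sub>v V) \<Longrightarrow> ev V t = ev V t' \<Longrightarrow> t = t'"
  by (metis unev_ev)

lemma unev_linear:
  "linear_on (fscale (scl V)) (fscale (*)) {g. \<forall>a. g a \<in> car V} (unev V)"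
proof -
  interpret t: vector_space "fscale (*) :: 'k \<Rightarrow> ((('h \<Rightarrow> 'k) \<Rightarrow> 'v \<Rightarrow> 'k) \<Rightarrow> 'k) \<Rightarrow> _"
    by (rule tensor_vs(1))
  have "bilin Hd V (Hd \<otimes>\<^sub>v V) (pure Hd V)" by (rule bilin_pure[OF is_vspace_Hd V])
  then have l: "linear_on (scl V) (fscale (*)) (car V) (pure Hd V (crd sH B e))" for e
    using crd_Hd by (simp add: bilin_def lin_iff)
  show ?thesis
    unfolding unev_def
    by (rule linear_onI)
      (simp_all add: linear_on_add[OF l] linear_on_scale[OF l] sum.distrib t.scale_sum_right del: fscale_apply,
        simp add: linear_on_scale[OF l])
qed

end

lemma conv_eq: "lmap sH (*) \<alpha> \<Longrightarrow> lmap sH (*) \<beta> \<Longrightarrow> conv \<alpha> \<beta> = (\<lambda>h. sw h (\<lambda>a b. \<alpha> a * \<beta> b))"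
  unfolding conv_def ground_def
  by (intro ext comult_tlift[OF vector_space_ground])
    (auto simp: linear_on_def algebra_simps)

lemma conv_Hd: "\<alpha> \<in> car Hd \<Longrightarrow> \<beta> \<in> car Hd \<Longrightarrow> conv \<alpha> \<beta> \<in> car Hd"
  unfolding car_Hd
  by (subst conv_eq)
    (auto intro!: lmap_sw[OF vector_space_ground lmap_ident] lmap_scale_right[OF vector_space_ground])

lemma dual_act_Hd: "\<beta> \<in> car Hd \<Longrightarrow> dual_act h \<beta> \<in> car Hd"
  unfolding car_Hd dual_act_def by (erule lmap_compose) (intro lin_intros)

context
  fixes sV :: "'k \<Rightarrow> 'v::ab_group_add \<Rightarrow> 'v" and act
  assumes V: "left_module_over sK sV act"
begin

interpretation V: left_module_over sK sV act by (rule V)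

lemma vsV: "vector_space sV" by (rule V.M.vector_space_axioms)

lemma is_vspace_V: "is_vspace (full sV)" by (rule is_vspace_full[OF vsV])

lemma act_lmap: "lmap sV sV (act x)" "lmap sK sV (\<lambda>x. act x v)"
  using V.act_bilinear by (simp_all add: bilin_full)

lemma dual_tensor_act_inner:
  assumes "\<beta> \<in> car Hd"
  shows "tlift HH KK (Hd \<otimes>\<^sub>v full sV) (\<lambda>h y. pure Hd (full sV) (dual_act h \<beta>) (act y u)) (\<rho> x) =
    (\<Sum>e\<in>B. pure Hd (full sV) (dual_act e \<beta>) (act (rcomp e x) u))"
  unfolding rcomp_def
proof (rule F.tlift_eq_sum[OF is_vspace_full[OF vsK] is_vspace_tensor _ coaction_car[OF vsK coact_linear]])
  have "lin HH Hd (\<lambda>h. dual_act h \<beta>)"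
    using assms dual_act_Hd
    by (auto simp: lin_iff linear_on_def fun_eq_iff dual_act_def car_Hd linear_on_add[OF T_lmap]
        linear_on_scale[OF T_lmap] distrib_right scale_mult_left)
  then show "bilin HH KK (Hd \<otimes>\<^sub>v full sV) (\<lambda>h y. pure Hd (full sV) (dual_act h \<beta>) (act y u))"
    by (intro bilin_pure_comp is_vspace_Hd is_vspace_V) (simp_all add: lin_full act_lmap)
qed

lemma dual_tensor_act_bilin:
  "bilin Hd (full sV) (Hd \<otimes>\<^sub>v full sV)
     (\<lambda>\<beta> u. tlift HH KK (Hd \<otimes>\<^sub>v full sV) (\<lambda>h y. pure Hd (full sV) (dual_act h \<beta>) (act y u)) (\<rho> x))"
proof -
  have "bilin Hd (full sV) (Hd \<otimes>\<^sub>v full sV) (\<lambda>\<beta> u. pure Hd (full sV) (dual_act e \<beta>) (act y u))" for e y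
  proof (intro bilin_pure_comp is_vspace_Hd is_vspace_V)
    show "lin Hd Hd (dual_act e)"
      using dual_act_Hd by (auto simp: lin_iff linear_on_def fun_eq_iff dual_act_def)
  qed (simp add: lin_full act_lmap)
  then have b: "bilin Hd (full sV) (Hd \<otimes>\<^sub>v full sV)
      (\<lambda>\<beta> u. \<Sum>e\<in>B. pure Hd (full sV) (dual_act e \<beta>) (act (rcomp e x) u))"
    by (auto simp: bilin_def lin_iff intro!: linear_on_sum_fun tensor_vs
        module.subspace_sum[OF _ tensor_vs(2)] simp: module_iff_vector_space)
  show ?thesis
    by (rule bilin_cong[OF is_vspace_Hd is_vspace_V dual_tensor_act_inner b])
qed

lemma dual_tensor_act_car:
  "t \<in> car (Hd \<otimes>\<^sub>v full sV) \<Longrightarrow> dual_tensor_act sV act x t \<in> car (Hd \<otimes>\<^sub>v full sV)"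
  unfolding dual_tensor_act_def
  by (rule tlift_car[OF is_vspace_Hd is_vspace_V is_vspace_tensor dual_tensor_act_bilin])

text \<open>For a linear map \<open>g\<close> on \<open>H\<close>, the transported action is
  \<open>(x g)(a) = x_(0) g(T(x_(-1)) a)\<close>. Both sides are linear in \<open>t\<close>, so the
  comparison is made on pure tensors.\<close>

lemma ev_dual_tensor_act:
  assumes t: "t \<in> car (Hd \<otimes>\<^sub>v full sV)"
  shows "ev (full sV) (dual_tensor_act sV act x t) a = co x (\<lambda>e y. act y (ev (full sV) t (T e * a)))"
proof (rule linear_on_eq_tensor[OF _ _ vsV _ t])
  let ?V = "full sV"
  have el: "linear_on (fscale (*)) sV (car (Hd \<otimes>\<^sub>v ?V)) (\<lambda>t. ev ?V t a)" for a
    using ev_linear[OF is_vspace_V] by simp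
  have lin: "linear_on (fscale (*)) (fscale (*)) (car (Hd \<otimes>\<^sub>v ?V)) (dual_tensor_act sV act x)"
    unfolding dual_tensor_act_def
    using tlift_linear[OF is_vspace_Hd is_vspace_V is_vspace_tensor dual_tensor_act_bilin] by simp
  show "linear_on (fscale (*)) sV (car (Hd \<otimes>\<^sub>v ?V)) (\<lambda>t. ev ?V (dual_tensor_act sV act x t) a)"
    by (rule linear_on_compose[OF el lin]) (auto simp: dual_tensor_act_car)
  show "linear_on (fscale (*)) sV (car (Hd \<otimes>\<^sub>v ?V)) (\<lambda>t. co x (\<lambda>e y. act y (ev ?V t (T e * a))))"
    unfolding co_def
    by (intro linear_on_sum_fun[OF vsV] linear_on_compose[OF act_lmap(1) el]) simp
  fix \<beta> u assume \<beta>: "\<beta> \<in> car Hd" and u: "u \<in> car ?V"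
  have "dual_tensor_act sV act x (pure Hd ?V \<beta> u) =
      (\<Sum>e\<in>B. pure Hd ?V (dual_act e \<beta>) (act (rcomp e x) u))"
    unfolding dual_tensor_act_def
    by (simp add: tlift_pure[OF is_vspace_Hd is_vspace_V is_vspace_tensor dual_tensor_act_bilin]
        \<beta> dual_tensor_act_inner)
  then have "ev ?V (dual_tensor_act sV act x (pure Hd ?V \<beta> u)) a =
      (\<Sum>e\<in>B. ev ?V (pure Hd ?V (dual_act e \<beta>) (act (rcomp e x) u)) a)"
    by (simp add: linear_on_sum[OF el tensor_vs] pure_in_tensor dual_act_Hd \<beta>)
  moreover have "ev ?V (pure Hd ?V (dual_act e \<beta>) v) a = sV (\<beta> (T e * a)) v" for e v
    by (subst ev_pure[OF is_vspace_V dual_act_Hd[OF \<beta>]]) (simp_all add: dual_act_def)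
  ultimately show "ev ?V (dual_tensor_act sV act x (pure Hd ?V \<beta> u)) a =
      co x (\<lambda>e y. act y (ev ?V (pure Hd ?V \<beta> u) (T e * a)))"
    by (simp add: ev_pure[OF is_vspace_V \<beta>] co_def linear_on_scale[OF act_lmap(1)])
qed

end

end

section \<open>The map \<open>LL\<close> as a convolution, and the dimension of the
  stabilizer\<close>

context fd_comodule_algebra
begin

lemma conv_add_scale:
  assumes "\<alpha> \<in> car Hd" "\<beta> \<in> car Hd" "\<gamma> \<in> car Hd"
  shows "conv \<alpha> (\<beta> + \<gamma>) = conv \<alpha> \<beta> + conv \<alpha> \<gamma>" "conv (\<beta> + \<gamma>) \<alpha> = conv \<beta> \<alpha> + conv \<gamma> \<alpha>"
    "conv \<alpha> (fscale (*) c \<beta>) = fscale (*) c (conv \<alpha> \<beta>)"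
    "conv (fscale (*) c \<beta>) \<alpha> = fscale (*) c (conv \<beta> \<alpha>)"
proof -
  have l: "lmap sH (*) \<alpha>" "lmap sH (*) \<beta>" "lmap sH (*) \<gamma>" using assms by (simp_all add: car_Hd)
  then have "lmap sH (*) (\<beta> + \<gamma>)" "lmap sH (*) (fscale (*) c \<beta>)"
    by (auto simp: linear_on_def algebra_simps)
  with l show "conv \<alpha> (\<beta> + \<gamma>) = conv \<alpha> \<beta> + conv \<alpha> \<gamma>" "conv (\<beta> + \<gamma>) \<alpha> = conv \<beta> \<alpha> + conv \<gamma> \<alpha>"
    "conv \<alpha> (fscale (*) c \<beta>) = fscale (*) c (conv \<alpha> \<beta>)"
    "conv (fscale (*) c \<beta>) \<alpha> = fscale (*) c (conv \<beta> \<alpha>)"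
    by (simp_all add: conv_eq fun_eq_iff sw_def algebra_simps sum.distrib sum_distrib_left)
qed

end

context fd_stab
begin

abbreviation "UU \<equiv> full sU"
abbreviation "WW \<equiv> full sW"
abbreviation "HU \<equiv> Hd \<otimes>\<^sub>v UU"
abbreviation "HW \<equiv> Hd \<otimes>\<^sub>v WW"
abbreviation "UW \<equiv> Hom UU WW"

lemma is_vspace_U: "is_vspace UU" and is_vspace_W': "is_vspace WW"
  by (simp_all add: is_vspace_full vsU vsW)

lemma is_vspace_UW: "is_vspace UW"
  by (rule is_vspace_Hom[OF is_vspace_U is_vspace_W'])

lemma scl_UW [simp]: "scl UW = fscale sW" and car_UW: "f \<in> car UW \<longleftrightarrow> lmap sU sW f"
  by (simp_all add: Hom_def lin_iff fscale_def[abs_def])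

lemma is_vspace_HUW: "is_vspace (Hom HU HW)"
  by (rule is_vspace_Hom[OF is_vspace_tensor is_vspace_tensor])

lemma scl_HUW: "scl (Hom HU HW) = fscale (fscale (*))"
  by (simp add: Hom_def fscale_def[abs_def] tensor_def)

lemma ev_linear_W: "linear_on (fscale (*)) sW (car HW) (\<lambda>t. ev WW t a)"
  using ev_linear[OF is_vspace_W'] by simp

lemma ev_linear_U: "linear_on (fscale (*)) sU (car HU) (\<lambda>t. ev UU t a)"
  using ev_linear[OF is_vspace_U] by simp

text \<open>The inner lift of \<open>LL\<close>, for one pure tensor
  \<open>\<alpha> \<otimes> f\<close>; its bilinearity in \<open>\<alpha>\<close> and
  \<open>f\<close> is what the outer lift requires.\<close>

definition LL1 where
  "LL1 \<alpha> f = tlift Hd UU HW (\<lambda>\<beta> u. pure Hd WW (conv \<alpha> \<beta>) (f u))"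

context
  fixes \<alpha> f assumes \<alpha>: "\<alpha> \<in> car Hd" and f: "f \<in> car UW"
begin

lemma LL1_bilin: "bilin Hd UU HW (\<lambda>\<beta> u. pure Hd WW (conv \<alpha> \<beta>) (f u))"
proof (intro bilin_pure_comp is_vspace_Hd is_vspace_W')
  show "lin Hd Hd (conv \<alpha>)"
    using \<alpha> by (simp add: lin_iff linear_on_def conv_Hd conv_add_scale)
  show "lin UU WW f" using f by (simp add: car_UW lin_full)
qed

lemma LL1_Hom: "LL1 \<alpha> f \<in> car (Hom HU HW)"
  unfolding LL1_def by (rule tlift_in_Hom[OF is_vspace_Hd is_vspace_U is_vspace_tensor LL1_bilin])

lemma LL1_pure: "\<beta> \<in> car Hd \<Longrightarrow> LL1 \<alpha> f (pure Hd UU \<beta> u) = pure Hd WW (conv \<alpha> \<beta>) (f u)"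
  unfolding LL1_def by (rule tlift_pure[OF is_vspace_Hd is_vspace_U is_vspace_tensor LL1_bilin]) simp_all

text \<open>On linear maps, multiplying functionals becomes convolution: the first leg of
  \<open>a\<close> goes to \<open>\<alpha>\<close>, the second to the given map.\<close>

lemma ev_LL1:
  assumes t: "t \<in> car HU"
  shows "ev WW (LL1 \<alpha> f t) a = sw a (\<lambda>p q. sW (\<alpha> p) (f (ev UU t q)))"
proof (rule linear_on_eq_tensor[OF _ _ vsW _ t])
  have fl: "lmap sU sW f" using f by (simp add: car_UW)
  show "linear_on (fscale (*)) sW (car HU) (\<lambda>t. ev WW (LL1 \<alpha> f t) a)"
    using LL1_Hom by (intro linear_on_compose[OF ev_linear_W]) (auto simp: Hom_def lin_iff)
  show "linear_on (fscale (*)) sW (car HU) (\<lambda>t. sw a (\<lambda>p q. sW (\<alpha> p) (f (ev UU t q))))"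
    unfolding sw_def
    by (intro linear_on_sum_fun[OF vsW]
        linear_on_compose[OF lmap_scale_right[OF vsW fl] ev_linear_U]) simp
  fix \<beta> u assume \<beta>: "\<beta> \<in> car Hd" and u: "u \<in> car UU"
  have "ev WW (LL1 \<alpha> f (pure Hd UU \<beta> u)) a = sW (conv \<alpha> \<beta> a) (f u)"
    by (simp add: LL1_pure \<beta> ev_pure[OF is_vspace_W' conv_Hd] \<alpha>)
  also have "\<dots> = sw a (\<lambda>p q. sW (\<alpha> p) (f (sU (\<beta> q) u)))"
    using \<alpha> \<beta> by (simp add: conv_eq car_Hd linear_on_scale[OF fl] sw_def W.M.scale_sum_left)
  finally show "ev WW (LL1 \<alpha> f (pure Hd UU \<beta> u)) a =
      sw a (\<lambda>p q. sW (\<alpha> p) (f (ev UU (pure Hd UU \<beta> u) q)))"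
    by (simp add: ev_pure[OF is_vspace_U \<beta>])
qed

end

lemma HUW_eqI:
  assumes "G \<in> car (Hom HU HW)" "G' \<in> car (Hom HU HW)"
    and "\<And>t a. t \<in> car HU \<Longrightarrow> ev WW (G t) a = ev WW (G' t) a"
  shows "G = G'"
proof
  fix t show "G t = G' t"
  proof (cases "t \<in> car HU")
    case True
    show ?thesis
      by (rule ev_inject[OF is_vspace_W']) (use assms True in \<open>auto simp: Hom_def lin_iff\<close>)
  qed (use assms in \<open>simp add: Hom_def\<close>)
qed

text \<open>Values of \<open>LL1\<close> are compared through the injective \<open>ev\<close>, where
  bilinearity can be read off the convolution formula.\<close>

lemma LL_bilin: "bilin Hd UW (Hom HU HW) LL1"
proof -
  interpret X: vector_space "scl (Hom HU HW)" by (rule is_vspaceD[OF is_vspace_HUW])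
  interpret D: vector_space "scl Hd" by (rule is_vspaceD[OF is_vspace_Hd])
  interpret UW: vector_space "scl UW" by (rule is_vspaceD[OF is_vspace_UW])
  note X_sub = X.subspace_add[OF is_vspaceD(2)[OF is_vspace_HUW]] X.subspace_scale[OF is_vspaceD(2)[OF is_vspace_HUW]]
  note D_sub = D.subspace_add[OF is_vspaceD(2)[OF is_vspace_Hd]] D.subspace_scale[OF is_vspaceD(2)[OF is_vspace_Hd]]
  note UW_sub = UW.subspace_add[OF is_vspaceD(2)[OF is_vspace_UW]] UW.subspace_scale[OF is_vspaceD(2)[OF is_vspace_UW]]
  have HWc: "LL1 \<alpha> f t \<in> car HW" if "\<alpha> \<in> car Hd" "f \<in> car UW" "t \<in> car HU" for \<alpha> f t
    using LL1_Hom[OF that(1,2)] that(3) by (simp add: Hom_def lin_iff)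
  have "linear_on (scl UW) (scl (Hom HU HW)) (car UW) (LL1 \<alpha>)" if \<alpha>: "\<alpha> \<in> car Hd" for \<alpha>
  proof (rule linear_onI)
    fix f g assume fg: "f \<in> car UW" "g \<in> car UW"
    show "LL1 \<alpha> (f + g) = LL1 \<alpha> f + LL1 \<alpha> g"
      by (rule HUW_eqI)
        (simp_all add: LL1_Hom X_sub UW_sub \<alpha> fg ev_LL1 HWc linear_on_add[OF ev_linear_W]
          W.M.scale_right_distrib sw_def sum.distrib)
  next
    fix c f assume f: "f \<in> car UW"
    have "fscale sW c f \<in> car UW" using UW_sub(2)[OF f] by simp
    then show "LL1 \<alpha> (scl UW c f) = scl (Hom HU HW) c (LL1 \<alpha> f)"
      by (intro HUW_eqI)
        (simp_all add: LL1_Hom X_sub \<alpha> f ev_LL1 HWc, simp add: scl_HUW linear_on_scale[OF ev_linear_W]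
          HWc ev_LL1 \<alpha> f sw_def W.M.scale_sum_right mult.commute)
  qed
  moreover have "linear_on (scl Hd) (scl (Hom HU HW)) (car Hd) (\<lambda>\<alpha>. LL1 \<alpha> f)" if f: "f \<in> car UW" for f
  proof (rule linear_onI)
    fix \<alpha> \<beta> assume ab: "\<alpha> \<in> car Hd" "\<beta> \<in> car Hd"
    show "LL1 (\<alpha> + \<beta>) f = LL1 \<alpha> f + LL1 \<beta> f"
      by (rule HUW_eqI)
        (simp_all add: LL1_Hom X_sub D_sub f ab ev_LL1 HWc linear_on_add[OF ev_linear_W]
          W.M.scale_left_distrib sw_def sum.distrib)
  next
    fix c \<alpha> assume \<alpha>: "\<alpha> \<in> car Hd"
    have "fscale (*) c \<alpha> \<in> car Hd" using D_sub(2)[OF \<alpha>] by simp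
    then show "LL1 (scl Hd c \<alpha>) f = scl (Hom HU HW) c (LL1 \<alpha> f)"
      by (intro HUW_eqI)
        (simp_all add: LL1_Hom X_sub \<alpha> f ev_LL1 HWc, simp add: scl_HUW linear_on_scale[OF ev_linear_W]
          HWc ev_LL1 \<alpha> f sw_def W.M.scale_sum_right)
  qed
  ultimately show ?thesis by (simp add: bilin_def lin_iff LL1_Hom)
qed

lemma LL_eq: "LL sU sW = tlift Hd UW (Hom HU HW) LL1"
  unfolding LL_def LL1_def[abs_def] ..

lemma LL_car: "z \<in> car (Hd \<otimes>\<^sub>v UW) \<Longrightarrow> LL sU sW z \<in> car (Hom HU HW)"
  unfolding LL_eq by (rule tlift_car[OF is_vspace_Hd is_vspace_UW is_vspace_HUW LL_bilin])

text \<open>An element of \<open>H^* \<otimes> Hom(U, W)\<close> is a linear map \<open>F\<close>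
  from \<open>H\<close> to \<open>Hom(U, W)\<close>, and \<open>LL\<close> lets it act on linear
  maps from \<open>H\<close> to \<open>U\<close> by convolution.\<close>

lemma ev_LL:
  assumes z: "z \<in> car (Hd \<otimes>\<^sub>v UW)" and t: "t \<in> car HU"
  shows "ev WW (LL sU sW z t) a = sw a (\<lambda>p q. ev UW z p (ev UU t q))"
proof -
  let ?f = "\<lambda>e. DF.tcomp UW e z"
  have fc: "?f e \<in> car UW" for e by (rule DF.tcomp_car[OF is_vspace_UW z])
  have "LL sU sW z t = (\<Sum>e\<in>B. LL1 (crd sH B e) (?f e) t)"
    unfolding LL_eq DF.tlift_eq_sum[OF is_vspace_UW is_vspace_HUW LL_bilin z] by (rule sum_fun_apply)
  then have "ev WW (LL sU sW z t) a = (\<Sum>e\<in>B. ev WW (LL1 (crd sH B e) (?f e) t) a)"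
    using LL1_Hom[OF crd_Hd fc] t
    by (simp add: linear_on_sum[OF ev_linear_W tensor_vs] Hom_def lin_iff)
  also have "\<dots> = sw a (\<lambda>p q. \<Sum>e\<in>B. sW (crd sH B e p) (?f e (ev UU t q)))"
    unfolding ev_LL1[OF crd_Hd fc t] sw_def by (rule sum.swap)
  finally show ?thesis by (simp add: ev_def[of UW] sum_fun_apply)
qed

text \<open>Read through \<open>ev\<close>, commuting with the \<open>K\<close>-actions is exactly
  the equation of \<open>stabilizer_condition\<close>, so the stabilizer corresponds to the module
  maps from \<open>H \<otimes> U\<close> to \<open>W\<close>.\<close>

lemma LL_Hom_iff:
  assumes z: "z \<in> car (Hd \<otimes>\<^sub>v UW)"
  shows "LL sU sW z \<in> Hom_dual_tensor sU actU sW actW \<longleftrightarrow> ev UW z \<in> HomM sW actW UNIV"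
proof -
  let ?F = "ev UW z"
  have lF: "lmap sH (fscale sW) ?F" using ev_lmap[OF is_vspace_UW, of z] by simp
  have F: "bmap sH sU sW ?F"
    using lF ev_car[OF is_vspace_UW z] by (auto simp: car_UW linear_on_def fun_eq_iff)
  note mU = U.left_module_over_axioms and mW = W.left_module_over_axioms
  have LHW: "LL sU sW z t \<in> car HW" if "t \<in> car HU" for t
    using LL_car[OF z] that by (simp add: Hom_def lin_iff)
  have eq: "LL sU sW z (dual_tensor_act sU actU x t) = dual_tensor_act sW actW x (LL sU sW z t) \<longleftrightarrow>
      (\<forall>a. sw a (\<lambda>p q. ?F p (co x (\<lambda>e y. actU y (ev UU t (T e * q))))) =
        co x (\<lambda>e y. actW y (sw (T e * a) (\<lambda>p q. ?F p (ev UU t q)))))" (is "?L = ?R \<longleftrightarrow> _")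
    if t: "t \<in> car HU" for x t
  proof -
    have xt: "dual_tensor_act sU actU x t \<in> car HU" by (rule dual_tensor_act_car[OF mU t])
    have "?L = ?R \<longleftrightarrow> ev WW ?L = ev WW ?R"
      using ev_inject[OF is_vspace_W' LHW[OF xt] dual_tensor_act_car[OF mW LHW[OF t]]] by auto
    then show ?thesis
      by (simp add: fun_eq_iff ev_LL[OF z xt] ev_dual_tensor_act[OF mU t]
          ev_dual_tensor_act[OF mW LHW[OF t]] ev_LL[OF z t])
  qed
  \<comment> \<open>\<open>ev\<close> is onto the linear maps from \<open>H\<close> to
    \<open>U\<close>, so quantifying over tensors amounts to quantifying over these.\<close>
  have all: "(\<forall>t\<in>car HU. P (ev UU t)) \<longleftrightarrow> (\<forall>g. lmap sH sU g \<longrightarrow> P g)" for P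
  proof (intro iffI allI impI ballI)
    fix g assume *: "\<forall>t\<in>car HU. P (ev UU t)" and g: "lmap sH sU g"
    have "P (ev UU (unev UU g))" using * by (auto intro!: unev_car[OF is_vspace_U])
    then show "P g" using ev_unev[OF is_vspace_U, of g] g by simp
  next
    fix t assume "\<forall>g. lmap sH sU g \<longrightarrow> P g"
    then show "P (ev UU t)" using ev_lmap[OF is_vspace_U, of t] by simp
  qed
  have "LL sU sW z \<in> Hom_dual_tensor sU actU sW actW \<longleftrightarrow>
      (\<forall>t\<in>car HU. \<forall>x a. sw a (\<lambda>p q. ?F p (co x (\<lambda>e y. actU y (ev UU t (T e * q))))) =
        co x (\<lambda>e y. actW y (sw (T e * a) (\<lambda>p q. ?F p (ev UU t q)))))"
    unfolding Hom_dual_tensor_def using LL_car[OF z] eq by auto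
  also have "\<dots> \<longleftrightarrow> (\<forall>x a u. actW x (?F a u) = co x (\<lambda>e y. ?F (e * a) (actU y u)))"
    unfolding all[of "\<lambda>g. \<forall>x a. sw a (\<lambda>p q. ?F p (co x (\<lambda>e y. actU y (g (T e * q))))) =
        co x (\<lambda>e y. actW y (sw (T e * a) (\<lambda>p q. ?F p (g q))))"]
    by (rule stabilizer_condition[OF F])
  finally show ?thesis using F by (simp add: HomM_def bilforms_def)
qed

lemma HomM_Hom:
  assumes "F \<in> HomM sW actW UNIV"
  shows "F a \<in> car UW" "lmap sH (scl UW) F"
  using assms by (auto simp: HomM_def bilforms_def car_UW linear_on_def fun_eq_iff)

lemma Stab_eq: "Stab sU actU sW actW = (\<lambda>F. LL sU sW (unev UW F)) ` HomM sW actW UNIV"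
proof (intro equalityI subsetI)
  fix G assume "G \<in> Stab sU actU sW actW"
  then obtain z where z: "z \<in> car (Hd \<otimes>\<^sub>v UW)" "G = LL sU sW z" "G \<in> Hom_dual_tensor sU actU sW actW"
    by (auto simp: Stab_def)
  then have "ev UW z \<in> HomM sW actW UNIV" using LL_Hom_iff[OF z(1)] by simp
  then show "G \<in> (\<lambda>F. LL sU sW (unev UW F)) ` HomM sW actW UNIV"
    using z(1,2) by (intro image_eqI[of _ _ "ev UW z"]) (simp_all add: unev_ev[OF is_vspace_UW])
next
  fix G assume "G \<in> (\<lambda>F. LL sU sW (unev UW F)) ` HomM sW actW UNIV"
  then obtain F where F: "F \<in> HomM sW actW UNIV" "G = LL sU sW (unev UW F)" by blast
  have z: "unev UW F \<in> car (Hd \<otimes>\<^sub>v UW)" by (rule unev_car[OF is_vspace_UW HomM_Hom(1)[OF F(1)]])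
  have "ev UW (unev UW F) = F" by (rule ev_unev[OF is_vspace_UW HomM_Hom(2,1)[OF F(1)]])
  then show "G \<in> Stab sU actU sW actW" using F z LL_Hom_iff[OF z] by (simp add: Stab_def)
qed

text \<open>The parametrization of the stabilizer by module maps is linear, so only its injectivity
  is at stake.\<close>

lemma dim_Stab_eq_hdim:
  assumes W: "kmod sW actW UNIV"
  shows "dim_Stab sU actU sW actW = hdim sW actW UNIV"
proof -
  let ?X = "HomM sW actW UNIV" and ?f = "\<lambda>F. LL sU sW (unev UW F)"
  let ?t = "fscale (fscale (*)) :: 'k \<Rightarrow> (((('h \<Rightarrow> 'k) \<Rightarrow> 'u \<Rightarrow> 'k) \<Rightarrow> 'k) \<Rightarrow> ((('h \<Rightarrow> 'k) \<Rightarrow> 'w \<Rightarrow> 'k) \<Rightarrow> 'k)) \<Rightarrow> _"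
  have t: "vector_space ?t" by (intro vector_space_fscale vector_space_ground)
  have LLlin: "linear_on (fscale (*)) ?t (car (Hd \<otimes>\<^sub>v UW)) (LL sU sW)"
    using tlift_linear[OF is_vspace_Hd is_vspace_UW is_vspace_HUW LL_bilin] by (simp add: LL_eq scl_HUW)
  have "linear_on (fscale (fscale sW)) (fscale (*)) {g. \<forall>a. g a \<in> car UW} (unev UW)"
    using unev_linear[OF is_vspace_UW] by simp
  then have "linear_on (fscale (fscale sW)) (fscale (*)) ?X (unev UW)"
    by (rule linear_on_subset) (auto simp: HomM_Hom(1))
  then have lin: "linear_on (fscale (fscale sW)) ?t ?X ?f"
    by (rule linear_on_compose[OF LLlin]) (auto intro!: unev_car[OF is_vspace_UW] HomM_Hom(1))
  have inj: "F = 0" if F: "F \<in> ?X" and 0: "?f F = 0" for F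
  proof (intro ext)
    fix a u
    \<comment> \<open>Convolving \<open>F\<close> with this map returns \<open>F a u\<close> by the
      counit, so \<open>F\<close> is recovered from the operator it defines.\<close>
    let ?g = "\<lambda>q. sU (\<epsilon> q) u"
    have g: "lmap sH sU ?g" by (auto intro!: lin_intros vsU)
    have z: "unev UW F \<in> car (Hd \<otimes>\<^sub>v UW)" by (rule unev_car[OF is_vspace_UW HomM_Hom(1)[OF F]])
    have t: "unev UU ?g \<in> car HU" by (rule unev_car[OF is_vspace_U]) simp
    have "ev WW (?f F (unev UU ?g)) a = sw a (\<lambda>p q. F p (?g q))"
      using ev_unev[OF is_vspace_UW HomM_Hom(2,1)[OF F]] ev_unev[OF is_vspace_U, of ?g] g
      by (simp add: ev_LL[OF z t])
    also have "\<dots> = sw a (\<lambda>p q. sW (\<epsilon> q) (F p u))"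
      by (simp add: linear_on_scale[OF HomM_lmap(1)[OF F]])
    also have "\<dots> = F a u" by (rule sw_counit_right[OF vsW HomM_lmap(2)[OF F]])
    finally show "F a u = 0 a u"
      using linear_on_0[OF ev_linear_W tensor_vs, of a] by (simp add: 0)
  qed
  show ?thesis
    unfolding dim_Stab_def Stab_eq scl_HUW hdim_def
    by (rule dim_image_inj[OF HomM_findim[OF W] t lin inj])
qed

end

theorem proposition2p16:
  fixes sH :: "'k::{alg_closed_field, field_char_0} \<Rightarrow> 'h::ring_1 \<Rightarrow> 'h"
    and \<Delta> :: "'h \<Rightarrow> ('h \<Rightarrow> 'h \<Rightarrow> 'k) \<Rightarrow> 'k"
    and \<epsilon> :: "'h \<Rightarrow> 'k"
    and S :: "'h \<Rightarrow> 'h"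
    and sK :: "'k \<Rightarrow> 'a::{ring, monoid_mult} \<Rightarrow> 'a"
    and \<rho> :: "'a \<Rightarrow> ('h \<Rightarrow> 'a \<Rightarrow> 'k) \<Rightarrow> 'k"
    and sU :: "'k \<Rightarrow> 'u::ab_group_add \<Rightarrow> 'u" and actU :: "'a \<Rightarrow> 'u \<Rightarrow> 'u"
    and sW :: "'k \<Rightarrow> 'w::ab_group_add \<Rightarrow> 'w" and actW :: "'a \<Rightarrow> 'w \<Rightarrow> 'w"
  assumes "hopf_algebra sH \<Delta> \<epsilon> S" and "finite_dim sH"
    and "left_comodule_algebra sH \<Delta> \<epsilon> S sK \<rho>" and "finite_dim sK" and "H_simple sH sK \<rho>"
    and "left_module_over sK sU actU" and "finite_dim sU"
    and "left_module_over sK sW actW" and "finite_dim sW"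
  shows "vector_space.dim sK UNIV *
           left_comodule_algebra.dim_Stab sH \<Delta> S sK \<rho> sU actU sW actW =
         vector_space.dim sU UNIV * vector_space.dim sW UNIV * vector_space.dim sH UNIV"
proof -
  obtain B BK BU BW where B: "finite_dimensional_vector_space sH B"
    and BK: "finite_dimensional_vector_space sK BK"
    and BU: "finite_dimensional_vector_space sU BU"
    and BW: "finite_dimensional_vector_space sW BW"
    using assms(2,4,7,9) unfolding finite_dim_def by blast
  interpret H': hopf_algebra sH \<Delta> \<epsilon> S by fact
  interpret K': left_comodule_algebra sH \<Delta> \<epsilon> S sK \<rho> by fact
  interpret U': left_module_over sK sU actU by fact
  interpret W': left_module_over sK sW actW by fact
  interpret HB': finite_dimensional_vector_space sH B by fact
  interpret KB': finite_dimensional_vector_space sK BK by fact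
  interpret UB': finite_dimensional_vector_space sU BU by fact
  interpret WB': finite_dimensional_vector_space sW BW by fact
  interpret A: fd_setting sH \<Delta> \<epsilon> S B sK \<rho> sU actU BU BK
    by unfold_locales
  interpret A: fd_stab sH \<Delta> \<epsilon> S B sK \<rho> sU actU BU sW actW
    by unfold_locales
  have W: "A.kmod sW actW UNIV"
    unfolding A.kmod_def
    using WB'.findim_UNIV A.actW_right A.actW_left by (simp add: W'.act_one W'.act_mult)
  show ?thesis
    using A.hdim_eq[OF assms(5) W] by (simp add: A.dim_Stab_eq_hdim[OF W])
qed

end
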